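(* If $K$ is polynomial in the input, then $$\text{Bounded-}K\text{-Adaptability}(\mathcal{X}_d,\mathcal{U}_d(x),\mathcal{Y}_d)\ \le\ \text{Bounded-}1\text{-Adaptability}(\mathcal{X}_d,\mathcal{U}_d(x),\mathcal{Y}_d),$$ i.e. the former decision problem is polynomial-time many-one reducible to the latter.
   Context: An instance consists of rational data encoded in binary: a bound $R\in\mathbb{Z}_+$, vectors $a\in\mathbb{Q}^{m_x}$, $b\in\mathbb{Q}^{m_u}$, matrices $A\in\mathbb{Q}^{m_x\times n_x}$, $W\in\mathbb{Q}^{m_y\times n_y}$, an $m_u\times n_u$ matrix $B(x)$ whose entries depend linearly on $x$ with rational coefficients, and an $m_y\times n_x$ matrix $T(u)$ whose entries depend linearly on $u$ with rational coefficients. (Affine dependence can be modelled by auxiliary coordinates of $x$ and $u$ fixed to $1$.) The sets are $\mathcal{X}_d=\{x\in[0,R]^{n_x}\cap\mathbb{Z}^{n_x}: Ax\le a\}$, $\mathcal{U}_d(x)=\{u\in[0,R]^{n_u}\cap\mathbb{Z}^{n_u}: B(x)u\le b\}$, $\mathcal{Y}_d(x,u)=\{y\in[0,R]^{n_y}\cap\mathbb{Z}^{n_y}: T(u)x+Wy\le 0\}$. Bounded-$K$-Adaptability$(\mathcal{X}_d,\mathcal{U}_d(x),\mathcal{Y}_d)$ is the decision problem $$\exists x\in\mathcal{X}_d,\ y^1,\dots,y^K\in\mathbb{R}^{n_y}\ \ \forall u\in\mathcal{U}_d(x):\ \{y^1,\dots,y^K\}\cap\mathcal{Y}_d(x,u)\neq\emptyset\,?$$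 Here $K$ is given by a function of the input, the function itself not being part of the input (constant $K$ is a special case). "$K$ is polynomial in the input" means that $K$ is bounded by a polynomial in the encoding length of the instance (this includes constant $K$). $P\le Q$ means that decision problem $P$ reduces to $Q$ by a polynomial-time many-one reduction.
   Formalization: The formal theorem also assumes that the function giving K is computable in polynomial time; for arbitrary polynomially bounded K the claim fails, e.g. when K takes values in {1,2} chosen by an undecidable property of the instance. *)

theory Defs
  imports
    "Jordan_Normal_Form.Matrix"
    "HOL-Computational_Algebra.Polynomial"
begin

section \<open>Deterministic multi-tape Turing machines\<close>

text \<open>
  The tape alphabet is fixed to blank (\<open>None\<close>) and the two bits. Tapes are infinite in both
  directions.
\<close>

type_synonym symbol = "bool option"

datatype move = Move_Left | Stay | Move_Right

record tape =
  cell :: "int \<Rightarrow> symbol"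
  pos :: int

fun move_offset :: "move \<Rightarrow> int" where
  "move_offset Move_Left = -1"
| "move_offset Stay = 0"
| "move_offset Move_Right = 1"

definition scan :: "tape \<Rightarrow> symbol" where
  "scan t = cell t (pos t)"

definition act :: "symbol \<times> move \<Rightarrow> tape \<Rightarrow> tape" where
  "act a t = \<lparr>cell = (cell t)(pos t := fst a), pos = pos t + move_offset (snd a)\<rparr>"

definition blank_tape :: tape where
  "blank_tape = \<lparr>cell = (\<lambda>_. None), pos = 0\<rparr>"

definition word_tape :: "bool list \<Rightarrow> tape" where
  "word_tape w =
     \<lparr>cell = (\<lambda>i. if 0 \<le> i \<and> i < int (length w) then Some (w ! nat i) else None), pos = 0\<rparr>"

text \<open>A tape presents the word that starts at the head position and ends before the next blank.\<close>

definition presents :: "tape \<Rightarrow> bool list \<Rightarrow> bool" where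
  "presents t w \<longleftrightarrow>
     (\<forall>i<length w. cell t (pos t + int i) = Some (w ! i)) \<and>
     cell t (pos t + int (length w)) = None"

text \<open>
  The states of a machine are \<open>0, \<dots>, states M\<close>; state \<open>0\<close> is initial and \<open>states M\<close> is the only
  halting state. By well-formedness only finitely many values of \<open>delta M\<close> are ever used.
\<close>

record tm =
  tapes :: nat
  states :: nat
  delta :: "nat \<Rightarrow> symbol list \<Rightarrow> nat \<times> (symbol \<times> move) list"

definition wf_tm :: "tm \<Rightarrow> bool" where
  "wf_tm M \<longleftrightarrow> 1 \<le> tapes M \<and>
     (\<forall>q < states M. \<forall>ss. length ss = tapes M \<longrightarrow>
        fst (delta M q ss) \<le> states M \<and> length (snd (delta M q ss)) = tapes M)"

type_synonym config = "nat \<times> tape list"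

definition step :: "tm \<Rightarrow> config \<Rightarrow> config" where
  "step M c = (case c of (q, ts) \<Rightarrow>
     if q < states M
     then (case delta M q (map scan ts) of (q', as) \<Rightarrow> (q', map2 act as ts))
     else (q, ts))"

text \<open>The input is on the first tape, the output is read from the last one.\<close>

definition init_config :: "tm \<Rightarrow> bool list \<Rightarrow> config" where
  "init_config M w = (0, word_tape w # replicate (tapes M - 1) blank_tape)"

definition computes_within :: "tm \<Rightarrow> bool list \<Rightarrow> bool list \<Rightarrow> nat \<Rightarrow> bool" where
  "computes_within M w v t \<longleftrightarrow>
     (\<exists>n\<le>t. case (step M ^^ n) (init_config M w) of (q, ts) \<Rightarrow>
        q = states M \<and> presents (last ts) v)"

section \<open>Polynomial-time computability and many-one reductions\<close>

definition polytime_computable ::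
    "'a set \<Rightarrow> ('a \<Rightarrow> bool list) \<Rightarrow> ('b \<Rightarrow> bool list) \<Rightarrow> ('a \<Rightarrow> 'b) \<Rightarrow> bool" where
  "polytime_computable S enc enc' f \<longleftrightarrow>
     (\<exists>M (p :: nat poly). wf_tm M \<and>
        (\<forall>a\<in>S. computes_within M (enc a) (enc' (f a)) (poly p (length (enc a)))))"

record 'a decision_problem =
  instances :: "'a set"
  encoding :: "'a \<Rightarrow> bool list"
  accepted :: "'a \<Rightarrow> bool"

definition polytime_reducible ::
    "'a decision_problem \<Rightarrow> 'b decision_problem \<Rightarrow> bool"  (infix \<open>\<le>\<^sub>p\<close> 50) where
  "P \<le>\<^sub>p Q \<longleftrightarrow>
     (\<exists>f. f \<in> instances P \<rightarrow> instances Q \<and>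
        polytime_computable (instances P) (encoding P) (encoding Q) f \<and>
        (\<forall>I\<in>instances P. accepted P I \<longleftrightarrow> accepted Q (f I)))"

section \<open>Instances of bounded adaptability problems\<close>

text \<open>
  The coefficients of \<open>B(x)\<close> are given by one matrix per coordinate of \<open>x\<close>, those of \<open>T(u)\<close> by one
  matrix per coordinate of \<open>u\<close>, i.e. \<open>B(x) = (\<Sum>k. x\<^sub>k B\<^sub>k)\<close> and \<open>T(u) = (\<Sum>k. u\<^sub>k T\<^sub>k)\<close>.
\<close>

record adapt_inst =
  nx :: nat
  nu :: nat
  ny :: nat
  mx :: nat
  mu :: nat
  my :: nat
  bound :: nat
  a_vec :: "rat vec"
  b_vec :: "rat vec"
  A_mat :: "rat mat"
  W_mat :: "rat mat"
  B_mats :: "rat mat list"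
  T_mats :: "rat mat list"

definition adapt_insts :: "adapt_inst set" where
  "adapt_insts = {I.
     a_vec I \<in> carrier_vec (mx I) \<and>
     b_vec I \<in> carrier_vec (mu I) \<and>
     A_mat I \<in> carrier_mat (mx I) (nx I) \<and>
     W_mat I \<in> carrier_mat (my I) (ny I) \<and>
     length (B_mats I) = nx I \<and> set (B_mats I) \<subseteq> carrier_mat (mu I) (nu I) \<and>
     length (T_mats I) = nu I \<and> set (T_mats I) \<subseteq> carrier_mat (my I) (nx I)}"

definition lin_mat :: "nat \<Rightarrow> nat \<Rightarrow> rat mat list \<Rightarrow> real vec \<Rightarrow> real mat" where
  "lin_mat m n Cs z =
     mat m n (\<lambda>(i, j). \<Sum>k<length Cs. z $ k * real_of_rat ((Cs ! k) $$ (i, j)))"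

definition B_of :: "adapt_inst \<Rightarrow> real vec \<Rightarrow> real mat" where
  "B_of I x = lin_mat (mu I) (nu I) (B_mats I) x"

definition T_of :: "adapt_inst \<Rightarrow> real vec \<Rightarrow> real mat" where
  "T_of I u = lin_mat (my I) (nx I) (T_mats I) u"

definition int_box :: "nat \<Rightarrow> nat \<Rightarrow> real vec set" where
  "int_box R n = {v \<in> carrier_vec n. \<forall>i<n. v $ i \<in> {0..real R} \<inter> \<int>}"

definition X_d :: "adapt_inst \<Rightarrow> real vec set" where
  "X_d I = {x \<in> int_box (bound I) (nx I).
     map_mat real_of_rat (A_mat I) *\<^sub>v x \<le> map_vec real_of_rat (a_vec I)}"

definition U_d :: "adapt_inst \<Rightarrow> real vec \<Rightarrow> real vec set" where
  "U_d I x = {u \<in> int_box (bound I) (nu I).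
     B_of I x *\<^sub>v u \<le> map_vec real_of_rat (b_vec I)}"

definition Y_d :: "adapt_inst \<Rightarrow> real vec \<Rightarrow> real vec \<Rightarrow> real vec set" where
  "Y_d I x u = {y \<in> int_box (bound I) (ny I).
     T_of I u *\<^sub>v x + map_mat real_of_rat (W_mat I) *\<^sub>v y \<le> 0\<^sub>v (my I)}"

definition adaptable :: "nat \<Rightarrow> adapt_inst \<Rightarrow> bool" where
  "adaptable k I \<longleftrightarrow>
     (\<exists>x \<in> X_d I. \<exists>y \<in> {1..k} \<rightarrow> carrier_vec (ny I).
        \<forall>u \<in> U_d I x. y ` {1..k} \<inter> Y_d I x u \<noteq> {})"

section \<open>Binary encoding\<close>

text \<open>Binary digits, least significant digit first, without leading zeros.\<close>

fun bits :: "nat \<Rightarrow> bool list" where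
  "bits n = (if n = 0 then [] else odd n # bits (n div 2))"

declare bits.simps [simp del]

text \<open>
  All encodings below are self-delimiting, so that they can be concatenated: each element of a
  list is preceded by \<open>True\<close>, and the list is terminated by \<open>False\<close>. The dimensions are written in
  unary, since the encoding length is at least the number of variables and constraints even when
  a matrix has no rows or no columns.
\<close>

definition enc_list :: "('a \<Rightarrow> bool list) \<Rightarrow> 'a list \<Rightarrow> bool list" where
  "enc_list e xs = concat (map (\<lambda>x. True # e x) xs) @ [False]"

definition enc_unary :: "nat \<Rightarrow> bool list" where
  "enc_unary n = replicate n True @ [False]"

definition enc_nat :: "nat \<Rightarrow> bool list" where
  "enc_nat n = enc_list (\<lambda>b. [b]) (bits n)"

definition enc_int :: "int \<Rightarrow> bool list" where
  "enc_int i = (i < 0) # enc_nat (nat \<bar>i\<bar>)"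

definition enc_rat :: "rat \<Rightarrow> bool list" where
  "enc_rat r = (case quotient_of r of (p, q) \<Rightarrow> enc_int p @ enc_nat (nat q))"

definition enc_vec :: "rat vec \<Rightarrow> bool list" where
  "enc_vec v = enc_list enc_rat (list_of_vec v)"

definition enc_mat :: "rat mat \<Rightarrow> bool list" where
  "enc_mat M = enc_list (enc_list enc_rat) (mat_to_list M)"

definition enc_inst :: "adapt_inst \<Rightarrow> bool list" where
  "enc_inst I =
     enc_unary (nx I) @ enc_unary (nu I) @ enc_unary (ny I) @
     enc_unary (mx I) @ enc_unary (mu I) @ enc_unary (my I) @
     enc_nat (bound I) @
     enc_vec (a_vec I) @ enc_vec (b_vec I) @
     enc_mat (A_mat I) @ enc_mat (W_mat I) @
     enc_list enc_mat (B_mats I) @ enc_list enc_mat (T_mats I)"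

section \<open>The decision problems\<close>

definition bounded_adaptability :: "(adapt_inst \<Rightarrow> nat) \<Rightarrow> adapt_inst decision_problem" where
  "bounded_adaptability K =
     \<lparr>instances = adapt_insts, encoding = enc_inst, accepted = (\<lambda>I. adaptable (K I) I)\<rparr>"

definition polynomial_in_input :: "(adapt_inst \<Rightarrow> nat) \<Rightarrow> bool" where
  "polynomial_in_input K \<longleftrightarrow>
     (\<exists>p :: nat poly. \<forall>I\<in>adapt_insts. K I \<le> poly p (length (enc_inst I)))"

section \<open>The encoding is injective\<close>

definition prefix_code :: "'a set \<Rightarrow> ('a \<Rightarrow> bool list) \<Rightarrow> bool" where
  "prefix_code S e \<longleftrightarrow> (\<forall>x\<in>S. \<forall>y\<in>S. \<forall>r s. e x @ r = e y @ s \<longrightarrow> x = y \<and> r = s)"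

lemma prefix_codeD:
  "prefix_code S e \<Longrightarrow> e x @ r = e y @ s \<Longrightarrow> x \<in> S \<Longrightarrow> y \<in> S \<Longrightarrow> x = y \<and> r = s"
  unfolding prefix_code_def by blast

lemma prefix_code_enc_list:
  assumes "prefix_code S e"
  shows "prefix_code (lists S) (enc_list e)"
proof -
  have "xs = ys \<and> r = s"
    if "enc_list e xs @ r = enc_list e ys @ s" "xs \<in> lists S" "ys \<in> lists S" for xs ys r s
    using that
  proof (induction xs arbitrary: ys)
    case Nil
    then show ?case by (cases ys) (auto simp: enc_list_def)
  next
    case (Cons x xs)
    then obtain z zs where ys: "ys = z # zs"
      by (cases ys) (auto simp: enc_list_def)
    with Cons.prems have "e x @ enc_list e xs @ r = e z @ enc_list e zs @ s"
      by (simp add: enc_list_def)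
    with prefix_codeD[OF assms] Cons.prems ys
    have "x = z \<and> enc_list e xs @ r = enc_list e zs @ s" by auto
    with Cons ys show ?case by auto
  qed
  then show ?thesis unfolding prefix_code_def by blast
qed

lemma prefix_code_inj:
  assumes "prefix_code T e" "inj_on g S" "g ` S \<subseteq> T"
  shows "prefix_code S (\<lambda>x. e (g x))"
  using assms unfolding prefix_code_def inj_on_def by blast

lemma prefix_code_unary: "prefix_code UNIV enc_unary"
proof -
  have "m = n \<and> r = s" if "enc_unary m @ r = enc_unary n @ s" for m n r s
    using that
  proof (induction m arbitrary: n)
    case 0
    then show ?case by (cases n) (auto simp: enc_unary_def)
  next
    case (Suc m)
    then show ?case by (cases n) (auto simp: enc_unary_def)
  qed
  then show ?thesis unfolding prefix_code_def by blast
qed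

lemma inj_bits: "inj bits"
proof (rule injI)
  fix m n :: nat
  assume "bits m = bits n"
  then show "m = n"
  proof (induction m arbitrary: n rule: less_induct)
    case (less m)
    show ?case
    proof (cases "m = 0 \<or> n = 0")
      case True
      with less.prems show ?thesis
        by (auto simp: bits.simps[of m] bits.simps[of n] split: if_splits)
    next
      case False
      with less.prems have "odd m = odd n" "bits (m div 2) = bits (n div 2)"
        by (auto simp: bits.simps[of m] bits.simps[of n])
      moreover from this(2) False have "m div 2 = n div 2"
        by (intro less.IH) auto
      ultimately show ?thesis by presburger
    qed
  qed
qed

lemma prefix_code_nat: "prefix_code UNIV enc_nat"
proof -
  have "prefix_code (lists UNIV) (enc_list (\<lambda>b. [b]))"
    by (rule prefix_code_enc_list) (auto simp: prefix_code_def)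
  then have "prefix_code UNIV (\<lambda>n. enc_list (\<lambda>b. [b]) (bits n))"
    by (rule prefix_code_inj) (auto intro: inj_bits)
  then show ?thesis by (simp add: enc_nat_def[abs_def])
qed

lemma prefix_code_rat: "prefix_code UNIV enc_rat"
proof -
  have "x = y \<and> r = s" if eq: "enc_rat x @ r = enc_rat y @ s" for x y r s
  proof -
    obtain p q where x: "quotient_of x = (p, q)" by force
    obtain p' q' where y: "quotient_of y = (p', q')" by force
    from eq have 1: "(p < 0) = (p' < 0)"
      and 2: "enc_nat (nat \<bar>p\<bar>) @ enc_nat (nat q) @ r = enc_nat (nat \<bar>p'\<bar>) @ enc_nat (nat q') @ s"
      by (auto simp: enc_rat_def enc_int_def x y)
    from prefix_codeD[OF prefix_code_nat 2]
    have 3: "nat \<bar>p\<bar> = nat \<bar>p'\<bar>" and 4: "enc_nat (nat q) @ r = enc_nat (nat q') @ s" by auto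
    from prefix_codeD[OF prefix_code_nat 4] have 5: "nat q = nat q'" "r = s" by auto
    have "p = p'" using 1 3 by auto
    moreover have "q = q'"
      using 5 quotient_of_denom_pos[OF x] quotient_of_denom_pos[OF y] by auto
    ultimately show ?thesis using 5 x y by (metis quotient_of_div)
  qed
  then show ?thesis unfolding prefix_code_def by blast
qed

lemma prefix_code_vec: "prefix_code UNIV enc_vec"
proof -
  have "inj list_of_vec"
    by (rule injI) (metis vec_list)
  then have "prefix_code UNIV (\<lambda>v. enc_list enc_rat (list_of_vec v))"
    by (intro prefix_code_inj[OF prefix_code_enc_list[OF prefix_code_rat]]) auto
  then show ?thesis by (simp add: enc_vec_def[abs_def])
qed

lemma prefix_code_mat: "prefix_code (carrier_mat m n) enc_mat"
proof -
  have "M = N"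
    if "M \<in> carrier_mat m n" "N \<in> carrier_mat m n" "mat_to_list M = mat_to_list N"
    for M N :: "rat mat"
  proof (rule eq_matI)
    fix i j assume "i < dim_row N" "j < dim_col N"
    then have "mat_to_list M ! i ! j = M $$ (i, j)" "mat_to_list N ! i ! j = N $$ (i, j)"
      using that by (auto simp: mat_to_list_def)
    with that show "M $$ (i, j) = N $$ (i, j)" by simp
  qed (use that in auto)
  then have "inj_on mat_to_list (carrier_mat m n :: rat mat set)"
    by (auto intro: inj_onI)
  then have "prefix_code (carrier_mat m n) (\<lambda>M. enc_list (enc_list enc_rat) (mat_to_list M))"
    by (intro prefix_code_inj[OF prefix_code_enc_list[OF prefix_code_enc_list[OF prefix_code_rat]]])
      auto
  then show ?thesis by (simp add: enc_mat_def[abs_def])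
qed

lemma inj_on_enc_inst: "inj_on enc_inst adapt_insts"
proof (rule inj_onI)
  fix I J
  assume I: "I \<in> adapt_insts" and J: "J \<in> adapt_insts" and eq: "enc_inst I = enc_inst J"
  note u = prefix_codeD[OF prefix_code_unary _ UNIV_I UNIV_I]
  note v = prefix_codeD[OF prefix_code_vec _ UNIV_I UNIV_I]
  note m = prefix_codeD[OF prefix_code_mat]
  note ml = prefix_codeD[OF prefix_code_enc_list[OF prefix_code_mat]]
  from eq[unfolded enc_inst_def] have d1: "nx I = nx J"
    and e: "enc_unary (nu I) @ enc_unary (ny I) @ enc_unary (mx I) @ enc_unary (mu I) @
      enc_unary (my I) @ enc_nat (bound I) @ enc_vec (a_vec I) @ enc_vec (b_vec I) @
      enc_mat (A_mat I) @ enc_mat (W_mat I) @ enc_list enc_mat (B_mats I) @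
      enc_list enc_mat (T_mats I) =
      enc_unary (nu J) @ enc_unary (ny J) @ enc_unary (mx J) @ enc_unary (mu J) @
      enc_unary (my J) @ enc_nat (bound J) @ enc_vec (a_vec J) @ enc_vec (b_vec J) @
      enc_mat (A_mat J) @ enc_mat (W_mat J) @ enc_list enc_mat (B_mats J) @
      enc_list enc_mat (T_mats J)"
    by (auto dest!: u)
  note d2 = u[OF e]
  note d3 = u[OF d2[THEN conjunct2]]
  note d4 = u[OF d3[THEN conjunct2]]
  note d5 = u[OF d4[THEN conjunct2]]
  note d6 = u[OF d5[THEN conjunct2]]
  note d7 = prefix_codeD[OF prefix_code_nat d6[THEN conjunct2] UNIV_I UNIV_I]
  note d8 = v[OF d7[THEN conjunct2]]
  note d9 = v[OF d8[THEN conjunct2]]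
  note dims = d1 d2[THEN conjunct1] d3[THEN conjunct1] d4[THEN conjunct1] d5[THEN conjunct1]
    d6[THEN conjunct1]
  have carr: "A_mat I \<in> carrier_mat (mx I) (nx I)" "A_mat J \<in> carrier_mat (mx I) (nx I)"
    "W_mat I \<in> carrier_mat (my I) (ny I)" "W_mat J \<in> carrier_mat (my I) (ny I)"
    "B_mats I \<in> lists (carrier_mat (mu I) (nu I))" "B_mats J \<in> lists (carrier_mat (mu I) (nu I))"
    "T_mats I \<in> lists (carrier_mat (my I) (nx I))" "T_mats J \<in> lists (carrier_mat (my I) (nx I))"
    using I J dims by (auto simp: adapt_insts_def)
  note d10 = m[OF d9[THEN conjunct2] carr(1,2)]
  note d11 = m[OF d10[THEN conjunct2] carr(3,4)]
  note d12 = ml[OF d11[THEN conjunct2] carr(5,6)]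
  have d13: "enc_list enc_mat (T_mats I) @ [] = enc_list enc_mat (T_mats J) @ []"
    using d12[THEN conjunct2] by simp
  note d14 = ml[OF d13 carr(7,8)]
  show "I = J"
    using dims d7 d8 d9 d10 d11 d12 d14 by simp
qed

end

theory Submission
  imports Defs
begin

text \<open>
  In the new instance the here-and-now decision consists of \<open>x\<close> together with all candidates
  \<open>y\<^sup>1, \<dots>, y\<^sup>K\<close>. The adversary picks \<open>u\<close> and, for every \<open>i\<close>, marks a row of \<open>T(u) x + W y\<^sup>i \<le> 0\<close> that is
  claimed to be violated; a big-M constraint makes each marked row strictly violated. The products of
  the entries of \<open>u\<close> and \<open>x\<close> are available because the uncertainty set may depend bilinearly on both.
  The recourse constraints of the new instance are infeasible, so the adversary loses only if no such
  \<open>u\<close> exists. With \<open>L\<close> the encoding length, a positive left-hand side is at least \<open>2\<^sup>-\<^sup>L\<close> and its absolute value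
  is at most of order \<open>2\<^sup>5\<^sup>L\<close>; hence \<open>\<epsilon> = 2\<^sup>-\<^sup>L\<close> and \<open>M = 2\<^sup>6\<^sup>L\<close> work, and writing them down needs no arithmetic.

  For the running time, every tape is used as a stack. All encodings are prefix codes, so that a
  value on top of a stack can be consumed without knowing what lies below it. The functions computable
  in this way in polynomial time are closed under composition, pairing and iteration over lists with
  polynomially bounded intermediate results, which is enough to express the reduction.
\<close>

section \<open>Stack programs on Turing machines\<close>

text \<open>For a fixed \<open>x\<close> and fixed candidates, a scenario \<open>u\<close> defeats
  them iff for every \<open>i\<close> some row is violated by \<open>y\<^sup>i\<close>. This is
  again an existential statement, with only \<open>K\<close> times \<open>my I\<close> additional
  unknowns, so the universal quantifier over \<open>u\<close> and the choice of a suitable candidate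
  collapse into the emptiness of one uncertainty set. Non-strict inequalities cannot express a
  violation directly; integrality and rational data leave a gap above 0 that can be used instead.
  Since \<open>B(x) u\<close> is homogeneous in both arguments, every term lacking one of them (such
  as \<epsilon>, the big-M terms and \<open>W y\<^sup>i\<close>) needs a factor 1 on the other side,
  which is the purpose of the constant coordinates.

  On the machine side the obstacle is that \<open>K\<close> is not part of the input. The reduction
  has to run a given machine that delivers \<open>K\<close> in binary and may destroy its input, so
  the input is saved first. Candidates are then enumerated by iteration over the unary form of
  \<open>K\<close>, whose length is polynomial because \<open>K\<close> is.\<close>

definition halts_in :: "tm \<Rightarrow> tape list \<Rightarrow> nat \<Rightarrow> tape list \<Rightarrow> bool" where
  "halts_in M ts t ts' \<longleftrightarrow> (\<exists>n\<le>t. (step M ^^ n) (0, ts) = (states M, ts'))"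

definition idle :: "symbol list \<Rightarrow> (symbol \<times> move) list" where
  "idle = map (\<lambda>s. (s, Stay))"

lemma length_idle [simp]: "length (idle ss) = length ss"
  by (simp add: idle_def)

lemma act_idle [simp]: "act (scan t, Stay) t = t"
  by (simp add: act_def scan_def)

lemma map2_act_idle [simp]: "map2 act (idle (map scan ts)) ts = ts"
  by (induction ts) (auto simp: idle_def)

lemma map2_act_update:
  assumes "i < length ts"
  shows "map2 act ((idle (map scan ts))[i := a]) ts = ts[i := act a (ts ! i)]"
proof -
  have "map2 act ((idle (map scan ts))[i := a]) (ts[i := ts ! i]) =
      (map2 act (idle (map scan ts)) ts)[i := act a (ts ! i)]"
    by (simp only: map_update zip_update) (simp add: map_update)
  then show ?thesis by simp
qed

lemma wf_tmD:
  assumes "wf_tm M" "q < states M" "length ss = tapes M"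
  shows "fst (delta M q ss) \<le> states M" "length (snd (delta M q ss)) = tapes M"
  using assms by (auto simp: wf_tm_def)

text \<open>\<open>\<phi>\<close> places the states of \<open>M\<close> inside a larger machine,
  while \<open>m\<close> further tapes stay idle. The image of the halting state may be a state in
  which \<open>M'\<close> goes on, as sequencing and looping require. Steps that \<open>M\<close>
  spends in its halting state are dropped, hence \<open>n' \<le> n\<close>.\<close>

lemma simulate:
  assumes "wf_tm M"
    and sim: "\<And>q ss. q < states M \<Longrightarrow> length ss = tapes M + m \<Longrightarrow> \<phi> q < states M' \<and>
      delta M' (\<phi> q) ss = (\<phi> (fst (delta M q (take (tapes M) ss))),
        snd (delta M q (take (tapes M) ss)) @ idle (drop (tapes M) ss))"
    and "length ts = tapes M" "length us = m" "q \<le> states M"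
    and "(step M ^^ n) (q, ts) = (states M, ts')"
  shows "\<exists>n'\<le>n. (step M' ^^ n') (\<phi> q, ts @ us) = (\<phi> (states M), ts' @ us)"
  using assms(3-6)
proof (induction n arbitrary: q ts)
  case 0
  then show ?case by auto
next
  case (Suc n)
  show ?case
  proof (cases "q = states M")
    case True
    have "step M (states M, ts) = (states M, ts)" for ts
      by (simp add: step_def)
    then have "(step M ^^ k) (states M, ts) = (states M, ts)" for k
      by (induction k) auto
    from this[of "Suc n"] Suc.prems(4) True have "ts' = ts" by (simp del: funpow.simps)
    with True show ?thesis by (intro exI[of _ 0]) auto
  next
    case False
    with Suc.prems have q: "q < states M" by simp
    obtain q1 as where d: "delta M q (map scan ts) = (q1, as)" by force
    have len: "length as = tapes M" and q1: "q1 \<le> states M"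
      using wf_tmD[OF \<open>wf_tm M\<close> q, of "map scan ts"] d Suc.prems(1) by auto
    have s: "step M (q, ts) = (q1, map2 act as ts)"
      using q d by (simp add: step_def)
    have s': "step M' (\<phi> q, ts @ us) = (\<phi> q1, map2 act as ts @ us)"
      using sim[OF q, of "map scan ts @ map scan us"] d Suc.prems(1,2) len
      by (simp add: step_def)
    have "\<exists>n'\<le>n. (step M' ^^ n') (\<phi> q1, map2 act as ts @ us) = (\<phi> (states M), ts' @ us)"
      using Suc.prems len q1 s by (intro Suc.IH) (simp_all add: funpow_swap1)
    then obtain n' where "n' \<le> n"
      "(step M' ^^ n') (\<phi> q1, map2 act as ts @ us) = (\<phi> (states M), ts' @ us)" by blast
    with s' show ?thesis
      by (intro exI[of _ "Suc n'"]) (simp add: funpow_swap1)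
  qed
qed

lemma simulate_start:
  assumes "halts_in M ts t ts'" "wf_tm M"
    and "\<And>q ss. q < states M \<Longrightarrow> length ss = tapes M \<Longrightarrow> \<phi> q < states M' \<and>
      delta M' (\<phi> q) ss = (\<phi> (fst (delta M q ss)), snd (delta M q ss))"
    and "length ts = tapes M"
  shows "\<exists>n\<le>t. (step M' ^^ n) (\<phi> 0, ts) = (\<phi> (states M), ts')"
proof -
  obtain n where n: "n \<le> t" "(step M ^^ n) (0, ts) = (states M, ts')"
    using assms(1) by (auto simp: halts_in_def)
  have "\<exists>n'\<le>n. (step M' ^^ n') (\<phi> 0, ts @ []) = (\<phi> (states M), ts' @ [])"
    by (rule simulate[OF assms(2), where m = 0]) (use assms(3,4) n in \<open>auto simp: idle_def\<close>)
  then show ?thesis using n by (metis append_Nil2 le_trans)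
qed

section \<open>Sequencing, branching and looping of Turing machines\<close>

definition seq_tm :: "tm \<Rightarrow> tm \<Rightarrow> tm" where
  "seq_tm M1 M2 = \<lparr>tapes = tapes M1, states = states M1 + states M2,
     delta = (\<lambda>q ss. if q < states M1 then delta M1 q ss
        else (case delta M2 (q - states M1) ss of (q', as) \<Rightarrow> (states M1 + q', as)))\<rparr>"

text \<open>A machine without working states has already halted in state 0, so for
  \<open>states M1 = 0\<close> the test itself must enter the common halting state. For
  \<open>M2\<close> the shift by \<open>Suc (states M1)\<close> sends its halting state there
  automatically.\<close>

definition cond_tm :: "nat \<Rightarrow> symbol set \<Rightarrow> tm \<Rightarrow> tm \<Rightarrow> tm" where
  "cond_tm i X M1 M2 = \<lparr>tapes = tapes M1, states = Suc (states M1 + states M2),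
     delta = (\<lambda>q ss. if q = 0 then
          (if ss ! i \<in> X then (if states M1 = 0 then Suc (states M1 + states M2) else 1)
           else Suc (states M1), idle ss)
        else if q \<le> states M1 then (case delta M1 (q - 1) ss of (q', as) \<Rightarrow>
          (if q' = states M1 then Suc (states M1 + states M2) else Suc q', as))
        else (case delta M2 (q - Suc (states M1)) ss of (q', as) \<Rightarrow> (Suc (states M1) + q', as)))\<rparr>"

definition loop_tm :: "nat \<Rightarrow> symbol set \<Rightarrow> tm \<Rightarrow> tm" where
  "loop_tm i X M = \<lparr>tapes = tapes M, states = Suc (states M),
     delta = (\<lambda>q ss. if q = 0 then
          (if ss ! i \<in> X then (if states M = 0 then 0 else 1) else Suc (states M), idle ss)
        else (case delta M (q - 1) ss of (q', as) \<Rightarrow> (if q' = states M then 0 else Suc q', as)))\<rparr>"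

lemma seq_tm_sel [simp]:
  "tapes (seq_tm M1 M2) = tapes M1" "states (seq_tm M1 M2) = states M1 + states M2"
  by (simp_all add: seq_tm_def)

lemma cond_tm_sel [simp]:
  "tapes (cond_tm i X M1 M2) = tapes M1" "states (cond_tm i X M1 M2) = Suc (states M1 + states M2)"
  by (simp_all add: cond_tm_def)

lemma loop_tm_sel [simp]: "tapes (loop_tm i X M) = tapes M" "states (loop_tm i X M) = Suc (states M)"
  by (simp_all add: loop_tm_def)

lemma wf_seq_tm:
  assumes "wf_tm M1" "wf_tm M2" "tapes M1 = tapes M2"
  shows "wf_tm (seq_tm M1 M2)"
  unfolding wf_tm_def
proof (intro conjI allI impI)
  show "1 \<le> tapes (seq_tm M1 M2)" using assms by (simp add: wf_tm_def)
next
  fix q :: nat and ss :: "symbol list"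
  assume q: "q < states (seq_tm M1 M2)" and ss: "length ss = tapes (seq_tm M1 M2)"
  show "fst (delta (seq_tm M1 M2) q ss) \<le> states (seq_tm M1 M2)"
    using wf_tmD(1)[OF assms(1), of q ss] wf_tmD(1)[OF assms(2), of "q - states M1" ss] assms(3) q ss
    by (auto simp: seq_tm_def split: prod.splits)
  show "length (snd (delta (seq_tm M1 M2) q ss)) = tapes (seq_tm M1 M2)"
    using wf_tmD(2)[OF assms(1), of q ss] wf_tmD(2)[OF assms(2), of "q - states M1" ss] assms(3) q ss
    by (auto simp: seq_tm_def split: prod.splits)
qed

lemma wf_cond_tm:
  assumes "wf_tm M1" "wf_tm M2" "tapes M1 = tapes M2"
  shows "wf_tm (cond_tm i X M1 M2)"
  unfolding wf_tm_def
proof (intro conjI allI impI)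
  show "1 \<le> tapes (cond_tm i X M1 M2)" using assms by (simp add: wf_tm_def)
next
  fix q :: nat and ss :: "symbol list"
  assume q: "q < states (cond_tm i X M1 M2)" and ss: "length ss = tapes (cond_tm i X M1 M2)"
  have d1: "0 < q \<Longrightarrow> q \<le> states M1 \<Longrightarrow> fst (delta M1 (q - 1) ss) \<le> states M1"
    "0 < q \<Longrightarrow> q \<le> states M1 \<Longrightarrow> length (snd (delta M1 (q - 1) ss)) = tapes M1"
    using wf_tmD[OF assms(1), of "q - 1" ss] ss by auto
  have d2: "states M1 < q \<Longrightarrow> fst (delta M2 (q - Suc (states M1)) ss) \<le> states M2"
    "states M1 < q \<Longrightarrow> length (snd (delta M2 (q - Suc (states M1)) ss)) = tapes M2"
    using wf_tmD[OF assms(2), of "q - Suc (states M1)" ss] ss q assms(3) by auto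
  show "fst (delta (cond_tm i X M1 M2) q ss) \<le> states (cond_tm i X M1 M2)"
    using d1(1) d2(1) assms(3) q ss by (auto simp: cond_tm_def split: prod.splits)
  show "length (snd (delta (cond_tm i X M1 M2) q ss)) = tapes (cond_tm i X M1 M2)"
    using d1(2) d2(2) assms(3) q ss by (auto simp: cond_tm_def split: prod.splits)
qed

lemma wf_loop_tm:
  assumes "wf_tm M"
  shows "wf_tm (loop_tm i X M)"
  unfolding wf_tm_def
proof (intro conjI allI impI)
  show "1 \<le> tapes (loop_tm i X M)" using assms by (simp add: wf_tm_def)
next
  fix q :: nat and ss :: "symbol list"
  assume q: "q < states (loop_tm i X M)" and ss: "length ss = tapes (loop_tm i X M)"
  have d: "0 < q \<Longrightarrow> fst (delta M (q - 1) ss) \<le> states M"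
    "0 < q \<Longrightarrow> length (snd (delta M (q - 1) ss)) = tapes M"
    using wf_tmD[OF assms(1), of "q - 1" ss] ss q by auto
  show "fst (delta (loop_tm i X M) q ss) \<le> states (loop_tm i X M)"
    using d(1) q ss by (auto simp: loop_tm_def split: prod.splits)
  show "length (snd (delta (loop_tm i X M) q ss)) = tapes (loop_tm i X M)"
    using d(2) q ss by (auto simp: loop_tm_def split: prod.splits)
qed

lemma halts_in_seq_tm:
  assumes wf: "wf_tm M1" "wf_tm M2" "tapes M1 = tapes M2"
    and len: "length ts = tapes M1" "length ts' = tapes M1"
    and "halts_in M1 ts t ts'" "halts_in M2 ts' t' ts''"
  shows "halts_in (seq_tm M1 M2) ts (t + t') ts''"
proof -
  let ?M = "seq_tm M1 M2"
  have "\<exists>n\<le>t. (step ?M ^^ n) ((\<lambda>q. q) 0, ts) = ((\<lambda>q. q) (states M1), ts')"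
    by (rule simulate_start[OF assms(6,1)]) (use len in \<open>auto simp: seq_tm_def\<close>)
  then obtain n where n: "n \<le> t" "(step ?M ^^ n) (0, ts) = (states M1, ts')" by auto
  have "\<exists>n\<le>t'. (step ?M ^^ n) ((\<lambda>q. states M1 + q) 0, ts') = ((\<lambda>q. states M1 + q) (states M2), ts'')"
    by (rule simulate_start[OF assms(7,2)])
      (use len wf(3) in \<open>auto simp: seq_tm_def split: prod.splits\<close>)
  then obtain n' where n': "n' \<le> t'" "(step ?M ^^ n') (states M1, ts') = (states M1 + states M2, ts'')"
    by auto
  have "(step ?M ^^ (n' + n)) (0, ts) = (states ?M, ts'')"
    using n n' by (simp add: funpow_add)
  then show ?thesis unfolding halts_in_def using n n' by (intro exI[of _ "n' + n"]) auto
qed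

lemma halts_in_prefix:
  assumes "step M (0, ts) = (q, ts1)" "\<exists>n\<le>t. (step M ^^ n) (q, ts1) = (states M, ts')"
  shows "halts_in M ts (Suc t) ts'"
proof -
  obtain n where "n \<le> t" "(step M ^^ n) (q, ts1) = (states M, ts')" using assms(2) by auto
  then show ?thesis unfolding halts_in_def
    using assms(1) by (intro exI[of _ "Suc n"]) (simp add: funpow_swap1)
qed

lemma halts_in_cond_tm_true:
  assumes wf: "wf_tm M1" "tapes M1 = tapes M2"
    and len: "length ts = tapes M1" "i < tapes M1"
    and "scan (ts ! i) \<in> X" "halts_in M1 ts t ts'"
  shows "halts_in (cond_tm i X M1 M2) ts (Suc t) ts'"
proof -
  let ?M = "cond_tm i X M1 M2"
  let ?\<phi> = "\<lambda>q. if q = states M1 then Suc (states M1 + states M2) else Suc q"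
  have "step ?M (0, ts) = (?\<phi> 0, ts)"
    using assms by (auto simp: step_def cond_tm_def)
  moreover have "\<exists>n\<le>t. (step ?M ^^ n) (?\<phi> 0, ts) = (?\<phi> (states M1), ts')"
    by (rule simulate_start[OF assms(6,1)]) (use len in \<open>auto simp: cond_tm_def split: prod.splits\<close>)
  ultimately show ?thesis by (intro halts_in_prefix) auto
qed

lemma halts_in_cond_tm_false:
  assumes wf: "wf_tm M2" "tapes M1 = tapes M2"
    and len: "length ts = tapes M1" "i < tapes M1"
    and "scan (ts ! i) \<notin> X" "halts_in M2 ts t ts'"
  shows "halts_in (cond_tm i X M1 M2) ts (Suc t) ts'"
proof -
  let ?M = "cond_tm i X M1 M2"
  let ?\<phi> = "\<lambda>q. Suc (states M1) + q"
  have "step ?M (0, ts) = (?\<phi> 0, ts)"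
    using assms by (auto simp: step_def cond_tm_def)
  moreover have "\<exists>n\<le>t. (step ?M ^^ n) (?\<phi> 0, ts) = (?\<phi> (states M2), ts')"
    by (rule simulate_start[OF assms(6,1)]) (use len wf in \<open>auto simp: cond_tm_def split: prod.splits\<close>)
  ultimately show ?thesis by (intro halts_in_prefix) auto
qed

lemma halts_in_loop_tm_stop:
  assumes "length ts = tapes M" "i < tapes M" "scan (ts ! i) \<notin> X"
  shows "halts_in (loop_tm i X M) ts 1 ts"
proof -
  have "step (loop_tm i X M) (0, ts) = (states (loop_tm i X M), ts)"
    using assms by (auto simp: step_def loop_tm_def)
  then show ?thesis unfolding halts_in_def by (intro exI[of _ 1]) auto
qed

lemma halts_in_loop_tm_step:
  assumes "wf_tm M" and len: "length ts = tapes M" "i < tapes M"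
    and "scan (ts ! i) \<in> X" "halts_in M ts t ts'" "halts_in (loop_tm i X M) ts' t' ts''"
  shows "halts_in (loop_tm i X M) ts (Suc (t + t')) ts''"
proof -
  let ?M = "loop_tm i X M"
  let ?\<phi> = "\<lambda>q. if q = states M then 0 else Suc q"
  have "\<exists>n\<le>t. (step ?M ^^ n) (?\<phi> 0, ts) = (?\<phi> (states M), ts')"
    by (rule simulate_start[OF assms(5,1)]) (use len in \<open>auto simp: loop_tm_def split: prod.splits\<close>)
  then obtain n where n: "n \<le> t" "(step ?M ^^ n) (?\<phi> 0, ts) = (0, ts')" by auto
  obtain n' where n': "n' \<le> t'" "(step ?M ^^ n') (0, ts') = (states ?M, ts'')"
    using assms(6) by (auto simp: halts_in_def)
  have "(step ?M ^^ (n' + n)) (?\<phi> 0, ts) = (states ?M, ts'')"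
    using n n' by (simp only: funpow_add o_apply)
  moreover have "n' + n \<le> t + t'" using n n' by simp
  moreover have "step ?M (0, ts) = (?\<phi> 0, ts)"
    using assms by (auto simp: step_def loop_tm_def)
  ultimately show ?thesis by (intro halts_in_prefix) blast+
qed

section \<open>A command language on stacks and its compilation\<close>

datatype cmd =
    Skip
  | Push nat bool
  | Pop nat
  | Seq cmd cmd  (infixr \<open>;;\<close> 60)
  | Cond nat "symbol set" cmd cmd
  | Loop nat "symbol set" cmd

definition top_sym :: "bool list \<Rightarrow> symbol" where
  "top_sym w = (case w of [] \<Rightarrow> None | b # _ \<Rightarrow> Some b)"

lemma top_sym_simps [simp]: "top_sym [] = None" "top_sym (b # w) = Some b"
  by (simp_all add: top_sym_def)

text \<open>Register 0 holds the data, register 1 is a stash, register 2 is scratch space for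
  copying, and register 4 receives the output of the machine for \<open>K\<close>.\<close>

type_synonym store = "nat \<Rightarrow> bool list"

text \<open>The number in \<open>exec\<close> is an upper bound for the running time, not the exact time.\<close>

inductive exec :: "cmd \<Rightarrow> store \<Rightarrow> nat \<Rightarrow> store \<Rightarrow> bool" where
  exec_Skip: "exec Skip s 0 s"
| exec_Push: "r < 5 \<Longrightarrow> exec (Push r b) s 2 (s(r := b # s r))"
| exec_Pop: "r < 5 \<Longrightarrow> exec (Pop r) s 1 (s(r := tl (s r)))"
| exec_Seq: "exec c s t s' \<Longrightarrow> exec c' s' t' s'' \<Longrightarrow> exec (c ;; c') s (t + t') s''"
| exec_Cond_true: "r < 5 \<Longrightarrow> top_sym (s r) \<in> X \<Longrightarrow> exec c s t s' \<Longrightarrow> exec (Cond r X c c') s (Suc t) s'"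
| exec_Cond_false: "r < 5 \<Longrightarrow> top_sym (s r) \<notin> X \<Longrightarrow> exec c' s t s' \<Longrightarrow> exec (Cond r X c c') s (Suc t) s'"
| exec_Loop_stop: "r < 5 \<Longrightarrow> top_sym (s r) \<notin> X \<Longrightarrow> exec (Loop r X c) s 1 s"
| exec_Loop_step: "r < 5 \<Longrightarrow> top_sym (s r) \<in> X \<Longrightarrow> exec c s t s' \<Longrightarrow> exec (Loop r X c) s' t' s'' \<Longrightarrow>
    exec (Loop r X c) s (Suc (t + t')) s''"
| exec_weaken: "exec c s t s' \<Longrightarrow> t \<le> t' \<Longrightarrow> exec c s t' s'"

text \<open>A push costs two units and lengthens a stack by one, so every time bound also bounds the
  output. \<open>fpE\<close> turns this into the length bound needed for compositions.\<close>

lemma length_exec: "exec c s t s' \<Longrightarrow> length (s' r) \<le> length (s r) + t"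
  by (induction rule: exec.induct) (auto simp: le_diff_conv)

text \<open>
  Register \<open>r\<close> is tape \<open>N - 1 - r\<close>, so that register \<open>0\<close> is the output tape. Writing happens before
  moving, hence a push takes two steps.
\<close>

fun compile :: "nat \<Rightarrow> cmd \<Rightarrow> tm" where
  "compile N Skip = \<lparr>tapes = N, states = 0, delta = (\<lambda>_ _. (0, []))\<rparr>"
| "compile N (Push r b) = \<lparr>tapes = N, states = 2, delta = (\<lambda>q ss.
     (Suc q, (idle ss)[N - 1 - r := if q = 0 then (ss ! (N - 1 - r), Move_Left) else (Some b, Stay)]))\<rparr>"
| "compile N (Pop r) = \<lparr>tapes = N, states = 1, delta = (\<lambda>q ss.
     (1, (idle ss)[N - 1 - r := (ss ! (N - 1 - r), if ss ! (N - 1 - r) = None then Stay else Move_Right)]))\<rparr>"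
| "compile N (c ;; c') = seq_tm (compile N c) (compile N c')"
| "compile N (Cond r X c c') = cond_tm (N - 1 - r) X (compile N c) (compile N c')"
| "compile N (Loop r X c) = loop_tm (N - 1 - r) X (compile N c)"

lemma tapes_compile [simp]: "tapes (compile N c) = N"
  by (induction c) auto

lemma wf_compile: "1 \<le> N \<Longrightarrow> wf_tm (compile N c)"
  by (induction c) (auto intro!: wf_seq_tm wf_cond_tm wf_loop_tm simp: wf_tm_def[of "\<lparr>tapes = _, states = _, delta = _\<rparr>"])

definition represents :: "nat \<Rightarrow> tape list \<Rightarrow> store \<Rightarrow> bool" where
  "represents N ts s \<longleftrightarrow> length ts = N \<and> (\<forall>r<5. presents (ts ! (N - 1 - r)) (s r))"

lemma scan_presents: "presents t w \<Longrightarrow> scan t = top_sym w"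
  by (cases w) (auto simp: presents_def scan_def)

text \<open>Popping leaves old symbols to the left of the head. They are harmless, because
  \<open>presents\<close> looks only to the right and a push overwrites the cell that it
  enters.\<close>

lemma presents_push:
  assumes "presents t w"
  shows "presents (act (Some b, Stay) (act (scan t, Move_Left) t)) (b # w)"
proof -
  have "cell t (pos t - 1 + (1 + int i)) = Some (w ! i)" if "i < length w" for i
    using assms that by (simp add: presents_def)
  then show ?thesis
    using assms by (auto simp: presents_def act_def scan_def nth_Cons less_Suc_eq_0_disj algebra_simps)
qed

text \<open>Staying on a blank makes the pop of an empty stack a no-op, in agreement with
  \<open>tl [] = []\<close>.\<close>

lemma presents_pop:
  assumes "presents t w"
  shows "presents (act (scan t, if scan t = None then Stay else Move_Right) t) (tl w)"
proof (cases w)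
  case Nil
  with assms scan_presents[OF assms] show ?thesis by (auto simp: act_def presents_def)
next
  case (Cons b v)
  have "\<forall>i<length v. cell t (pos t + 1 + int i) = Some (v ! i)"
  proof (intro allI impI)
    fix i assume "i < length v"
    with assms Cons have "cell t (pos t + int (Suc i)) = Some (w ! Suc i)"
      unfolding presents_def by auto
    with Cons show "cell t (pos t + 1 + int i) = Some (v ! i)" by (simp add: algebra_simps)
  qed
  with assms Cons scan_presents[OF assms] show ?thesis
    by (auto simp: act_def presents_def scan_def algebra_simps)
qed

lemma represents_update:
  assumes "represents N ts s" "5 \<le> N" "r < 5" "presents t w"
  shows "represents N (ts[N - 1 - r := t]) (s(r := w))"
  unfolding represents_def
proof (intro conjI allI impI)
  show "length (ts[N - 1 - r := t]) = N" using assms by (simp add: represents_def)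
  fix r' :: nat assume r': "r' < 5"
  have "N - 1 - r' \<noteq> N - 1 - r" if "r' \<noteq> r" using that r' assms(2,3) by linarith
  with assms r' show "presents (ts[N - 1 - r := t] ! (N - 1 - r')) ((s(r := w)) r')"
    by (cases "r' = r") (auto simp: represents_def)
qed

lemma compile_correct:
  assumes "exec c s t s'" "represents N ts s" "5 \<le> N"
  shows "\<exists>ts'. halts_in (compile N c) ts t ts' \<and> represents N ts' s'"
  using assms
proof (induction arbitrary: ts rule: exec.induct)
  case (exec_Skip s)
  then show ?case by (intro exI[of _ ts]) (auto simp: halts_in_def)
next
  case (exec_Push r b s)
  let ?i = "N - 1 - r"
  from exec_Push have i: "?i < length ts" and p: "presents (ts ! ?i) (s r)"
    by (auto simp: represents_def)
  have len: "length ts = N" using exec_Push by (simp add: represents_def)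
  let ?t1 = "act (scan (ts ! ?i), Move_Left) (ts ! ?i)"
  have 1: "step (compile N (Push r b)) (0, ts) = (1, ts[?i := ?t1])"
    using i len map2_act_update[OF i] by (simp add: step_def)
  have "map2 act ((idle (map scan (ts[?i := ?t1])))[?i := (Some b, Stay)]) (ts[?i := ?t1]) =
      ts[?i := act (Some b, Stay) ?t1]"
    using i by (subst map2_act_update) auto
  then have 2: "step (compile N (Push r b)) (1, ts[?i := ?t1]) = (2, ts[?i := act (Some b, Stay) ?t1])"
    using len by (simp add: step_def)
  have "halts_in (compile N (Push r b)) ts 2 (ts[?i := act (Some b, Stay) ?t1])"
    unfolding halts_in_def using 1 2 by (intro exI[of _ 2]) (simp add: numeral_2_eq_2)
  moreover have "represents N (ts[?i := act (Some b, Stay) ?t1]) (s(r := b # s r))"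
    using exec_Push p by (intro represents_update presents_push) auto
  ultimately show ?case by blast
next
  case (exec_Pop r s)
  let ?i = "N - 1 - r"
  from exec_Pop have i: "?i < length ts" and p: "presents (ts ! ?i) (s r)"
    by (auto simp: represents_def)
  have len: "length ts = N" using exec_Pop by (simp add: represents_def)
  let ?t1 = "act (scan (ts ! ?i), if scan (ts ! ?i) = None then Stay else Move_Right) (ts ! ?i)"
  have "step (compile N (Pop r)) (0, ts) = (1, ts[?i := ?t1])"
    using i len map2_act_update[OF i] by (simp add: step_def)
  then have "halts_in (compile N (Pop r)) ts 1 (ts[?i := ?t1])"
    unfolding halts_in_def by (intro exI[of _ 1]) simp
  moreover have "represents N (ts[?i := ?t1]) (s(r := tl (s r)))"
    using exec_Pop p by (intro represents_update presents_pop) auto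
  ultimately show ?case by blast
next
  case (exec_Seq c s t s' c' t' s'')
  then obtain ts1 where 1: "halts_in (compile N c) ts t ts1" "represents N ts1 s'" by blast
  with exec_Seq obtain ts2 where 2: "halts_in (compile N c') ts1 t' ts2" "represents N ts2 s''" by blast
  have "halts_in (seq_tm (compile N c) (compile N c')) ts (t + t') ts2"
    using exec_Seq.prems 1 2 by (intro halts_in_seq_tm[of _ _ _ ts1]) (auto simp: wf_compile represents_def)
  with 2 show ?case by auto
next
  case (exec_Cond_true r s X c t s' c')
  then obtain ts1 where 1: "halts_in (compile N c) ts t ts1" "represents N ts1 s'" by blast
  have "scan (ts ! (N - 1 - r)) = top_sym (s r)"
    using exec_Cond_true by (intro scan_presents) (auto simp: represents_def)
  with exec_Cond_true 1 have "halts_in (compile N (Cond r X c c')) ts (Suc t) ts1"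
    unfolding compile.simps by (intro halts_in_cond_tm_true) (auto simp: wf_compile represents_def)
  with 1 show ?case by auto
next
  case (exec_Cond_false r s X c' t s' c)
  then obtain ts1 where 1: "halts_in (compile N c') ts t ts1" "represents N ts1 s'" by blast
  have "scan (ts ! (N - 1 - r)) = top_sym (s r)"
    using exec_Cond_false by (intro scan_presents) (auto simp: represents_def)
  with exec_Cond_false 1 have "halts_in (compile N (Cond r X c c')) ts (Suc t) ts1"
    unfolding compile.simps by (intro halts_in_cond_tm_false) (auto simp: wf_compile represents_def)
  with 1 show ?case by auto
next
  case (exec_Loop_stop r s X c)
  have "scan (ts ! (N - 1 - r)) = top_sym (s r)"
    using exec_Loop_stop by (intro scan_presents) (auto simp: represents_def)
  with exec_Loop_stop have "halts_in (compile N (Loop r X c)) ts 1 ts"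
    unfolding compile.simps by (intro halts_in_loop_tm_stop) (auto simp: represents_def)
  with exec_Loop_stop show ?case by blast
next
  case (exec_Loop_step r s X c t s' t' s'')
  then obtain ts1 where 1: "halts_in (compile N c) ts t ts1" "represents N ts1 s'" by blast
  with exec_Loop_step obtain ts2
    where 2: "halts_in (compile N (Loop r X c)) ts1 t' ts2" "represents N ts2 s''" by blast
  have "scan (ts ! (N - 1 - r)) = top_sym (s r)"
    using exec_Loop_step by (intro scan_presents) (auto simp: represents_def)
  with exec_Loop_step 1 2 have "halts_in (compile N (Loop r X c)) ts (Suc (t + t')) ts2"
    unfolding compile.simps by (intro halts_in_loop_tm_step[of _ _ _ _ _ ts1]) (auto simp: wf_compile represents_def)
  with 2 show ?case by blast
next
  case (exec_weaken c s t s' t')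
  then obtain ts' where "halts_in (compile N c) ts t ts'" "represents N ts' s'" by blast
  with exec_weaken.hyps show ?case by (auto simp: halts_in_def intro: le_trans)
qed

section \<open>Polynomial-time functions on self-delimiting words\<close>

text \<open>For loop-free commands, effect and cost can be computed by rewriting;
  \<open>exec_straightI\<close> then replaces derivations with the rules of
  \<open>exec\<close>.\<close>

fun straight :: "cmd \<Rightarrow> bool" where
  "straight Skip = True"
| "straight (Push r b) = (r < 5)"
| "straight (Pop r) = (r < 5)"
| "straight (c ;; c') = (straight c \<and> straight c')"
| "straight (Cond r X c c') = (r < 5 \<and> straight c \<and> straight c')"
| "straight (Loop r X c) = False"

fun result :: "cmd \<Rightarrow> store \<Rightarrow> store" where
  "result (Push r b) s = s(r := b # s r)"
| "result (Pop r) s = s(r := tl (s r))"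
| "result (c ;; c') s = result c' (result c s)"
| "result (Cond r X c c') s = (if top_sym (s r) \<in> X then result c s else result c' s)"
| "result _ s = s"

fun cost :: "cmd \<Rightarrow> nat" where
  "cost (Push r b) = 2"
| "cost (Pop r) = 1"
| "cost (c ;; c') = cost c + cost c'"
| "cost (Cond r X c c') = Suc (cost c + cost c')"
| "cost _ = 0"

lemma exec_straight: "straight c \<Longrightarrow> exec c s (cost c) (result c s)"
proof (induction c arbitrary: s)
  case (Cond r X c c')
  then have IH: "r < 5" "exec c s (cost c) (result c s)" "exec c' s (cost c') (result c' s)" by auto
  show ?case
  proof (cases "top_sym (s r) \<in> X")
    case True
    from exec_Cond_true[OF IH(1) True IH(2), of c'] True show ?thesis by (auto elim: exec_weaken)
  next
    case False
    from exec_Cond_false[OF IH(1) False IH(3), of c] False show ?thesis by (auto elim: exec_weaken)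
  qed
qed (auto intro: exec.intros)

lemma exec_straightI: "straight c \<Longrightarrow> result c s = s' \<Longrightarrow> cost c \<le> t \<Longrightarrow> exec c s t s'"
  using exec_straight exec_weaken by blast

lemma exec_cong: "exec c s t s' \<Longrightarrow> t \<le> t' \<Longrightarrow> s' = s'' \<Longrightarrow> exec c s t' s''"
  using exec_weaken by blast

lemma exec_SeqI: "exec c s t s1 \<Longrightarrow> exec c' s1 t' s2 \<Longrightarrow> t + t' \<le> T \<Longrightarrow> exec (c ;; c') s T s2"
  using exec_Seq exec_weaken by blast

text \<open>Words lie on the stash in reverse, where a prefix code no longer delimits itself. A
  \<open>True\<close> before every bit leaves \<open>False\<close> free as an end marker for words
  of any code.\<close>

definition marked :: "bool list \<Rightarrow> bool list" where
  "marked w = concat (map (\<lambda>b. [True, b]) w)"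

lemma marked_simps [simp]:
  "marked [] = []" "marked (b # w) = True # b # marked w" "marked (v @ w) = marked v @ marked w"
  by (simp_all add: marked_def)

definition each :: "nat \<Rightarrow> (bool \<Rightarrow> cmd) \<Rightarrow> cmd" where
  "each i c = Loop i {Some True}
     (Pop i ;; Cond i {Some True} (Pop i ;; c True) (Pop i ;; c False)) ;; Pop i"

text \<open>The third assumption says that the handler neither reads nor changes register
  \<open>i\<close>, so the unread part of the word survives every round.\<close>

lemma exec_each:
  assumes "i < 5" "\<And>b s. exec (c b) s k (F b s)" "\<And>b s w. F b (s(i := w)) = (F b s)(i := w)"
    and "s i = marked v @ False # w"
  shows "exec (each i c) s ((k + 5) * length v + 2) ((fold F v s)(i := w))"
proof -
  let ?body = "Pop i ;; Cond i {Some True} (Pop i ;; c True) (Pop i ;; c False)"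
  have body: "exec ?body s (k + 4) ((F b s)(i := w))" if "s i = True # b # w" for s b w
  proof -
    let ?s = "s(i := b # w)"
    have 1: "exec (Pop i ;; c b) ?s (1 + k) (F b (?s(i := tl (?s i))))"
      by (rule exec_Seq[OF exec_Pop[OF assms(1)] assms(2)])
    have "exec (Cond i {Some True} (Pop i ;; c True) (Pop i ;; c False)) ?s (Suc (1 + k))
      (F b (?s(i := tl (?s i))))"
      by (cases b; rule exec_Cond_true exec_Cond_false) (use 1 assms in auto)
    moreover have "exec (Pop i) s 1 ?s" using exec_Pop[of i s] assms(1) that by simp
    ultimately show ?thesis
      using assms(3) by (auto intro: exec_SeqI)
  qed
  have "exec (Loop i {Some True} ?body) s ((k + 5) * length v + 1) ((fold F v s)(i := False # w))"
    using assms(4)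
  proof (induction v arbitrary: s)
    case Nil
    then show ?case using exec_Loop_stop[of i s "{Some True}" ?body] assms(1)
      by (simp add: fun_upd_idem)
  next
    case (Cons b v)
    let ?s = "(F b s)(i := marked v @ False # w)"
    have comm: "fold F v (s(i := x)) = (fold F v s)(i := x)" for v s x
      by (induction v arbitrary: s) (auto simp: assms(3))
    have 1: "exec (Loop i {Some True} ?body) ?s ((k + 5) * length v + 1) ((fold F v ?s)(i := False # w))"
      by (rule Cons.IH) simp
    have 2: "exec ?body s (k + 4) ?s" by (rule body) (use Cons.prems in simp)
    show ?case
      by (rule exec_cong[OF exec_Loop_step[OF assms(1) _ 2 1]]) (use Cons.prems in \<open>auto simp: comm\<close>)
  qed
  moreover have "exec (Pop i) ((fold F v s)(i := False # w)) 1 ((fold F v s)(i := w))"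
    using exec_Pop[OF assms(1), of "(fold F v s)(i := False # w)"] by simp
  ultimately show ?thesis unfolding each_def by (auto intro: exec_SeqI)
qed

text \<open>The operational form of a prefix code: the end of a code word is found in linear time
  without knowledge of what follows. No end marker is pushed here, so that the words scanned for the
  components of a pair concatenate; \<open>scannableE\<close> adds the marker.\<close>

definition scannable :: "('a \<Rightarrow> bool list) \<Rightarrow> bool" where
  "scannable e \<longleftrightarrow> (\<exists>c k. \<forall>a s r. s 0 = e a @ r \<longrightarrow>
     exec c s (k * (length (e a) + 1)) (s(0 := r, 1 := marked (rev (e a)) @ s 1)))"

lemma scannableI:
  "(\<And>a s r. s 0 = e a @ r \<Longrightarrow> exec c s (k * (length (e a) + 1)) (s(0 := r, 1 := marked (rev (e a)) @ s 1)))
    \<Longrightarrow> scannable e"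
  unfolding scannable_def by blast

definition unit_code :: "unit \<Rightarrow> bool list" where
  "unit_code _ = []"

definition bool_code :: "bool \<Rightarrow> bool list" where
  "bool_code b = [b]"

definition pair_code :: "('a \<Rightarrow> bool list) \<Rightarrow> ('b \<Rightarrow> bool list) \<Rightarrow> 'a \<times> 'b \<Rightarrow> bool list"
    (infixr \<open>\<times>\<^sub>c\<close> 65) where
  "(e \<times>\<^sub>c d) = (\<lambda>(a, b). e a @ d b)"

lemma pair_code_simp [simp]: "(e \<times>\<^sub>c d) (a, b) = e a @ d b"
  by (simp add: pair_code_def)

lemma pair_code_eq: "(e \<times>\<^sub>c d) z = e (fst z) @ d (snd z)"
  by (simp add: pair_code_def split_def)

lemma enc_list_simps [simp]:
  "enc_list e [] = [False]" "enc_list e (x # xs) = True # e x @ enc_list e xs"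
  by (simp_all add: enc_list_def)

definition scan_bit :: cmd where
  "scan_bit = Cond 0 {Some True} (Pop 0 ;; Push 1 True ;; Push 1 True) (Pop 0 ;; Push 1 False ;; Push 1 True)"

lemma exec_scan_bit:
  assumes "s 0 = b # r"
  shows "exec scan_bit s 11 (s(0 := r, 1 := True # b # s 1))"
  by (rule exec_straightI) (use assms in \<open>auto simp: scan_bit_def\<close>)

lemma scannable_unit [intro, simp]: "scannable unit_code"
  by (rule scannableI[of _ Skip 0]) (auto simp: unit_code_def fun_upd_idem intro: exec_Skip)

lemma scannable_bool [intro, simp]: "scannable bool_code"
proof (rule scannableI[of _ scan_bit 6])
  fix a r and s :: store assume "s 0 = bool_code a @ r"
  then have "exec scan_bit s 11 (s(0 := r, 1 := True # a # s 1))"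
    by (intro exec_scan_bit) (simp add: bool_code_def)
  then show "exec scan_bit s (6 * (length (bool_code a) + 1)) (s(0 := r, 1 := marked (rev (bool_code a)) @ s 1))"
    by (auto simp: bool_code_def elim: exec_weaken)
qed

lemma scannable_pair [intro, simp]:
  assumes "scannable e" "scannable d"
  shows "scannable (e \<times>\<^sub>c d)"
proof -
  from assms(1) obtain c1 k1 where 1: "\<And>a s r. s 0 = e a @ r \<Longrightarrow>
     exec c1 s (k1 * (length (e a) + 1)) (s(0 := r, 1 := marked (rev (e a)) @ s 1))"
    unfolding scannable_def by blast
  from assms(2) obtain c2 k2 where 2: "\<And>a s r. s 0 = d a @ r \<Longrightarrow>
     exec c2 s (k2 * (length (d a) + 1)) (s(0 := r, 1 := marked (rev (d a)) @ s 1))"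
    unfolding scannable_def by blast
  show ?thesis
  proof (rule scannableI[of _ "c1 ;; c2" "k1 + k2"])
    fix z r and s :: store assume s: "s 0 = (e \<times>\<^sub>c d) z @ r"
    let ?s = "s(0 := d (snd z) @ r, 1 := marked (rev (e (fst z))) @ s 1)"
    have "exec c1 s (k1 * (length (e (fst z)) + 1)) ?s"
      using s by (intro 1) (simp add: pair_code_eq)
    moreover have "exec c2 ?s (k2 * (length (d (snd z)) + 1))
        (?s(0 := r, 1 := marked (rev (d (snd z))) @ ?s 1))"
      by (intro 2) simp
    ultimately have "exec (c1 ;; c2) s (k1 * (length (e (fst z)) + 1) + k2 * (length (d (snd z)) + 1))
        (?s(0 := r, 1 := marked (rev (d (snd z))) @ ?s 1))"
      by (rule exec_Seq)
    then show "exec (c1 ;; c2) s ((k1 + k2) * (length ((e \<times>\<^sub>c d) z) + 1))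
        (s(0 := r, 1 := marked (rev ((e \<times>\<^sub>c d) z)) @ s 1))"
      by (rule exec_cong) (auto simp: pair_code_eq fun_upd_twist algebra_simps)
  qed
qed

lemma scannable_list [intro, simp]:
  assumes "scannable e"
  shows "scannable (enc_list e)"
proof -
  from assms(1) obtain c k where c: "\<And>a s r. s 0 = e a @ r \<Longrightarrow>
     exec c s (k * (length (e a) + 1)) (s(0 := r, 1 := marked (rev (e a)) @ s 1))"
    unfolding scannable_def by blast
  \<comment> \<open>The loop stops in front of the terminating \<open>False\<close>, hence
    \<open>butlast\<close>; one more \<open>scan_bit\<close> moves that bit.\<close>
  have loop: "exec (Loop 0 {Some True} (scan_bit ;; c)) s ((12 + k) * length (enc_list e xs))
      (s(0 := False # r, 1 := marked (rev (butlast (enc_list e xs))) @ s 1))"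
    if "s 0 = enc_list e xs @ r" for xs s r
    using that
  proof (induction xs arbitrary: s)
    case Nil
    then show ?case using exec_Loop_stop[of 0 s "{Some True}" "scan_bit ;; c"]
      by (auto simp: fun_upd_idem elim: exec_weaken)
  next
    case (Cons x xs)
    let ?s1 = "s(0 := e x @ enc_list e xs @ r, 1 := True # True # s 1)"
    let ?s2 = "?s1(0 := enc_list e xs @ r, 1 := marked (rev (e x)) @ ?s1 1)"
    let ?s3 = "?s2(0 := False # r, 1 := marked (rev (butlast (enc_list e xs))) @ ?s2 1)"
    have ne: "enc_list e xs \<noteq> []" by (simp add: enc_list_def)
    have "exec scan_bit s 11 ?s1" by (rule exec_scan_bit) (use Cons.prems in simp)
    moreover have "exec c ?s1 (k * (length (e x) + 1)) ?s2" by (rule c) simp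
    ultimately have 1: "exec (scan_bit ;; c) s (11 + k * (length (e x) + 1)) ?s2"
      by (rule exec_Seq)
    have 2: "exec (Loop 0 {Some True} (scan_bit ;; c)) ?s2 ((12 + k) * length (enc_list e xs)) ?s3"
      by (rule Cons.IH) simp
    have "exec (Loop 0 {Some True} (scan_bit ;; c)) s
        (Suc ((11 + k * (length (e x) + 1)) + (12 + k) * length (enc_list e xs))) ?s3"
      using Cons.prems by (intro exec_Loop_step[OF _ _ 1 2]) auto
    then show ?case
      by (rule exec_cong) (use ne in \<open>auto simp: fun_upd_twist algebra_simps butlast_append\<close>)
  qed
  show ?thesis
  proof (rule scannableI[of _ "Loop 0 {Some True} (scan_bit ;; c) ;; scan_bit" "23 + k"])
    fix xs r and s :: store assume s: "s 0 = enc_list e xs @ r"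
    let ?s = "s(0 := False # r, 1 := marked (rev (butlast (enc_list e xs))) @ s 1)"
    have "exec scan_bit ?s 11 (?s(0 := r, 1 := True # False # ?s 1))"
      by (rule exec_scan_bit) simp
    with loop[where s = s and xs = xs and r = r, OF s] have "exec (Loop 0 {Some True} (scan_bit ;; c) ;; scan_bit) s
        ((12 + k) * length (enc_list e xs) + 11) (?s(0 := r, 1 := True # False # ?s 1))"
      by (rule exec_Seq)
    moreover have "marked (rev (enc_list e xs)) = True # False # marked (rev (butlast (enc_list e xs)))"
      by (simp add: enc_list_def)
    ultimately show "exec (Loop 0 {Some True} (scan_bit ;; c) ;; scan_bit) s
        ((23 + k) * (length (enc_list e xs) + 1)) (s(0 := r, 1 := marked (rev (enc_list e xs)) @ s 1))"
      by (auto simp: fun_upd_twist algebra_simps elim: exec_weaken)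
  qed
qed

definition unstash :: cmd where
  "unstash = each 1 (Push 0)"

lemma exec_unstash:
  assumes "s 1 = marked (rev w) @ False # v"
  shows "exec unstash s (7 * length w + 2) (s(0 := w @ s 0, 1 := v))"
proof -
  have "fold (\<lambda>b s. s(0 := b # s 0)) w s = s(0 := rev w @ s 0)" for w and s :: store
    by (induction w arbitrary: s) auto
  moreover have "exec (each 1 (Push 0)) s ((2 + 5) * length (rev w) + 2)
      ((fold (\<lambda>b s. s(0 := b # s 0)) (rev w) s)(1 := v))"
    by (rule exec_each) (use assms in \<open>auto intro: exec_straightI\<close>)
  ultimately show ?thesis by (simp add: unstash_def)
qed

text \<open>Reading the stash consumes it, so each bit is also pushed on register 2. The two
  reversals, from register 1 to 2 and back, restore the original order.\<close>

definition unstash_copy :: cmd where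
  "unstash_copy = Push 2 False ;; each 1 (\<lambda>b. Push 0 b ;; Push 2 b ;; Push 2 True) ;;
     Push 1 False ;; each 2 (\<lambda>b. Push 1 b ;; Push 1 True)"

lemma exec_unstash_copy:
  assumes "s 1 = marked (rev w) @ False # v"
  shows "exec unstash_copy s (20 * length w + 8) (s(0 := w @ s 0, 1 := marked (rev w) @ False # v))"
proof -
  have 1: "fold (\<lambda>b s. s(0 := b # s 0, 2 := True # b # s 2)) w s =
      s(0 := rev w @ s 0, 2 := marked (rev w) @ s 2)" for w and s :: store
    by (induction w arbitrary: s) (auto simp: fun_upd_twist)
  have 2: "fold (\<lambda>b s. s(1 := True # b # s 1)) w s = s(1 := marked (rev w) @ s 1)" for w and s :: store
    by (induction w arbitrary: s) (auto simp: fun_upd_twist)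
  let ?s1 = "s(2 := False # s 2)"
  have e1: "exec (Push 2 False) s 2 ?s1" by (rule exec_Push) simp
  let ?s2 = "s(0 := w @ s 0, 1 := v, 2 := marked w @ False # s 2)"
  have e2: "exec (each 1 (\<lambda>b. Push 0 b ;; Push 2 b ;; Push 2 True)) ?s1 (11 * length w + 2) ?s2"
  proof (rule exec_cong)
    show "exec (each 1 (\<lambda>b. Push 0 b ;; Push 2 b ;; Push 2 True)) ?s1 ((6 + 5) * length (rev w) + 2)
        ((fold (\<lambda>b s. s(0 := b # s 0, 2 := True # b # s 2)) (rev w) ?s1)(1 := v))"
      by (rule exec_each) (use assms in \<open>auto intro: exec_straightI\<close>)
  qed (auto simp: 1)
  let ?s3 = "?s2(1 := False # v)"
  have e3: "exec (Push 1 False) ?s2 2 ?s3" by (rule exec_straightI) auto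
  have e4: "exec (each 2 (\<lambda>b. Push 1 b ;; Push 1 True)) ?s3 (9 * length w + 2)
      (s(0 := w @ s 0, 1 := marked (rev w) @ False # v))"
  proof (rule exec_cong)
    show "exec (each 2 (\<lambda>b. Push 1 b ;; Push 1 True)) ?s3 ((4 + 5) * length w + 2)
        ((fold (\<lambda>b s. s(1 := True # b # s 1)) w ?s3)(2 := s 2))"
      by (rule exec_each) (use assms in \<open>auto intro: exec_straightI\<close>)
  qed (auto simp: 2 simp del: One_nat_def)
  show ?thesis unfolding unstash_copy_def
    by (rule exec_weaken[OF exec_Seq[OF e1 exec_Seq[OF e2 exec_Seq[OF e3 e4]]]]) simp
qed

definition forget :: cmd where
  "forget = each 1 (\<lambda>_. Skip)"

lemma exec_forget:
  assumes "s 1 = marked w @ False # v"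
  shows "exec forget s (5 * length w + 2) (s(1 := v))"
proof -
  have "fold (\<lambda>_ s. s) w s = s" for w :: "bool list" and s :: store
    by (induction w) auto
  moreover have "exec (each 1 (\<lambda>_. Skip)) s ((0 + 5) * length w + 2) ((fold (\<lambda>_ s. s) w s)(1 := v))"
    by (rule exec_each) (use assms in \<open>auto intro: exec_Skip\<close>)
  ultimately show ?thesis by (simp add: forget_def)
qed

definition count :: cmd where
  "count = Push 0 False ;; each 1 (\<lambda>_. Push 0 True)"

lemma exec_count:
  assumes "s 1 = marked w @ False # v"
  shows "exec count s (7 * length w + 4) (s(0 := enc_unary (length w) @ s 0, 1 := v))"
proof -
  have *: "fold (\<lambda>_ s. s(0 := True # s 0)) w s = s(0 := replicate (length w) True @ s 0)"
    for w :: "bool list" and s :: store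
    by (induction w arbitrary: s) (auto simp: replicate_app_Cons_same)
  let ?s = "s(0 := False # s 0)"
  have "exec (each 1 (\<lambda>_. Push 0 True)) ?s ((2 + 5) * length w + 2)
      ((fold (\<lambda>_ s. s(0 := True # s 0)) w ?s)(1 := v))"
    by (rule exec_each) (use assms in \<open>auto intro: exec_straightI\<close>)
  moreover have "exec (Push 0 False) s 2 ?s" by (rule exec_Push) simp
  ultimately show ?thesis unfolding count_def
    by (auto simp: * enc_unary_def intro: exec_SeqI)
qed

section \<open>Combinators for polynomial-time functions\<close>

lemma poly_mono_nat:
  fixes p :: "nat poly"
  shows "m \<le> n \<Longrightarrow> poly p m \<le> poly p n"
  by (induction p) (auto intro!: mult_mono)

text \<open>
  The program works on the top of register \<open>0\<close> and leaves everything below untouched, so that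
  programs can be composed without allocating registers.
\<close>

definition fp :: "'a set \<Rightarrow> ('a \<Rightarrow> bool list) \<Rightarrow> ('b \<Rightarrow> bool list) \<Rightarrow> ('a \<Rightarrow> 'b) \<Rightarrow> bool" where
  "fp S e e' f \<longleftrightarrow> (\<exists>c p. \<forall>a\<in>S. \<forall>s r. s 0 = e a @ r \<longrightarrow>
     exec c s (poly p (length (e a))) (s(0 := e' (f a) @ r)))"

lemma fpI:
  "(\<And>a s r. a \<in> S \<Longrightarrow> s 0 = e a @ r \<Longrightarrow> exec c s (poly p (length (e a))) (s(0 := e' (f a) @ r)))
    \<Longrightarrow> fp S e e' f"
  unfolding fp_def by blast

lemma fpE:
  assumes "fp S e e' f"
  obtains c p where "\<And>a s r. a \<in> S \<Longrightarrow> s 0 = e a @ r \<Longrightarrow>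
      exec c s (poly p (length (e a))) (s(0 := e' (f a) @ r))"
    and "\<And>a. a \<in> S \<Longrightarrow> length (e' (f a)) \<le> length (e a) + poly p (length (e a))"
proof -
  from assms obtain c p where 1: "\<And>a s r. a \<in> S \<Longrightarrow> s 0 = e a @ r \<Longrightarrow>
      exec c s (poly p (length (e a))) (s(0 := e' (f a) @ r))"
    unfolding fp_def by blast
  have "length (e' (f a)) \<le> length (e a) + poly p (length (e a))" if "a \<in> S" for a
    using length_exec[OF 1[OF that, of "\<lambda>_. e a" "[]"], of 0] by simp
  with 1 that show ?thesis by blast
qed

lemma fp_subset: "fp T e e' f \<Longrightarrow> S \<subseteq> T \<Longrightarrow> fp S e e' f"
  unfolding fp_def by blast

lemma fp_cong: "fp S e e' f \<Longrightarrow> (\<And>a. a \<in> S \<Longrightarrow> e' (f a) = d (g a)) \<Longrightarrow> fp S e d g"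
  unfolding fp_def by metis

lemma fp_same_code: "(\<And>a. a \<in> S \<Longrightarrow> e' (f a) = e a) \<Longrightarrow> fp S e e' f"
  by (rule fpI[of _ _ Skip 0]) (auto simp: fun_upd_idem intro: exec_Skip)

lemma fp_ident: "fp S e e (\<lambda>z. z)"
  by (rule fp_same_code) simp

lemma fp_comp:
  assumes "fp T e1 e2 g" "fp S e e1 f" "f ` S \<subseteq> T"
  shows "fp S e e2 (\<lambda>z. g (f z))"
proof -
  from assms(1) obtain c1 p1 where 1: "\<And>a s r. a \<in> T \<Longrightarrow> s 0 = e1 a @ r \<Longrightarrow>
      exec c1 s (poly p1 (length (e1 a))) (s(0 := e2 (g a) @ r))" by (elim fpE) blast
  from assms(2) obtain c2 p2 where 2: "\<And>a s r. a \<in> S \<Longrightarrow> s 0 = e a @ r \<Longrightarrow>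
      exec c2 s (poly p2 (length (e a))) (s(0 := e1 (f a) @ r))"
    and len: "\<And>a. a \<in> S \<Longrightarrow> length (e1 (f a)) \<le> length (e a) + poly p2 (length (e a))"
    by (elim fpE) blast
  show ?thesis
  \<comment> \<open>On input length \<open>n\<close> the intermediate word has length at most
    \<open>n + p2 n\<close>, which is where \<open>p1\<close> has to be evaluated.\<close>
  proof (rule fpI[of _ _ "c2 ;; c1" "p2 + pcompose p1 ([:0, 1:] + p2)"])
    fix a r and s :: store assume a: "a \<in> S" and s: "s 0 = e a @ r"
    have "exec c2 s (poly p2 (length (e a))) (s(0 := e1 (f a) @ r))"
      by (rule 2) (use a s in auto)
    moreover have "exec c1 (s(0 := e1 (f a) @ r)) (poly p1 (length (e1 (f a)))) (s(0 := e2 (g (f a)) @ r))"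
      using 1[of "f a" "s(0 := e1 (f a) @ r)" r] a assms(3) by auto
    ultimately have "exec (c2 ;; c1) s (poly p2 (length (e a)) + poly p1 (length (e1 (f a))))
        (s(0 := e2 (g (f a)) @ r))"
      by (rule exec_Seq)
    then show "exec (c2 ;; c1) s (poly (p2 + pcompose p1 ([:0, 1:] + p2)) (length (e a))) (s(0 := e2 (g (f a)) @ r))"
      by (rule exec_weaken) (use poly_mono_nat[OF len[OF a], of p1] in \<open>auto simp: poly_pcompose\<close>)
  qed
qed

lemma fp_o: "fp UNIV e1 e2 g \<Longrightarrow> fp S e e1 f \<Longrightarrow> fp S e e2 (\<lambda>z. g (f z))"
  by (rule fp_comp) auto

lemma fp_first:
  assumes "fp S e e' f"
  shows "fp (S \<times> UNIV) (e \<times>\<^sub>c d) (e' \<times>\<^sub>c d) (\<lambda>z. (f (fst z), snd z))"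
proof -
  from assms(1) obtain c p where 1: "\<And>a s r. a \<in> S \<Longrightarrow> s 0 = e a @ r \<Longrightarrow>
      exec c s (poly p (length (e a))) (s(0 := e' (f a) @ r))" by (elim fpE) blast
  show ?thesis
  proof (rule fpI[of _ _ c p])
    fix z r and s :: store assume "z \<in> S \<times> (UNIV :: 'c set)" "s 0 = (e \<times>\<^sub>c d) z @ r"
    then have "exec c s (poly p (length (e (fst z)))) (s(0 := e' (f (fst z)) @ d (snd z) @ r))"
      by (intro 1) (auto simp: pair_code_eq)
    then show "exec c s (poly p (length ((e \<times>\<^sub>c d) z))) (s(0 := (e' \<times>\<^sub>c d) (f (fst z), snd z) @ r))"
      by (rule exec_cong) (auto simp: pair_code_eq intro: poly_mono_nat)
  qed
qed


lemma scannableE: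
  assumes "scannable e"
  obtains c k where "\<And>a s r. s 0 = e a @ r \<Longrightarrow>
    exec c s (k * length (e a) + k) (s(0 := r, 1 := marked (rev (e a)) @ False # s 1))"
proof -
  from assms obtain c k where c: "\<And>a s r. s 0 = e a @ r \<Longrightarrow>
     exec c s (k * (length (e a) + 1)) (s(0 := r, 1 := marked (rev (e a)) @ s 1))"
    unfolding scannable_def by blast
  have "exec (Push 1 False ;; c) s ((k + 2) * length (e a) + (k + 2))
      (s(0 := r, 1 := marked (rev (e a)) @ False # s 1))" if "s 0 = e a @ r" for a s r
  proof -
    let ?s = "s(1 := False # s 1)"
    have "exec (Push 1 False) s 2 ?s" by (rule exec_straightI) auto
    moreover have "exec c ?s (k * (length (e a) + 1)) (?s(0 := r, 1 := marked (rev (e a)) @ ?s 1))"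
      by (rule c) (use that in simp)
    ultimately show ?thesis by (auto simp: fun_upd_twist algebra_simps intro: exec_SeqI)
  qed
  then show ?thesis by (rule that)
qed

text \<open>The second component lies below the first on the stack. The first is parked in register
  1 while \<open>f\<close> runs, which is safe because programs in the sense of \<open>fp\<close>
  restore all registers other than 0. Acting on the first component needs no such detour.\<close>

lemma fp_second:
  assumes "scannable d" "fp S e e' f"
  shows "fp (UNIV \<times> S) (d \<times>\<^sub>c e) (d \<times>\<^sub>c e') (\<lambda>z. (fst z, f (snd z)))"
proof -
  from assms(1) obtain c k where c: "\<And>a s r. s 0 = d a @ r \<Longrightarrow>
    exec c s (k * length (d a) + k) (s(0 := r, 1 := marked (rev (d a)) @ False # s 1))"
    by (elim scannableE) blast
  from assms(2) obtain cf p where cf: "\<And>a s r. a \<in> S \<Longrightarrow> s 0 = e a @ r \<Longrightarrow>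
      exec cf s (poly p (length (e a))) (s(0 := e' (f a) @ r))" by (elim fpE) blast
  show ?thesis
  proof (rule fpI[of _ _ "c ;; cf ;; unstash" "[:k + 2, k + 7:] + p"])
    fix z r and s :: store assume z: "z \<in> (UNIV :: 'a set) \<times> S" and s: "s 0 = (d \<times>\<^sub>c e) z @ r"
    obtain a b where ab: "z = (a, b)" by force
    let ?s1 = "s(0 := e b @ r, 1 := marked (rev (d a)) @ False # s 1)"
    have 1: "exec c s (k * length (d a) + k) ?s1" by (rule c) (use s ab in simp)
    let ?s2 = "?s1(0 := e' (f b) @ r)"
    have 2: "exec cf ?s1 (poly p (length (e b))) ?s2" by (rule cf) (use z ab in auto)
    have 3: "exec unstash ?s2 (7 * length (d a) + 2) (?s2(0 := d a @ ?s2 0, 1 := s 1))"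
      by (rule exec_unstash) simp
    have "poly p (length (e b)) \<le> poly p (length ((d \<times>\<^sub>c e) z))"
      by (rule poly_mono_nat) (simp add: ab)
    with exec_weaken[OF exec_Seq[OF 1 exec_Seq[OF 2 3]], of "poly ([:k + 2, k + 7:] + p) (length ((d \<times>\<^sub>c e) z))"]
    show "exec (c ;; cf ;; unstash) s (poly ([:k + 2, k + 7:] + p) (length ((d \<times>\<^sub>c e) z)))
      (s(0 := (d \<times>\<^sub>c e') (fst z, f (snd z)) @ r))"
      by (auto simp: ab fun_upd_twist fun_upd_idem algebra_simps)
  qed
qed

lemma fp_dup:
  assumes "scannable e"
  shows "fp UNIV e (e \<times>\<^sub>c e) (\<lambda>z. (z, z))"
proof -
  from assms(1) obtain c k where c: "\<And>a s r. s 0 = e a @ r \<Longrightarrow>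
    exec c s (k * length (e a) + k) (s(0 := r, 1 := marked (rev (e a)) @ False # s 1))"
    by (elim scannableE) blast
  show ?thesis
  proof (rule fpI[of _ _ "c ;; unstash_copy ;; unstash" "[:k + 10, k + 27:]"])
    fix a r and s :: store assume s: "s 0 = e a @ r"
    let ?s1 = "s(0 := r, 1 := marked (rev (e a)) @ False # s 1)"
    let ?s2 = "?s1(0 := e a @ ?s1 0, 1 := marked (rev (e a)) @ False # s 1)"
    have 1: "exec c s (k * length (e a) + k) ?s1" by (rule c) (rule s)
    have 2: "exec unstash_copy ?s1 (20 * length (e a) + 8) ?s2" by (rule exec_unstash_copy) simp
    have 3: "exec unstash ?s2 (7 * length (e a) + 2) (?s2(0 := e a @ ?s2 0, 1 := s 1))"
      by (rule exec_unstash) simp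
    from exec_weaken[OF exec_Seq[OF 1 exec_Seq[OF 2 3]], of "poly [:k + 10, k + 27:] (length (e a))"]
    show "exec (c ;; unstash_copy ;; unstash) s (poly [:k + 10, k + 27:] (length (e a)))
      (s(0 := (e \<times>\<^sub>c e) (a, a) @ r))"
      by (auto simp: fun_upd_twist fun_upd_idem algebra_simps)
  qed
qed

lemma fp_const:
  assumes "scannable e"
  shows "fp S e e' (\<lambda>_. x)"
proof -
  from assms(1) obtain c k where c: "\<And>a s r. s 0 = e a @ r \<Longrightarrow>
    exec c s (k * length (e a) + k) (s(0 := r, 1 := marked (rev (e a)) @ False # s 1))"
    by (elim scannableE) blast
  define pushes :: "bool list \<Rightarrow> cmd" where "pushes w = foldr (\<lambda>b c. c ;; Push 0 b) w Skip" for w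
  have pushes: "exec (pushes w) s (2 * length w) (s(0 := w @ s 0))" for w s
  proof (induction w)
    case (Cons b w)
    show ?case unfolding pushes_def foldr.simps o_apply
      by (rule exec_cong[OF exec_Seq[OF Cons[unfolded pushes_def] exec_Push[where r = 0 and b = b]]]) auto
  qed (auto simp: pushes_def fun_upd_idem intro: exec_Skip)
  show ?thesis
  proof (rule fpI[of _ _ "c ;; forget ;; pushes (e' x)" "[:k + 2 + 2 * length (e' x), k + 5:]"])
    fix a r and s :: store assume s: "s 0 = e a @ r"
    let ?s1 = "s(0 := r, 1 := marked (rev (e a)) @ False # s 1)"
    have 1: "exec c s (k * length (e a) + k) ?s1" by (rule c) (rule s)
    have 2: "exec forget ?s1 (5 * length (rev (e a)) + 2) (?s1(1 := s 1))" by (rule exec_forget) simp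
    from exec_weaken[OF exec_Seq[OF 1 exec_Seq[OF 2 pushes[of "e' x"]]],
      of "poly [:k + 2 + 2 * length (e' x), k + 5:] (length (e a))"]
    show "exec (c ;; forget ;; pushes (e' x)) s (poly [:k + 2 + 2 * length (e' x), k + 5:] (length (e a)))
      (s(0 := e' x @ r))"
      by (auto simp: fun_upd_twist fun_upd_idem algebra_simps)
  qed
qed

lemma fp_length_code:
  assumes "scannable e"
  shows "fp UNIV e enc_unary (\<lambda>z. length (e z))"
proof -
  from assms(1) obtain c k where c: "\<And>a s r. s 0 = e a @ r \<Longrightarrow>
    exec c s (k * length (e a) + k) (s(0 := r, 1 := marked (rev (e a)) @ False # s 1))"
    by (elim scannableE) blast
  show ?thesis
  proof (rule fpI[of _ _ "c ;; count" "[:k + 4, k + 7:]"])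
    fix a r and s :: store assume s: "s 0 = e a @ r"
    let ?s1 = "s(0 := r, 1 := marked (rev (e a)) @ False # s 1)"
    have 1: "exec c s (k * length (e a) + k) ?s1" by (rule c) (rule s)
    have 2: "exec count ?s1 (7 * length (rev (e a)) + 4)
        (?s1(0 := enc_unary (length (rev (e a))) @ ?s1 0, 1 := s 1))" by (rule exec_count) simp
    from exec_weaken[OF exec_Seq[OF 1 2], of "poly [:k + 4, k + 7:] (length (e a))"]
    show "exec (c ;; count) s (poly [:k + 4, k + 7:] (length (e a)))
      (s(0 := enc_unary (length (e a)) @ r))"
      by (auto simp: fun_upd_twist fun_upd_idem algebra_simps)
  qed
qed

lemma fp_pair:
  assumes "fp S e e1 f" "fp S e e2 g" "scannable e"
  shows "fp S e (e1 \<times>\<^sub>c e2) (\<lambda>z. (f z, g z))"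
proof -
  have 1: "fp S e (e \<times>\<^sub>c e) (\<lambda>z. (z, z))"
    using fp_dup[OF assms(3)] by (rule fp_subset) simp
  have 2: "fp S e (e \<times>\<^sub>c e2) (\<lambda>z. (z, g z))"
    using fp_comp[OF fp_second[OF assms(3,2)] 1] by auto
  show ?thesis
    using fp_comp[OF fp_first[OF assms(1), of e2] 2] by auto
qed

text \<open>Projections reduce to constant functions: a component replaced by \<open>()\<close> has
  the empty code, so the code of the pair becomes the code of the other component.\<close>

lemma fp_fst:
  assumes "fp S e (e1 \<times>\<^sub>c e2) f" "scannable e1" "scannable e2"
  shows "fp S e e1 (\<lambda>z. fst (f z))"
proof -
  have "fp UNIV (e1 \<times>\<^sub>c e2) (e1 \<times>\<^sub>c unit_code) (\<lambda>z. (fst z, ()))"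
    using fp_second[OF assms(2) fp_const[OF assms(3), of UNIV unit_code "()"]] by simp
  then have "fp UNIV (e1 \<times>\<^sub>c e2) e1 fst"
    by (rule fp_cong) (auto simp: unit_code_def)
  from fp_o[OF this assms(1)] show ?thesis .
qed

lemma fp_snd:
  assumes "fp S e (e1 \<times>\<^sub>c e2) f" "scannable e1"
  shows "fp S e e2 (\<lambda>z. snd (f z))"
proof -
  have "fp UNIV (e1 \<times>\<^sub>c e2) (unit_code \<times>\<^sub>c e2) (\<lambda>z. ((), snd z))"
    using fp_first[OF fp_const[OF assms(2), of UNIV unit_code "()"]] by simp
  then have "fp UNIV (e1 \<times>\<^sub>c e2) e2 snd"
    by (rule fp_cong) (auto simp: unit_code_def)
  from fp_o[OF this assms(1)] show ?thesis .
qed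

text \<open>A list code starts with a tag bit that tells whether a head and a tail follow.\<close>

lemma fp_branch:
  assumes "fp S e1 e f" "fp T e2 e g"
    and "\<And>a. a \<in> U \<Longrightarrow> (\<exists>b\<in>S. d a = True # e1 b \<and> e' (h a) = e (f b)) \<or>
      (\<exists>b\<in>T. d a = False # e2 b \<and> e' (h a) = e (g b))"
  shows "fp U d e' h"
proof -
  from assms(1) obtain c1 p1 where 1: "\<And>a s r. a \<in> S \<Longrightarrow> s 0 = e1 a @ r \<Longrightarrow>
      exec c1 s (poly p1 (length (e1 a))) (s(0 := e (f a) @ r))" by (elim fpE) blast
  from assms(2) obtain c2 p2 where 2: "\<And>a s r. a \<in> T \<Longrightarrow> s 0 = e2 a @ r \<Longrightarrow>
      exec c2 s (poly p2 (length (e2 a))) (s(0 := e (g a) @ r))" by (elim fpE) blast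
  show ?thesis
  proof (rule fpI[of _ _ "Cond 0 {Some True} (Pop 0 ;; c1) (Pop 0 ;; c2)" "[:2:] + p1 + p2"])
    fix a r and s :: store assume "a \<in> U" and s: "s 0 = d a @ r"
    from assms(3)[OF this(1)]
    show "exec (Cond 0 {Some True} (Pop 0 ;; c1) (Pop 0 ;; c2)) s
      (poly ([:2:] + p1 + p2) (length (d a))) (s(0 := e' (h a) @ r))"
    proof (elim disjE bexE conjE)
      fix b assume b: "b \<in> S" "d a = True # e1 b" "e' (h a) = e (f b)"
      let ?s = "s(0 := tl (s 0))"
      have "exec (Pop 0) s 1 ?s" by (rule exec_Pop) simp
      moreover have "exec c1 ?s (poly p1 (length (e1 b))) (?s(0 := e (f b) @ r))"
        by (rule 1) (use s b in auto)
      ultimately have "exec (Pop 0 ;; c1) s (1 + poly p1 (length (e1 b))) (?s(0 := e (f b) @ r))"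
        by (rule exec_Seq)
      then have "exec (Cond 0 {Some True} (Pop 0 ;; c1) (Pop 0 ;; c2)) s
        (Suc (1 + poly p1 (length (e1 b)))) (?s(0 := e (f b) @ r))"
        by (rule exec_Cond_true[rotated 2]) (use s b in auto)
      moreover have "poly p1 (length (e1 b)) \<le> poly p1 (length (d a))"
        by (rule poly_mono_nat) (simp add: b)
      ultimately show ?thesis using b by (auto elim: exec_weaken)
    next
      fix b assume b: "b \<in> T" "d a = False # e2 b" "e' (h a) = e (g b)"
      let ?s = "s(0 := tl (s 0))"
      have "exec (Pop 0) s 1 ?s" by (rule exec_Pop) simp
      moreover have "exec c2 ?s (poly p2 (length (e2 b))) (?s(0 := e (g b) @ r))"
        by (rule 2) (use s b in auto)
      ultimately have "exec (Pop 0 ;; c2) s (1 + poly p2 (length (e2 b))) (?s(0 := e (g b) @ r))"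
        by (rule exec_Seq)
      then have "exec (Cond 0 {Some True} (Pop 0 ;; c1) (Pop 0 ;; c2)) s
        (Suc (1 + poly p2 (length (e2 b)))) (?s(0 := e (g b) @ r))"
        by (rule exec_Cond_false[rotated 2]) (use s b in auto)
      moreover have "poly p2 (length (e2 b)) \<le> poly p2 (length (d a))"
        by (rule poly_mono_nat) (simp add: b)
      ultimately show ?thesis using b by (auto elim: exec_weaken)
    qed
  qed
qed

lemma fp_if:
  assumes "fp UNIV e bool_code b" "fp UNIV e e' f" "fp UNIV e e' g" "scannable e"
  shows "fp UNIV e e' (\<lambda>z. if b z then f z else g z)"
proof -
  have "fp UNIV (bool_code \<times>\<^sub>c e) e' (\<lambda>p. if fst p then f (snd p) else g (snd p))"
    by (rule fp_branch[OF assms(2,3)]) (auto simp: bool_code_def)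
  from fp_o[OF this fp_pair[OF assms(1) fp_ident assms(4)]] show ?thesis by (simp cong: if_cong)
qed

lemma fp_case_list:
  assumes "fp UNIV e (enc_list e1) f" "fp UNIV e e' g"
    and "fp UNIV (e1 \<times>\<^sub>c enc_list e1 \<times>\<^sub>c e) e' (\<lambda>p. h (fst p) (fst (snd p)) (snd (snd p)))"
    and "scannable e"
  shows "fp UNIV e e' (\<lambda>z. case f z of [] \<Rightarrow> g z | x # xs \<Rightarrow> h x xs z)"
proof -
  have "fp UNIV (enc_list e1 \<times>\<^sub>c e) e'
      (\<lambda>p. case fst p of [] \<Rightarrow> g (snd p) | x # xs \<Rightarrow> h x xs (snd p))"
    by (rule fp_branch[OF assms(3,2)]) (auto split: list.splits, blast)
  from fp_o[OF this fp_pair[OF assms(1) fp_ident assms(4)]] show ?thesis by (simp cong: list.case_cong)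
qed

lemma fp_Cons:
  assumes "fp S e e1 f" "fp S e (enc_list e1) g" "scannable e"
  shows "fp S e (enc_list e1) (\<lambda>z. f z # g z)"
proof -
  \<comment> \<open>Head and tail already lie consecutively on the stack; only the tag bit has to be
    pushed.\<close>
  have "fp UNIV (e1 \<times>\<^sub>c enc_list e1) (enc_list e1) (\<lambda>p. fst p # snd p)"
    by (rule fpI[of _ _ "Push 0 True" "[:2:]"]) (auto simp: pair_code_eq intro!: exec_straightI)
  from fp_o[OF this fp_pair[OF assms]] show ?thesis by simp
qed

lemma length_le_enc_list: "length xs < length (enc_list e xs)"
  by (induction xs) auto

text \<open>The rest of the list, the accumulator and a fixed context lie on top of each other.
  Iterating a polynomial-time step could square the accumulator each time, so \<open>bd\<close>
  bounds it after every prefix of the list; all rounds then have a common polynomial cost.\<close>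

lemma fp_fold_core:
  fixes g :: "'a \<Rightarrow> 'b \<Rightarrow> 'c \<Rightarrow> 'b"
  assumes body: "fp UNIV (e1 \<times>\<^sub>c enc_list e1 \<times>\<^sub>c e2 \<times>\<^sub>c e) (enc_list e1 \<times>\<^sub>c e2 \<times>\<^sub>c e)
      (\<lambda>p. (fst (snd p), g (fst p) (fst (snd (snd p))) (snd (snd (snd p))), snd (snd (snd p))))"
    and bd: "\<And>xs b a i. (xs, b, a) \<in> S \<Longrightarrow> i \<le> length xs \<Longrightarrow>
      length (e2 (fold (\<lambda>x b. g x b a) (take i xs) b)) \<le> poly q (length ((enc_list e1 \<times>\<^sub>c e2 \<times>\<^sub>c e) (xs, b, a)))"
  shows "fp S (enc_list e1 \<times>\<^sub>c e2 \<times>\<^sub>c e) (e2 \<times>\<^sub>c e)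
      (\<lambda>z. (fold (\<lambda>x b. g x b (snd (snd z))) (fst z) (fst (snd z)), snd (snd z)))"
proof -
  from body obtain c p where c: "\<And>x xs b a r s.
      s 0 = (e1 \<times>\<^sub>c enc_list e1 \<times>\<^sub>c e2 \<times>\<^sub>c e) (x, xs, b, a) @ r \<Longrightarrow>
      exec c s (poly p (length ((e1 \<times>\<^sub>c enc_list e1 \<times>\<^sub>c e2 \<times>\<^sub>c e) (x, xs, b, a))))
        (s(0 := (enc_list e1 \<times>\<^sub>c e2 \<times>\<^sub>c e) (xs, g x b a, a) @ r))"
    unfolding fp_def by (metis (no_types, lifting) UNIV_I fst_conv snd_conv)
  let ?loop = "Loop 0 {Some True} (Pop 0 ;; c)"
  have loop: "exec ?loop s (length xs * (poly p N + 2) + 1)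
      (s(0 := False # e2 (fold (\<lambda>x b. g x b a) xs b) @ e a @ r))"
    if "s 0 = enc_list e1 xs @ e2 b @ e a @ r"
      and "\<And>i. i \<le> length xs \<Longrightarrow> length (e2 (fold (\<lambda>x b. g x b a) (take i xs) b)) \<le> B"
      and "length (enc_list e1 xs) + B + length (e a) \<le> N" for xs s b a r B N
    using that
  proof (induction xs arbitrary: s b)
    case Nil
    then show ?case using exec_Loop_stop[of 0 s "{Some True}" "Pop 0 ;; c"]
      by (auto simp: fun_upd_idem)
  next
    case (Cons x xs)
    let ?w = "(e1 \<times>\<^sub>c enc_list e1 \<times>\<^sub>c e2 \<times>\<^sub>c e) (x, xs, b, a)"
    let ?s1 = "s(0 := ?w @ r)"
    let ?s2 = "?s1(0 := (enc_list e1 \<times>\<^sub>c e2 \<times>\<^sub>c e) (xs, g x b a, a) @ r)"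
    have "length ?w \<le> N" using Cons.prems(2)[of 0] Cons.prems(3) by simp
    then have "exec c ?s1 (poly p N) ?s2"
      by (intro exec_weaken[OF c] poly_mono_nat) auto
    moreover have "exec (Pop 0) s 1 ?s1"
      by (rule exec_straightI) (use Cons.prems in auto)
    ultimately have 1: "exec (Pop 0 ;; c) s (1 + poly p N) ?s2" by (intro exec_Seq)
    have 2: "exec ?loop ?s2 (length xs * (poly p N + 2) + 1)
        (?s2(0 := False # e2 (fold (\<lambda>x b. g x b a) xs (g x b a)) @ e a @ r))"
    proof (rule Cons.IH)
      fix i assume "i \<le> length xs"
      then show "length (e2 (fold (\<lambda>x b. g x b a) (take i xs) (g x b a))) \<le> B"
        using Cons.prems(2)[of "Suc i"] by simp
    qed (use Cons.prems(3) in auto)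
    show ?case
      by (rule exec_cong[OF exec_Loop_step[OF _ _ 1 2]]) (use Cons.prems in auto)
  qed
  show ?thesis
  proof (rule fpI[of _ _ "?loop ;; Pop 0" "[:2:] + [:0, 1:] * (pcompose p ([:0, 1:] + q) + [:2:])"])
    fix z r and s :: store assume z: "z \<in> S" and s: "s 0 = (enc_list e1 \<times>\<^sub>c e2 \<times>\<^sub>c e) z @ r"
    obtain xs b a where zz: "z = (xs, b, a)" by (metis prod.exhaust)
    let ?n = "length ((enc_list e1 \<times>\<^sub>c e2 \<times>\<^sub>c e) z)"
    let ?N = "?n + poly q ?n"
    let ?b = "fold (\<lambda>x b. g x b a) xs b"
    have "exec ?loop s (length xs * (poly p ?N + 2) + 1) (s(0 := False # e2 ?b @ e a @ r))"
      by (rule loop[of _ _ b _ _ "poly q ?n"]) (use z s bd in \<open>auto simp: zz\<close>)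
    moreover have "exec (Pop 0) (s(0 := False # e2 ?b @ e a @ r)) 1 (s(0 := e2 ?b @ e a @ r))"
      by (rule exec_straightI) auto
    ultimately have "exec (?loop ;; Pop 0) s (length xs * (poly p ?N + 2) + 1 + 1) (s(0 := e2 ?b @ e a @ r))"
      by (rule exec_Seq)
    moreover have "length xs * (poly p ?N + 2) \<le> ?n * (poly p ?N + 2)"
      using length_le_enc_list[of xs e1] by (intro mult_right_mono) (auto simp: zz)
    ultimately show "exec (?loop ;; Pop 0) s (poly ([:2:] + [:0, 1:] * (pcompose p ([:0, 1:] + q) + [:2:])) ?n)
        (s(0 := (e2 \<times>\<^sub>c e) (fold (\<lambda>x b. g x b (snd (snd z))) (fst z) (fst (snd z)), snd (snd z)) @ r))"
      by (elim exec_cong) (auto simp: zz poly_pcompose algebra_simps)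
  qed
qed

definition size_bounded :: "'a set \<Rightarrow> ('a \<Rightarrow> bool list) \<Rightarrow> ('a \<Rightarrow> nat) \<Rightarrow> bool" where
  "size_bounded S e h \<longleftrightarrow> (\<exists>q. \<forall>z\<in>S. h z \<le> poly q (length (e z)))"

lemma size_bounded_fp:
  assumes "fp S e e' f"
  shows "size_bounded S e (\<lambda>z. length (e' (f z)))"
proof -
  from assms obtain p where "\<And>a. a \<in> S \<Longrightarrow> length (e' (f a)) \<le> length (e a) + poly p (length (e a))"
    by (elim fpE) blast
  then show ?thesis unfolding size_bounded_def by (intro exI[of _ "[:0, 1:] + p"]) auto
qed

lemma size_bounded_const: "size_bounded S e (\<lambda>_. k)"
  unfolding size_bounded_def by (intro exI[of _ "[:k:]"]) auto

lemma size_bounded_self: "size_bounded S e (\<lambda>z. length (e z))"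
  unfolding size_bounded_def by (intro exI[of _ "[:0, 1:]"]) auto

lemma size_bounded_add:
  assumes "size_bounded S e h" "size_bounded S e h'"
  shows "size_bounded S e (\<lambda>z. h z + h' z)"
proof -
  from assms obtain p q where "\<forall>z\<in>S. h z \<le> poly p (length (e z))" "\<forall>z\<in>S. h' z \<le> poly q (length (e z))"
    unfolding size_bounded_def by blast
  then show ?thesis unfolding size_bounded_def
    by (intro exI[of _ "p + q"]) (auto intro: add_mono)
qed

lemma size_bounded_mult:
  assumes "size_bounded S e h" "size_bounded S e h'"
  shows "size_bounded S e (\<lambda>z. h z * h' z)"
proof -
  from assms obtain p q where "\<forall>z\<in>S. h z \<le> poly p (length (e z))" "\<forall>z\<in>S. h' z \<le> poly q (length (e z))"
    unfolding size_bounded_def by blast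
  then show ?thesis unfolding size_bounded_def
    by (intro exI[of _ "p * q"]) (auto intro: mult_mono)
qed

lemma size_bounded_poly:
  assumes "size_bounded S e h"
  shows "size_bounded S e (\<lambda>z. poly p (h z))"
proof -
  from assms obtain q where "\<forall>z\<in>S. h z \<le> poly q (length (e z))"
    unfolding size_bounded_def by blast
  then show ?thesis unfolding size_bounded_def
    by (intro exI[of _ "pcompose p q"]) (auto simp: poly_pcompose intro: poly_mono_nat)
qed

lemmas fp_basic = fp_pair fp_fst fp_snd fp_ident fp_Cons scannable_pair scannable_list

text \<open>The context carried along is the input \<open>z\<close> itself, so that the step may
  depend on it. The size bound is available only for arguments that really occur, hence the core
  lemma is applied on an image set.\<close>

lemma fp_fold:
  assumes f: "fp S e (enc_list e1) f" and h: "fp S e e2 h"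
    and g: "fp UNIV (e1 \<times>\<^sub>c e2 \<times>\<^sub>c e) e2 (\<lambda>p. g (fst p) (fst (snd p)) (snd (snd p)))"
    and bd: "size_bounded S e B"
      "\<And>z i. z \<in> S \<Longrightarrow> i \<le> length (f z) \<Longrightarrow> length (e2 (fold (\<lambda>x b. g x b z) (take i (f z)) (h z))) \<le> B z"
    and e: "scannable e" "scannable e1" "scannable e2"
  shows "fp S e e2 (\<lambda>z. fold (\<lambda>x b. g x b z) (f z) (h z))"
proof -
  let ?E = "e1 \<times>\<^sub>c enc_list e1 \<times>\<^sub>c e2 \<times>\<^sub>c e"
  have "fp UNIV ?E (e1 \<times>\<^sub>c e2 \<times>\<^sub>c e) (\<lambda>p. (fst p, snd (snd p)))"
    by (rule fp_basic e)+
  from fp_o[OF g this] have b: "fp UNIV ?E e2 (\<lambda>p. g (fst p) (fst (snd (snd p))) (snd (snd (snd p))))"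
    by simp
  have body: "fp UNIV ?E (enc_list e1 \<times>\<^sub>c e2 \<times>\<^sub>c e)
      (\<lambda>p. (fst (snd p), g (fst p) (fst (snd (snd p))) (snd (snd (snd p))), snd (snd (snd p))))"
    by (rule b fp_basic e)+
  from bd(1) obtain q where q: "\<And>z. z \<in> S \<Longrightarrow> B z \<le> poly q (length (e z))"
    unfolding size_bounded_def by blast
  have core: "fp ((\<lambda>z. (f z, h z, z)) ` S) (enc_list e1 \<times>\<^sub>c e2 \<times>\<^sub>c e) (e2 \<times>\<^sub>c e)
      (\<lambda>z. (fold (\<lambda>x b. g x b (snd (snd z))) (fst z) (fst (snd z)), snd (snd z)))"
  proof (rule fp_fold_core[OF body, where q = q])
    fix xs b z i assume *: "(xs, b, z) \<in> (\<lambda>z. (f z, h z, z)) ` S" "i \<le> length xs"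
    then have "length (e2 (fold (\<lambda>x b. g x b z) (take i xs) b)) \<le> poly q (length (e z))"
      using bd(2)[of z i] q[of z] by auto
    also have "\<dots> \<le> poly q (length ((enc_list e1 \<times>\<^sub>c e2 \<times>\<^sub>c e) (xs, b, z)))"
      by (rule poly_mono_nat) simp
    finally show "length (e2 (fold (\<lambda>x b. g x b z) (take i xs) b)) \<le> \<dots>" .
  qed
  have arg: "fp S e (enc_list e1 \<times>\<^sub>c e2 \<times>\<^sub>c e) (\<lambda>z. (f z, h z, z))"
    by (rule f h fp_basic e)+
  show ?thesis using fp_fst[OF fp_comp[OF core arg] e(3,1)] by simp
qed

lemma fp_Nil: "scannable e \<Longrightarrow> fp S e (enc_list e1) (\<lambda>_. [])"
  by (rule fp_const)

lemma length_enc_list: "length (enc_list e xs) = (\<Sum>x\<leftarrow>xs. Suc (length (e x))) + 1"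
  by (induction xs) auto

lemma length_enc_list_take: "length (enc_list e (take i xs)) \<le> length (enc_list e xs)"
  by (induction xs arbitrary: i) (auto simp: take_Cons split: nat.splits)

lemma length_enc_list_append:
  "length (enc_list e (xs @ ys)) < length (enc_list e xs) + length (enc_list e ys)"
  by (simp add: length_enc_list)

lemma length_enc_list_rev: "length (enc_list e (rev xs)) = length (enc_list e xs)"
  by (simp add: length_enc_list rev_map[symmetric] sum_list_rev)

lemma fp_rev:
  assumes "fp UNIV e (enc_list e1) f" "scannable e" "scannable e1"
  shows "fp UNIV e (enc_list e1) (\<lambda>z. rev (f z))"
proof -
  have fold: "fold (\<lambda>x b. x # b) xs ys = rev xs @ ys" for xs ys :: "'b list"
    by (induction xs arbitrary: ys) auto
  have "fp UNIV e (enc_list e1) (\<lambda>z. fold (\<lambda>x b. x # b) (f z) [])"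
  proof (rule fp_fold[OF assms(1) fp_Nil[OF assms(2)] _ size_bounded_fp[OF assms(1)] _ assms(2,3)])
    show "fp UNIV (e1 \<times>\<^sub>c enc_list e1 \<times>\<^sub>c e) (enc_list e1) (\<lambda>p. fst p # fst (snd p))"
      by (rule fp_basic assms)+
  qed (auto simp: fold length_enc_list_rev length_enc_list_take assms)
  then show ?thesis by (simp add: fold)
qed

lemma fp_append:
  assumes "fp UNIV e (enc_list e1) f" "fp UNIV e (enc_list e1) g" "scannable e" "scannable e1"
  shows "fp UNIV e (enc_list e1) (\<lambda>z. f z @ g z)"
proof -
  have fold: "fold (\<lambda>x b. x # b) xs ys = rev xs @ ys" for xs ys :: "'b list"
    by (induction xs arbitrary: ys) auto
  have "fp UNIV e (enc_list e1) (\<lambda>z. fold (\<lambda>x b. x # b) (rev (f z)) (g z))"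
  proof (rule fp_fold[OF fp_rev[OF assms(1,3,4)] assms(2) _
        size_bounded_add[OF size_bounded_fp[OF assms(1)] size_bounded_fp[OF assms(2)]] _ assms(3,4)])
    show "fp UNIV (e1 \<times>\<^sub>c enc_list e1 \<times>\<^sub>c e) (enc_list e1) (\<lambda>p. fst p # fst (snd p))"
      by (rule fp_basic assms)+
    fix z i
    show "length (enc_list e1 (fold (\<lambda>x b. x # b) (take i (rev (f z))) (g z)))
        \<le> length (enc_list e1 (f z)) + length (enc_list e1 (g z))"
      using length_enc_list_append[of e1 "rev (take i (rev (f z)))" "g z"]
        length_enc_list_take[of e1 i "rev (f z)"]
      by (simp add: fold length_enc_list_rev)
  qed (auto simp: assms)
  then show ?thesis by (simp add: fold)
qed

text \<open>Consing inside a fold reverses the list, so a final \<open>rev\<close> follows. In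
  \<open>B\<close> the number of elements is multiplied by a common bound on the image of one
  element, since an element is no longer than the code of the whole list.\<close>

lemma fp_map:
  assumes f: "fp UNIV e (enc_list e1) f"
    and g: "fp UNIV (e1 \<times>\<^sub>c e) e2 (\<lambda>p. g (fst p) (snd p))"
    and e: "scannable e" "scannable e1" "scannable e2"
  shows "fp UNIV e (enc_list e2) (\<lambda>z. map (\<lambda>x. g x z) (f z))"
proof -
  have fold: "fold (\<lambda>x b. g x z # b) xs ys = rev (map (\<lambda>x. g x z) xs) @ ys" for xs ys z
    by (induction xs arbitrary: ys) auto
  from size_bounded_fp[OF g] obtain q
    where q: "\<And>x z. length (e2 (g x z)) \<le> poly q (length (e1 x) + length (e z))"
    unfolding size_bounded_def by fastforce
  define B where "B z = length (enc_list e1 (f z)) *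
    (1 + poly q (length (enc_list e1 (f z)) + length (e z))) + 1" for z
  have B: "size_bounded UNIV e B" unfolding B_def
    by (intro size_bounded_add size_bounded_mult size_bounded_const size_bounded_poly
        size_bounded_fp[OF f] size_bounded_self)
  have map: "length (enc_list e2 (map (\<lambda>x. g x z) xs)) \<le>
      length xs * (1 + poly q (length (enc_list e1 xs) + length (e z))) + 1" for xs z
  proof (induction xs)
    case (Cons x xs)
    let ?q = "\<lambda>xs. poly q (length (enc_list e1 xs) + length (e z))"
    have "length (e2 (g x z)) \<le> ?q (x # xs)"
      by (rule order.trans[OF q poly_mono_nat]) simp
    moreover have "length xs * (1 + ?q xs) \<le> length xs * (1 + ?q (x # xs))"
      by (intro mult_left_mono add_mono poly_mono_nat) auto
    ultimately have "Suc (length (e2 (g x z))) + (length xs * (1 + ?q xs) + 1) \<le>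
        length (x # xs) * (1 + ?q (x # xs)) + 1"
      by (simp only: length_Cons mult_Suc)
    with Cons show ?case by (simp only: list.map enc_list_simps length_Cons length_append)
  qed auto
  have "length (enc_list e2 (map (\<lambda>x. g x z) (take i (f z)))) \<le> B z" for i z
  proof -
    have "length (take i (f z)) * (1 + poly q (length (enc_list e1 (take i (f z))) + length (e z))) + 1 \<le> B z"
      unfolding B_def using length_enc_list_take[of e1 i "f z"] length_le_enc_list[of "take i (f z)" e1]
      by (intro add_mono mult_mono poly_mono_nat) auto
    with map[of z "take i (f z)"] show ?thesis by linarith
  qed
  note bd = this
  have "fp UNIV e (enc_list e2) (\<lambda>z. fold (\<lambda>x b. g x z # b) (f z) [])"
  proof (rule fp_fold[OF f fp_Nil[OF e(1)] _ B _ e(1,2)])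
    have "fp UNIV (e1 \<times>\<^sub>c enc_list e2 \<times>\<^sub>c e) (e1 \<times>\<^sub>c e) (\<lambda>p. (fst p, snd (snd p)))"
      by (rule fp_basic e)+
    from fp_o[OF g this]
    have gg: "fp UNIV (e1 \<times>\<^sub>c enc_list e2 \<times>\<^sub>c e) e2 (\<lambda>p. g (fst p) (snd (snd p)))" by simp
    show "fp UNIV (e1 \<times>\<^sub>c enc_list e2 \<times>\<^sub>c e) (enc_list e2) (\<lambda>p. g (fst p) (snd (snd p)) # fst (snd p))"
      by (rule gg fp_basic e)+
  qed (auto simp: fold length_enc_list_rev bd e)
  from fp_rev[OF this e(1,3)] show ?thesis by (simp add: fold)
qed

section \<open>Arithmetic and table access on list codes\<close>

lemma scannable_comp: "scannable e \<Longrightarrow> (\<And>a. e' a = e (g a)) \<Longrightarrow> scannable e'"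
  unfolding scannable_def by metis

text \<open>With the empty code for \<open>()\<close>, a unary number is a list of units. Addition,
  truncated subtraction and the test for 0 become append, \<open>drop\<close> and a case distinction
  on lists.\<close>

lemma enc_unary_conv: "enc_unary n = enc_list unit_code (replicate n ())"
  by (induction n) (auto simp: enc_unary_def unit_code_def)

lemma enc_nat_conv: "enc_nat n = enc_list bool_code (bits n)"
  by (simp add: enc_nat_def bool_code_def[abs_def])

lemma enc_rat_conv:
  "enc_rat r = (bool_code \<times>\<^sub>c enc_nat \<times>\<^sub>c enc_nat)
    (fst (quotient_of r) < 0, nat \<bar>fst (quotient_of r)\<bar>, nat (snd (quotient_of r)))"
  by (simp add: enc_rat_def enc_int_def bool_code_def split: prod.splits)

lemma scannable_unary: "scannable enc_unary"
  by (rule scannable_comp[where e = "enc_list unit_code"]) (auto simp: enc_unary_conv)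

lemma scannable_nat: "scannable enc_nat"
  by (rule scannable_comp[where e = "enc_list bool_code"]) (auto simp: enc_nat_conv)

lemma scannable_rat: "scannable enc_rat"
  by (rule scannable_comp[where e = "bool_code \<times>\<^sub>c enc_nat \<times>\<^sub>c enc_nat"]) (auto simp only: enc_rat_conv intro: scannable_nat scannable_bool scannable_pair)

lemmas scannable_intros = scannable_unit scannable_bool scannable_unary scannable_nat scannable_rat
  scannable_pair scannable_list

lemma length_enc_unary [simp]: "length (enc_unary n) = Suc n"
  by (simp add: enc_unary_def)

lemma fp_unary_iff: "fp S e enc_unary f \<longleftrightarrow> fp S e (enc_list unit_code) (\<lambda>z. replicate (f z) ())"
  unfolding fp_def by (simp add: enc_unary_conv)

lemma fp_nat_iff: "fp S e enc_nat f \<longleftrightarrow> fp S e (enc_list bool_code) (\<lambda>z. bits (f z))"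
  unfolding fp_def by (simp add: enc_nat_conv)

lemma fp_Suc:
  assumes "fp S e enc_unary f" "scannable e"
  shows "fp S e enc_unary (\<lambda>z. Suc (f z))"
  using fp_Cons[OF fp_const[OF assms(2), of S unit_code "()"] assms(1)[unfolded fp_unary_iff] assms(2)]
  by (simp add: fp_unary_iff)

lemma fp_tl:
  assumes "fp UNIV e (enc_list e1) f" "scannable e" "scannable e1"
  shows "fp UNIV e (enc_list e1) (\<lambda>z. tl (f z))"
proof -
  have "fp UNIV e (enc_list e1) (\<lambda>z. case f z of [] \<Rightarrow> [] | x # xs \<Rightarrow> xs)"
    by (rule fp_case_list[OF assms(1)] fp_Nil fp_basic assms)+
  then show ?thesis by (simp add: list.case_eq_if tl_def)
qed

lemma fp_drop:
  assumes "fp UNIV e (enc_list e1) f" "fp UNIV e enc_unary n" "scannable e" "scannable e1"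
  shows "fp UNIV e (enc_list e1) (\<lambda>z. drop (n z) (f z))"
proof -
  have fold: "fold (\<lambda>_ xs. tl xs) (replicate n ()) xs = drop n xs" for n and xs :: "'b list"
    by (induction n arbitrary: xs) (auto simp: drop_Suc)
  have drop: "length (enc_list e1 (drop i xs)) \<le> length (enc_list e1 xs)" for i xs
    by (induction xs arbitrary: i) (auto simp: drop_Cons split: nat.splits intro: le_SucI trans_le_add2)
  have "fp UNIV e (enc_list e1) (\<lambda>z. fold (\<lambda>_ xs. tl xs) (replicate (n z) ()) (f z))"
  proof (rule fp_fold[OF assms(2)[unfolded fp_unary_iff] assms(1) _ size_bounded_fp[OF assms(1)] _ assms(3)])
    show "fp UNIV (unit_code \<times>\<^sub>c enc_list e1 \<times>\<^sub>c e) (enc_list e1) (\<lambda>p. tl (fst (snd p)))"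
      by (rule fp_tl fp_basic assms scannable_intros)+
    fix z i
    show "length (enc_list e1 (fold (\<lambda>_ xs. tl xs) (take i (replicate (n z) ())) (f z)))
        \<le> length (enc_list e1 (f z))"
      by (simp only: take_replicate fold drop)
  qed (auto simp: assms)
  then show ?thesis by (simp only: fold)
qed

text \<open>A total access function, so that table entries are computable over \<open>UNIV\<close>
  without index conditions.\<close>

definition nth_default :: "'a \<Rightarrow> 'a list \<Rightarrow> nat \<Rightarrow> 'a" where
  "nth_default d xs i = (if i < length xs then xs ! i else d)"

lemma nth_default_drop: "nth_default d xs i = (case drop i xs of [] \<Rightarrow> d | x # _ \<Rightarrow> x)"
  by (auto simp: nth_default_def Cons_nth_drop_Suc[symmetric])

lemma fp_nth_default:
  assumes "fp UNIV e (enc_list e1) f" "fp UNIV e enc_unary n" "scannable e" "scannable e1"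
  shows "fp UNIV e e1 (\<lambda>z. nth_default d (f z) (n z))"
  unfolding nth_default_drop
  by (rule fp_case_list[OF fp_drop[OF assms]] fp_const fp_basic assms)+

lemma fp_length:
  assumes "fp UNIV e (enc_list e1) f" "scannable e" "scannable e1"
  shows "fp UNIV e enc_unary (\<lambda>z. length (f z))"
proof -
  have "fp UNIV e (enc_list unit_code) (\<lambda>z. map (\<lambda>_. ()) (f z))"
    by (rule fp_map[OF assms(1)] fp_const scannable_intros assms)+
  then show ?thesis by (simp add: fp_unary_iff map_replicate_const)
qed

lemma fp_add:
  assumes "fp UNIV e enc_unary f" "fp UNIV e enc_unary g" "scannable e"
  shows "fp UNIV e enc_unary (\<lambda>z. f z + g z)"
  using fp_append[OF assms(1,2)[unfolded fp_unary_iff] assms(3)]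
  by (simp add: fp_unary_iff replicate_add)

lemma fp_diff:
  assumes "fp UNIV e enc_unary f" "fp UNIV e enc_unary g" "scannable e"
  shows "fp UNIV e enc_unary (\<lambda>z. f z - g z)"
  using fp_drop[OF assms(1)[unfolded fp_unary_iff] assms(2,3)]
  by (simp add: fp_unary_iff)

lemma fp_eq_0:
  assumes "fp UNIV e enc_unary f" "scannable e"
  shows "fp UNIV e bool_code (\<lambda>z. f z = 0)"
proof -
  have "fp UNIV e bool_code (\<lambda>z. case replicate (f z) () of [] \<Rightarrow> True | _ # _ \<Rightarrow> False)"
    by (rule fp_case_list[OF assms(1)[unfolded fp_unary_iff]] fp_const scannable_intros assms)+
  then show ?thesis by (rule fp_cong) (simp add: list.case_eq_if)
qed

lemma fp_conj:
  assumes "fp UNIV e bool_code f" "fp UNIV e bool_code g" "scannable e"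
  shows "fp UNIV e bool_code (\<lambda>z. f z \<and> g z)"
  by (rule fp_cong[OF fp_if[OF assms(1,2) fp_const[OF assms(3)] assms(3), of False]]) auto

lemma fp_eq:
  assumes "fp UNIV e enc_unary f" "fp UNIV e enc_unary g" "scannable e"
  shows "fp UNIV e bool_code (\<lambda>z. f z = g z)"
proof -
  have "fp UNIV e bool_code (\<lambda>z. f z - g z = 0 \<and> g z - f z = 0)"
    by (rule fp_conj fp_eq_0 fp_diff assms)+
  then show ?thesis by (rule fp_cong) (auto simp: bool_code_def)
qed

lemma fp_upt:
  assumes "fp UNIV e enc_unary n" "scannable e"
  shows "fp UNIV e (enc_list enc_unary) (\<lambda>z. [0..<n z])"
proof -
  \<comment> \<open>The length of the list built so far is its next element, so no counter is
    carried along.\<close>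
  have fold: "fold (\<lambda>_ xs. xs @ [length xs]) (replicate n ()) [0..<k] = [0..<k + n]" for n k
  proof (induction n arbitrary: k)
    case (Suc n)
    from Suc[of "Suc k"] show ?case by simp
  qed auto
  have size: "length (enc_list enc_unary [0..<i]) \<le> i * Suc (Suc i) + 1" for i
  proof -
    have "(\<Sum>x\<leftarrow>[0..<i]. Suc (length (enc_unary x))) \<le> (\<Sum>x\<leftarrow>[0..<i]. Suc (Suc i))"
      by (intro sum_list_mono) auto
    also have "\<dots> = i * Suc (Suc i)" by (simp only: sum_list_triv length_upt) simp
    finally show ?thesis by (simp add: length_enc_list)
  qed
  define B where "B z = length (enc_unary (n z)) * (2 + length (enc_unary (n z))) + 1" for z
  have B: "size_bounded UNIV e B" unfolding B_def
    by (intro size_bounded_add size_bounded_mult size_bounded_const size_bounded_fp[OF assms(1)])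
  have "fp UNIV e (enc_list enc_unary) (\<lambda>z. fold (\<lambda>_ xs. xs @ [length xs]) (replicate (n z) ()) [])"
  proof (rule fp_fold[OF assms(1)[unfolded fp_unary_iff] fp_Nil[OF assms(2)] _ B _ assms(2)])
    show "fp UNIV (unit_code \<times>\<^sub>c enc_list enc_unary \<times>\<^sub>c e) (enc_list enc_unary)
        (\<lambda>p. fst (snd p) @ [length (fst (snd p))])"
      by (rule fp_append fp_Nil fp_length fp_basic assms scannable_intros)+
    fix z i assume i: "i \<le> length (replicate (n z) ())"
    have "i * Suc (Suc i) + 1 \<le> B z"
      unfolding B_def using i by (intro add_mono mult_mono) auto
    with size[of i] i show "length (enc_list enc_unary
        (fold (\<lambda>_ xs. xs @ [length xs]) (take i (replicate (n z) ())) [])) \<le> B z"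
      using fold[of i 0] by (simp add: take_replicate min_absorb1)
  qed (auto simp: scannable_intros)
  then show ?thesis using fold[of _ 0] by simp
qed

lemma length_enc_list_concat: "length (enc_list e (concat xss)) \<le> length (enc_list (enc_list e) xss)"
proof (induction xss)
  case (Cons xs xss)
  then show ?case using length_enc_list_append[of e xs "concat xss"] by simp
qed auto

lemma fp_concat:
  assumes "fp UNIV e (enc_list (enc_list e1)) f" "scannable e" "scannable e1"
  shows "fp UNIV e (enc_list e1) (\<lambda>z. concat (f z))"
proof -
  have fold: "fold (\<lambda>xs ys. xs @ ys) xss ys = concat (rev xss) @ ys" for xss and ys :: "'b list"
    by (induction xss arbitrary: ys) auto
  have "fp UNIV e (enc_list e1) (\<lambda>z. fold (\<lambda>xs ys. xs @ ys) (rev (f z)) [])"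
  proof (rule fp_fold[OF fp_rev[OF assms(1,2)] fp_Nil[OF assms(2)] _ size_bounded_fp[OF assms(1)] _ assms(2)])
    show "fp UNIV (enc_list e1 \<times>\<^sub>c enc_list e1 \<times>\<^sub>c e) (enc_list e1) (\<lambda>p. fst p @ fst (snd p))"
      by (rule fp_append fp_basic assms)+
    fix z i
    have "length (enc_list e1 (concat (rev (take i (rev (f z)))))) \<le> length (enc_list (enc_list e1) (f z))"
      using length_enc_list_concat[of e1 "rev (take i (rev (f z)))"]
        length_enc_list_take[of "enc_list e1" i "rev (f z)"]
      by (simp add: length_enc_list_rev)
    then show "length (enc_list e1 (fold (\<lambda>xs ys. xs @ ys) (take i (rev (f z))) []))
        \<le> length (enc_list (enc_list e1) (f z))"
      by (simp add: fold)
  qed (auto simp: assms)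
  then show ?thesis by (simp add: fold)
qed

lemma fp_length_enc:
  "fp UNIV e e1 f \<Longrightarrow> scannable e1 \<Longrightarrow> fp UNIV e enc_unary (\<lambda>z. length (e1 (f z)))"
  by (rule fp_o[OF fp_length_code])

lemma bits_0 [simp]: "bits 0 = []"
  by (simp add: bits.simps)

lemma bits_double [simp]: "0 < n \<Longrightarrow> bits (2 * n) = False # bits n"
  by (subst bits.simps) simp

lemma bits_double_Suc [simp]: "bits (Suc (2 * n)) = True # bits n"
  by (subst bits.simps) simp

lemma bits_power2: "bits (2 ^ n) = replicate n False @ [True]"
proof (induction n)
  case 0
  then show ?case using bits_double_Suc[of 0] by simp
qed simp

lemma fp_double_Suc:
  assumes "fp UNIV e enc_nat f" "scannable e"
  shows "fp UNIV e enc_nat (\<lambda>z. Suc (2 * f z))"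
  using fp_Cons[OF fp_const[OF assms(2), of _ bool_code True] assms(1)[unfolded fp_nat_iff] assms(2)]
  by (simp add: fp_nat_iff)

lemma fp_power2:
  assumes "fp UNIV e enc_unary n" "scannable e"
  shows "fp UNIV e enc_nat (\<lambda>z. 2 ^ n z)"
proof -
  have "fp UNIV e (enc_list bool_code) (\<lambda>z. map (\<lambda>_. False) (replicate (n z) ()) @ [True])"
    by (rule fp_append fp_map[OF assms(1)[unfolded fp_unary_iff]] fp_const scannable_intros assms)+
  then show ?thesis by (simp add: fp_nat_iff bits_power2)
qed

lemma fp_rat_of_nat:
  assumes "fp UNIV e enc_nat f" "scannable e"
  shows "fp UNIV e enc_rat (\<lambda>z. of_nat (f z))"
proof -
  have q: "quotient_of (of_nat n) = (int n, 1)" for n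
    using quotient_of_int[of "int n"] by simp
  have "fp UNIV e (bool_code \<times>\<^sub>c enc_nat \<times>\<^sub>c enc_nat) (\<lambda>z. (False, f z, 1))"
    by (rule fp_pair fp_const assms)+
  then show ?thesis by (rule fp_cong) (simp add: enc_rat_conv q)
qed

lemma fp_rat_inverse_power2:
  assumes "fp UNIV e enc_unary n" "scannable e"
  shows "fp UNIV e enc_rat (\<lambda>z. 1 / 2 ^ n z)"
proof -
  have q: "quotient_of (1 / 2 ^ n) = (1, 2 ^ n)" for n
    using quotient_of_Fract[of 1 "2 ^ n"] by (simp add: Fract_of_int_quotient)
  have "fp UNIV e (bool_code \<times>\<^sub>c enc_nat \<times>\<^sub>c enc_nat) (\<lambda>z. (False, 1, 2 ^ n z))"
    by (rule fp_pair fp_const fp_power2 assms)+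
  then show ?thesis by (rule fp_cong) (simp add: enc_rat_conv q nat_power_eq)
qed

text \<open>Negation flips the leading sign bit except for zero, whose sign bit is always
  \<open>False\<close>. Zero is recognised by the next bit, since the code of the absolute numerator
  starts with \<open>False\<close> exactly when it is 0.\<close>

lemma fp_rat_uminus:
  assumes "fp UNIV e enc_rat f"
  shows "fp UNIV e enc_rat (\<lambda>z. - f z)"
proof -
  have "fp UNIV enc_rat enc_rat uminus"
  proof (rule fpI[of _ _ "Cond 0 {Some True} (Pop 0 ;; Push 0 False)
        (Pop 0 ;; Cond 0 {Some True} (Push 0 True) (Push 0 False))" "[:20:]"])
    fix x r and s :: store assume s: "s 0 = enc_rat x @ r"
    obtain p q where pq: "quotient_of x = (p, q)" by force
    then have m: "quotient_of (- x) = (- p, q)" by (simp add: rat_uminus_code)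
    have 0: "enc_nat (nat \<bar>p\<bar>) = [False]" if "p = 0" using that by (simp add: enc_nat_conv)
    have 1: "\<exists>w. enc_nat (nat \<bar>p\<bar>) = True # w" if "p \<noteq> 0"
      using that bits.simps[of "nat \<bar>p\<bar>"] by (simp add: enc_nat_conv)
    show "exec (Cond 0 {Some True} (Pop 0 ;; Push 0 False)
        (Pop 0 ;; Cond 0 {Some True} (Push 0 True) (Push 0 False))) s
        (poly [:20:] (length (enc_rat x))) (s(0 := enc_rat (- x) @ r))"
    proof (rule exec_straightI)
      show "result (Cond 0 {Some True} (Pop 0 ;; Push 0 False)
        (Pop 0 ;; Cond 0 {Some True} (Push 0 True) (Push 0 False))) s = s(0 := enc_rat (- x) @ r)"
      proof (cases "p = 0")
        case True
        with s 0 show ?thesis by (simp add: enc_rat_conv pq m bool_code_def)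
      next
        case False
        with s 1 show ?thesis by (cases "p < 0") (auto simp: enc_rat_conv pq m bool_code_def)
      qed
    qed auto
  qed
  from fp_o[OF this assms] show ?thesis .
qed

text \<open>Horner's scheme starting from the most significant bit, hence \<open>rev\<close>.
  Partial values never exceed the final one, so the bound on \<open>k\<close> also bounds the
  accumulator; without such a bound the unary form could be exponentially long.\<close>

lemma fp_unary_of_bits:
  assumes "fp S e (enc_list bool_code) (\<lambda>z. rev (bits (k z)))" "size_bounded S e k" "scannable e"
  shows "fp S e enc_unary k"
proof -
  let ?f = "\<lambda>b n::nat. if b then Suc (n + n) else n + n"
  have val: "fold ?f (rev (bits n)) 0 = n" for n
  proof (induction n rule: less_induct)
    case (less n)
    show ?case
    proof (cases "n = 0")
      case False
      then have "fold ?f (rev (bits (n div 2))) 0 = n div 2" by (intro less) auto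
      moreover have "bits n = odd n # bits (n div 2)" using False by (subst bits.simps) simp
      ultimately have "fold ?f (rev (bits n)) 0 = ?f (odd n) (n div 2)" by simp
      also have "\<dots> = n" by presburger
      finally show ?thesis .
    qed auto
  qed
  have mono: "n \<le> fold ?f w n" for w n
  proof (induction w arbitrary: n)
    case (Cons b w)
    have "n \<le> ?f b n" by auto
    also have "\<dots> \<le> fold ?f w (?f b n)" by (rule Cons)
    finally show ?case by simp
  qed auto
  have part: "fold ?f (take i w) n \<le> fold ?f w n" for i w n
  proof -
    have "fold ?f (take i w @ drop i w) n = fold ?f (drop i w) (fold ?f (take i w) n)"
      by (simp only: fold_append o_apply)
    with mono[of "fold ?f (take i w) n" "drop i w"] show ?thesis by (simp only: append_take_drop_id)
  qed
  have "fp S e enc_unary (\<lambda>z. fold ?f (rev (bits (k z))) 0)"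
  proof (rule fp_fold[OF assms(1) fp_const[OF assms(3)] _ size_bounded_add[OF size_bounded_const[of _ _ 1] assms(2)]])
    show "fp UNIV (bool_code \<times>\<^sub>c enc_unary \<times>\<^sub>c e) enc_unary
        (\<lambda>p. if fst p then Suc (fst (snd p) + fst (snd p)) else fst (snd p) + fst (snd p))"
      by (rule fp_if fp_Suc fp_add fp_basic assms scannable_intros)+
    fix z i
    show "length (enc_unary (fold ?f (take i (rev (bits (k z)))) 0)) \<le> 1 + k z"
      using part[of i "rev (bits (k z))" 0] by (simp add: val)
  qed (auto simp: assms scannable_intros)
  then show ?thesis by (simp add: val)
qed

section \<open>The reduction\<close>

text \<open>
  Variables and constraints of the new instance are named by triples. A point of \<open>X\<close> consists of
  \<open>x\<^sub>l\<close> (named \<open>(0, l, 0)\<close>), the candidates \<open>y\<^sup>i\<^sub>j\<close> (named \<open>(1, i, j)\<close>) and a coordinate \<open>(2, 0, 0)\<close> with value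
  \<open>1\<close>; an adversary's point consists of \<open>u\<^sub>l\<close>, of markers \<open>(1, i, j)\<close> claiming that \<open>y\<^sup>i\<close> violates row \<open>j\<close>,
  and again of a coordinate with value \<open>1\<close>.
\<close>

type_synonym name = "nat \<times> nat \<times> nat"

definition var_names :: "nat \<Rightarrow> nat \<Rightarrow> nat \<Rightarrow> name list" where
  "var_names n k m = map (\<lambda>l. (0, l, 0)) [0..<n] @
     concat (map (\<lambda>i. map (\<lambda>j. (1, i, j)) [0..<m]) [0..<k]) @ [(2, 0, 0)]"

text \<open>Tag 0 stands for the original rows and tags 1 to 3 for upper bounds on the variables of
  tags 0 to 2. Row \<open>(4, 0, 0)\<close> is the lower bound that, together with row
  \<open>(3, 0, 0)\<close>, fixes the constant coordinate to 1.\<close>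

definition row_names :: "nat \<Rightarrow> name list \<Rightarrow> name list" where
  "row_names m L = map (\<lambda>r. (0, r, 0)) [0..<m] @ map (\<lambda>d. (Suc (fst d), snd d)) L @ [(4, 0, 0)]"

definition claim_names :: "nat \<Rightarrow> nat \<Rightarrow> name list" where
  "claim_names k m = map (\<lambda>i. (5, i, 0)) [0..<k] @
     concat (map (\<lambda>i. map (\<lambda>j. (6, i, j)) [0..<m]) [0..<k])"

definition box_entry :: "name \<Rightarrow> name \<Rightarrow> rat" where
  "box_entry \<rho> d =
     (if fst \<rho> = 4 then (if fst d = 2 then - 1 else 0)
      else if fst \<rho> = Suc (fst d) \<and> fst (snd \<rho>) = fst (snd d) \<and> snd (snd \<rho>) = snd (snd d) then 1 else 0)"

definition lookup :: "rat list list \<Rightarrow> nat \<Rightarrow> nat \<Rightarrow> rat" where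
  "lookup A i j = nth_default 0 (nth_default [] A i) j"

definition x_entry :: "rat list list \<Rightarrow> name \<Rightarrow> name \<Rightarrow> rat" where
  "x_entry A \<rho> d =
     (if fst \<rho> = 0 then (if fst d = 0 then lookup A (fst (snd \<rho>)) (fst (snd d)) else 0)
      else box_entry \<rho> d)"

text \<open>
  Row \<open>(5, i, 0)\<close> forces some marker of \<open>y\<^sup>i\<close>. Row \<open>(6, i, j)\<close> reads
  \<open>- (T(u) x + W y\<^sup>i)\<^sub>j + M z\<^sub>i\<^sub>j + \<epsilon> \<le> M\<close>, so that a marker \<open>z\<^sub>i\<^sub>j \<ge> 1\<close> forces a strict violation.
\<close>

definition u_entry :: "rat list list list \<Rightarrow> rat list list list \<Rightarrow> rat list list \<Rightarrow> rat \<Rightarrow> rat \<Rightarrow>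
    name \<Rightarrow> name \<Rightarrow> name \<Rightarrow> rat" where
  "u_entry B T W M \<epsilon> d \<rho> c =
     (if fst \<rho> = 0 then
        (if fst d = 0 \<and> fst c = 0
         then lookup (nth_default [] B (fst (snd d))) (fst (snd \<rho>)) (fst (snd c)) else 0)
      else if fst \<rho> = 5 then
        (if fst d = 2 \<and> fst c = 1 \<and> fst (snd c) = fst (snd \<rho>) then - 1 else 0)
      else if fst \<rho> = 6 then
        (if fst d = 0 \<and> fst c = 0
         then - lookup (nth_default [] T (fst (snd c))) (snd (snd \<rho>)) (fst (snd d))
         else if fst d = 1 \<and> fst c = 2 \<and> fst (snd d) = fst (snd \<rho>)
         then - lookup W (snd (snd \<rho>)) (snd (snd d))
         else if fst d = 2 \<and> fst c = 1 \<and> fst (snd c) = fst (snd \<rho>) \<and> snd (snd c) = snd (snd \<rho>)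
         then M
         else if fst d = 2 \<and> fst c = 2 then \<epsilon>
         else 0)
      else (if fst d = 2 then box_entry \<rho> c else 0))"

text \<open>\<open>s\<close> is the upper bound for the variables of tag 1: \<open>R\<close> for the
  candidates and 1 for the markers. Such rows are needed because an instance has only one common
  bound for all its variables.\<close>

definition rhs :: "rat list \<Rightarrow> rat \<Rightarrow> rat \<Rightarrow> rat \<Rightarrow> name \<Rightarrow> rat" where
  "rhs v R s M \<rho> =
     (if fst \<rho> = 0 then nth_default 0 v (fst (snd \<rho>)) else if fst \<rho> = 1 then R
      else if fst \<rho> = 2 then s else if fst \<rho> = 3 then 1 else if fst \<rho> = 4 then - 1
      else if fst \<rho> = 5 then - 1 else M)"

definition table_mat :: "'b list \<Rightarrow> 'c list \<Rightarrow> ('b \<Rightarrow> 'c \<Rightarrow> 'a) \<Rightarrow> 'a mat" where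
  "table_mat R C g = mat (length R) (length C) (\<lambda>(i, j). g (R ! i) (C ! j))"

text \<open>The common bound must cover both \<open>bound I\<close> and 1; twice the old bound plus
  1 does so and arises from the binary expansion by prepending one bit. There are no recourse
  variables, and the only recourse row has as left-hand side the product of the two coordinate sums,
  which is positive because both points are nonnegative with a coordinate 1. The exponent is written
  as a sum because addition of unary numbers is at hand.\<close>

definition reduct :: "nat \<Rightarrow> adapt_inst \<Rightarrow> adapt_inst" where
  "reduct k I =
    (let L = length (enc_inst I); M = rat_of_nat (2 ^ (L + L + L + L + L + L)); \<epsilon> = 1 / 2 ^ L;
       X = var_names (nx I) k (ny I); U = var_names (nu I) k (my I);
       XR = row_names (mx I) X; UR = row_names (mu I) U @ claim_names k (my I);
       R = rat_of_nat (bound I)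
     in \<lparr>nx = length X, nu = length U, ny = 0, mx = length XR, mu = length UR, my = 1,
         bound = Suc (2 * bound I),
         a_vec = vec_of_list (map (rhs (list_of_vec (a_vec I)) R R M) XR),
         b_vec = vec_of_list (map (rhs (list_of_vec (b_vec I)) R 1 M) UR),
         A_mat = table_mat XR X (x_entry (mat_to_list (A_mat I))),
         W_mat = table_mat [()] [] (\<lambda>_ _ :: unit. 0),
         B_mats = map (\<lambda>d. table_mat UR U (u_entry (map mat_to_list (B_mats I))
           (map mat_to_list (T_mats I)) (mat_to_list (W_mat I)) M \<epsilon> d)) X,
         T_mats = map (\<lambda>_. table_mat [()] X (\<lambda>_ _. 1)) U\<rparr>)"

lemma table_mat_carrier [simp]: "table_mat R C g \<in> carrier_mat (length R) (length C)"
  by (simp add: table_mat_def)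

lemma reduct_in_adapt_insts: "reduct k I \<in> adapt_insts"
proof -
  have "table_mat [()] C g \<in> carrier_mat 1 (length C)" for C :: "'c list" and g :: "unit \<Rightarrow> 'c \<Rightarrow> 'b"
    using table_mat_carrier[of "[()]" C g] by simp
  moreover have "set (map f xs) \<subseteq> A" if "\<And>x. f x \<in> A" for f A and xs :: "'c list"
    using that by auto
  moreover have "vec_of_list xs \<in> carrier_vec (length xs)" for xs :: "rat list"
    by (rule carrier_vecI) simp
  ultimately show ?thesis
    unfolding reduct_def Let_def adapt_insts_def mem_Collect_eq adapt_inst.select_convs length_map
    by (metis length_map list.size(3) table_mat_carrier)
qed

section \<open>Vectors and matrices with named coordinates\<close>

lemma sum_list_upt: "(\<Sum>l\<leftarrow>[0..<n]. f l) = (\<Sum>l<n. f l)" for f :: "nat \<Rightarrow> 'a::comm_monoid_add"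
  by (induction n) (auto simp: add.commute)

lemma sum_list_var_names:
  fixes g :: "name \<Rightarrow> 'a::comm_monoid_add"
  shows "(\<Sum>d\<leftarrow>var_names n k m. g d) =
    (\<Sum>l<n. g (0, l, 0)) + (\<Sum>i<k. \<Sum>j<m. g (1, i, j)) + g (2, 0, 0)"
proof -
  have "(\<Sum>d\<leftarrow>concat (map (\<lambda>i. map (\<lambda>j. (1, i, j)) [0..<m]) [0..<k]). g d) = (\<Sum>i<k. \<Sum>j<m. g (1, i, j))"
    by (induction k) (auto simp: o_def sum_list_upt add.commute)
  then show ?thesis by (simp add: var_names_def o_def sum_list_upt add.assoc)
qed

lemma set_var_names:
  "(\<forall>d\<in>set (var_names n k m). P d) \<longleftrightarrow>
    (\<forall>l<n. P (0, l, 0)) \<and> (\<forall>i<k. \<forall>j<m. P (1, i, j)) \<and> P (2, 0, 0)"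
  by (auto simp: var_names_def; force)

lemma distinct_var_names: "distinct (var_names n k m)"
proof -
  have "distinct (concat (map (\<lambda>i. map (\<lambda>j. (1::nat, i, j)) [0..<m]) [0..<k]))"
    by (induction k) (auto simp: distinct_map inj_on_def)
  then show ?thesis by (auto simp: var_names_def distinct_map inj_on_def)
qed

text \<open>Naming coordinates instead of numbering them lets sums be split by tag through
  \<open>sum_list_var_names\<close>. By \<open>ex_valuation\<close>, distinct names lose no
  vectors.\<close>

definition valuation :: "name list \<Rightarrow> (name \<Rightarrow> real) \<Rightarrow> real vec" where
  "valuation L \<phi> = vec_of_list (map \<phi> L)"

lemma dim_valuation [simp]: "dim_vec (valuation L \<phi>) = length L"
  by (simp add: valuation_def)

lemma valuation_nth [simp]: "i < length L \<Longrightarrow> valuation L \<phi> $ i = \<phi> (L ! i)"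
  by (simp add: valuation_def vec_of_list_index)

lemma ex_valuation:
  assumes "distinct L" "v \<in> carrier_vec (length L)"
  obtains \<phi> where "v = valuation L \<phi>"
proof
  let ?\<phi> = "\<lambda>d. v $ inv_into {..<length L} (nth L) d"
  have "inj_on (nth L) {..<length L}" using assms(1) by (auto intro: inj_on_nth)
  then show "v = valuation L ?\<phi>"
    using assms(2) by (intro eq_vecI) auto
qed

lemma all_valuation: "(\<forall>i<length L. P (valuation L \<phi> $ i)) \<longleftrightarrow> (\<forall>d\<in>set L. P (\<phi> d))"
  by (auto simp: all_set_conv_all_nth)

lemma valuation_int_box:
  "valuation L \<phi> \<in> int_box R n \<longleftrightarrow> n = length L \<and> (\<forall>d\<in>set L. \<phi> d \<in> {0..real R} \<inter> \<int>)"
  using all_valuation[of L "\<lambda>t. t \<in> {0..real R} \<inter> \<int>" \<phi>]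
  by (auto simp: int_box_def carrier_dim_vec simp del: carrier_vecD)

lemma table_mat_mult:
  assumes "i < length R"
  shows "(table_mat R C g *\<^sub>v valuation C \<phi>) $ i = (\<Sum>c\<leftarrow>C. g (R ! i) c * \<phi> c)"
  using assms by (simp add: table_mat_def scalar_prod_def sum_list_sum_nth)

lemma map_table_mat: "map_mat f (table_mat R C g) = table_mat R C (\<lambda>r c. f (g r c))"
  by (auto simp: table_mat_def)

lemma table_mat_le:
  "table_mat R C g *\<^sub>v valuation C \<phi> \<le> map_vec f (vec_of_list (map h R)) \<longleftrightarrow>
    (\<forall>\<rho>\<in>set R. (\<Sum>c\<leftarrow>C. g \<rho> c * \<phi> c) \<le> f (h \<rho>))"
proof -
  have "dim_row (table_mat R C g) = length R" by (simp add: table_mat_def)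
  then show ?thesis
    by (auto simp: less_eq_vec_def table_mat_mult vec_of_list_index all_set_conv_all_nth
        simp del: index_mult_mat_vec)
qed

lemma lin_table_mat:
  "lin_mat (length R) (length C) (map (\<lambda>d. table_mat R C (g d)) L) (valuation L \<phi>) =
    table_mat R C (\<lambda>\<rho> c. \<Sum>d\<leftarrow>L. \<phi> d * real_of_rat (g d \<rho> c))"
  by (rule eq_matI) (auto simp: lin_mat_def table_mat_def sum_list_sum_nth lessThan_atLeast0)

lemma int_box_vec: "vec n f \<in> int_box R m \<longleftrightarrow> n = m \<and> (\<forall>i<n. f i \<in> {0..real R} \<inter> \<int>)"
  by (auto simp: int_box_def carrier_dim_vec simp del: carrier_vecD)

lemma mult_vec_le:
  assumes "A \<in> carrier_mat m n"
  shows "A *\<^sub>v vec n f \<le> map_vec h b \<longleftrightarrow> dim_vec b = m \<and> (\<forall>i<m. (\<Sum>j<n. A $$ (i, j) * f j) \<le> h (b $ i))"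
  using assms by (auto simp: less_eq_vec_def scalar_prod_def lessThan_atLeast0)

section \<open>The feasible sets of the reduced instance\<close>

locale adapt =
  fixes I :: adapt_inst and k :: nat
  assumes I: "I \<in> adapt_insts"
begin

lemma carriers:
  "dim_vec (a_vec I) = mx I" "dim_vec (b_vec I) = mu I"
  "A_mat I \<in> carrier_mat (mx I) (nx I)" "W_mat I \<in> carrier_mat (my I) (ny I)"
  "length (B_mats I) = nx I" "length (T_mats I) = nu I"
  "\<And>l. l < nx I \<Longrightarrow> B_mats I ! l \<in> carrier_mat (mu I) (nu I)"
  "\<And>l. l < nu I \<Longrightarrow> T_mats I ! l \<in> carrier_mat (my I) (nx I)"
  using I nth_mem by (auto simp: adapt_insts_def)

text \<open>This is the left-hand side of row \<open>j\<close> of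
  \<open>T(u) x + W y \<le> 0\<close> in coordinates; positive values mean violation.\<close>

definition slack :: "(nat \<Rightarrow> real) \<Rightarrow> (nat \<Rightarrow> real) \<Rightarrow> (nat \<Rightarrow> real) \<Rightarrow> nat \<Rightarrow> real" where
  "slack x u y j = (\<Sum>l<nx I. (\<Sum>i<nu I. u i * real_of_rat (T_mats I ! i $$ (j, l))) * x l) +
     (\<Sum>i<ny I. real_of_rat (W_mat I $$ (j, i)) * y i)"

lemma X_d_vec:
  "vec (nx I) x \<in> X_d I \<longleftrightarrow> (\<forall>l<nx I. x l \<in> {0..real (bound I)} \<inter> \<int>) \<and>
    (\<forall>r<mx I. (\<Sum>l<nx I. real_of_rat (A_mat I $$ (r, l)) * x l) \<le> real_of_rat (a_vec I $ r))"
  using mult_vec_le[of "map_mat real_of_rat (A_mat I)" "mx I" "nx I" x real_of_rat "a_vec I"] carriers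
  by (auto simp: X_d_def int_box_vec)

lemma U_d_vec:
  "vec (nu I) u \<in> U_d I (vec (nx I) x) \<longleftrightarrow> (\<forall>l<nu I. u l \<in> {0..real (bound I)} \<inter> \<int>) \<and>
    (\<forall>r<mu I. (\<Sum>i<nu I. (\<Sum>l<nx I. x l * real_of_rat (B_mats I ! l $$ (r, i))) * u i)
      \<le> real_of_rat (b_vec I $ r))"
proof -
  have "B_of I (vec (nx I) x) \<in> carrier_mat (mu I) (nu I)"
    by (simp add: B_of_def lin_mat_def)
  from mult_vec_le[OF this, of u real_of_rat "b_vec I"] show ?thesis
    using carriers by (auto simp: U_d_def int_box_vec B_of_def lin_mat_def)
qed

lemma Y_d_vec:
  "vec (ny I) y \<in> Y_d I (vec (nx I) x) (vec (nu I) u) \<longleftrightarrow>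
    (\<forall>l<ny I. y l \<in> {0..real (bound I)} \<inter> \<int>) \<and> (\<forall>j<my I. slack x u y j \<le> 0)"
  using carriers
  by (auto simp: Y_d_def int_box_vec less_eq_vec_def scalar_prod_def lessThan_atLeast0 T_of_def
      lin_mat_def slack_def)

abbreviation "xn \<equiv> var_names (nx I) k (ny I)"
abbreviation "un \<equiv> var_names (nu I) k (my I)"
abbreviation "L \<equiv> length (enc_inst I)"
abbreviation "M \<equiv> rat_of_nat (2 ^ (L + L + L + L + L + L))"
abbreviation "\<epsilon> \<equiv> 1 / 2 ^ L :: rat"
abbreviation "R \<equiv> rat_of_nat (bound I)"
abbreviation "entry \<equiv> u_entry (map mat_to_list (B_mats I)) (map mat_to_list (T_mats I)) (mat_to_list (W_mat I)) M \<epsilon>"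

lemma lookup_mat:
  "C \<in> carrier_mat m n \<Longrightarrow> i < m \<Longrightarrow> j < n \<Longrightarrow> lookup (mat_to_list C) i j = C $$ (i, j)"
  by (auto simp: lookup_def nth_default_def mat_to_list_def)

lemma lookup_A: "i < mx I \<Longrightarrow> j < nx I \<Longrightarrow> lookup (mat_to_list (A_mat I)) i j = A_mat I $$ (i, j)"
  using lookup_mat carriers by blast

lemma lookup_W: "i < my I \<Longrightarrow> j < ny I \<Longrightarrow> lookup (mat_to_list (W_mat I)) i j = W_mat I $$ (i, j)"
  using lookup_mat carriers by blast

lemma lookup_B: "l < nx I \<Longrightarrow> i < mu I \<Longrightarrow> j < nu I \<Longrightarrow>
    lookup (nth_default [] (map mat_to_list (B_mats I)) l) i j = B_mats I ! l $$ (i, j)"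
  using lookup_mat[OF carriers(7)] carriers(5) by (simp add: nth_default_def)

lemma lookup_T: "l < nu I \<Longrightarrow> i < my I \<Longrightarrow> j < nx I \<Longrightarrow>
    lookup (nth_default [] (map mat_to_list (T_mats I)) l) i j = T_mats I ! l $$ (i, j)"
  using lookup_mat[OF carriers(8)] carriers(6) by (simp add: nth_default_def)

lemma nth_default_vec: "r < dim_vec v \<Longrightarrow> nth_default d (list_of_vec v) r = v $ r"
  by (simp add: nth_default_def list_of_vec_index)

lemma reduct_sel:
  "nx (reduct k I) = length xn" "nu (reduct k I) = length un" "ny (reduct k I) = 0"
  "my (reduct k I) = 1" "bound (reduct k I) = Suc (2 * bound I)"
  "a_vec (reduct k I) = vec_of_list (map (rhs (list_of_vec (a_vec I)) R R M) (row_names (mx I) xn))"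
  "b_vec (reduct k I) = vec_of_list (map (rhs (list_of_vec (b_vec I)) R 1 M)
     (row_names (mu I) un @ claim_names k (my I)))"
  "A_mat (reduct k I) = table_mat (row_names (mx I) xn) xn (x_entry (mat_to_list (A_mat I)))"
  "mu (reduct k I) = length (row_names (mu I) un @ claim_names k (my I))"
  "B_mats (reduct k I) = map (\<lambda>d. table_mat (row_names (mu I) un @ claim_names k (my I)) un (entry d)) xn"
  "T_mats (reduct k I) = map (\<lambda>_. table_mat [()] xn (\<lambda>_ _. 1)) un"
  by (simp_all only: reduct_def Let_def adapt_inst.select_convs)

lemma set_row_names:
  "(\<forall>\<rho>\<in>set (row_names m N). P \<rho>) \<longleftrightarrow>
    (\<forall>r<m. P (0, r, 0)) \<and> (\<forall>d\<in>set N. P (Suc (fst d), snd d)) \<and> P (4, 0, 0)"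
  by (auto simp: row_names_def)

lemma set_claim_names:
  "(\<forall>\<rho>\<in>set (claim_names n m). P \<rho>) \<longleftrightarrow> (\<forall>i<n. P (5, i, 0)) \<and> (\<forall>i<n. \<forall>j<m. P (6, i, j))"
  by (auto simp: claim_names_def; force)

lemma box_row:
  assumes "d \<in> set (var_names n i m)"
  shows "(\<Sum>c\<leftarrow>var_names n i m. real_of_rat (box_entry (Suc (fst d), snd d) c) * \<phi> c) = \<phi> d"
proof -
  \<comment> \<open>Hence \<open>Suc (fst d)\<close> stays below 4, the tag of the lower-bound
    row.\<close>
  have "fst d < 3" using assms by (auto simp: var_names_def)
  then have "real_of_rat (box_entry (Suc (fst d), snd d) c) * \<phi> c = (if c = d then \<phi> c else 0)" for c
    by (auto simp: box_entry_def prod_eq_iff)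
  with assms show ?thesis
    by (simp add: sum.distinct_set_conv_list[OF distinct_var_names, symmetric])
qed

lemma box_row_last:
  "(\<Sum>c\<leftarrow>var_names n i m. real_of_rat (box_entry (4, 0, 0) c) * \<phi> c) = - \<phi> (2, 0, 0)"
  by (simp add: sum_list_var_names box_entry_def)

text \<open>Nonnegativity and integrality come from the common box, the individual upper bounds from
  the rows. As \<open>Rb\<close> is at least each of \<open>Ra\<close>, \<open>s\<close> and 1, the
  box cuts off nothing else.\<close>

lemma box_rows:
  assumes "Rb = 2 * Ra + 1" "s \<le> Rb"
  shows "(\<forall>d\<in>set (var_names n i m). \<phi> d \<in> {0..real Rb} \<inter> \<int>) \<and>
    (\<forall>d\<in>set (var_names n i m). \<phi> d \<le> real_of_rat (rhs v (of_nat Ra) (of_nat s) M' (Suc (fst d), snd d))) \<and>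
    - \<phi> (2, 0, 0) \<le> real_of_rat (rhs v (of_nat Ra) (of_nat s) M' (4, 0, 0)) \<longleftrightarrow>
    \<phi> (2, 0, 0) = 1 \<and> (\<forall>l<n. \<phi> (0, l, 0) \<in> {0..real Ra} \<inter> \<int>) \<and>
    (\<forall>a<i. \<forall>b<m. \<phi> (1, a, b) \<in> {0..real s} \<inter> \<int>)"
proof -
  let ?S = "{0..real Rb} \<inter> \<int>"
  have p: "t \<in> ?S \<and> t \<le> real c \<longleftrightarrow> t \<in> {0..real c} \<inter> \<int>" if "c \<le> Rb" for t c
    using that by (auto intro: order.trans)
  have q: "t \<in> ?S \<and> t \<le> 1 \<and> - t \<le> - 1 \<longleftrightarrow> t = 1" for t :: real
    using assms(1) by auto
  have r4: "real_of_rat (rhs v (of_nat Ra) (of_nat s) M' (4, 0, 0)) = - 1"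
    by (simp add: rhs_def)
  have "Ra \<le> Rb" using assms(1) by simp
  note p' = p[OF this, symmetric] p[OF assms(2), symmetric] q[symmetric]
  show ?thesis
    unfolding p' set_var_names r4 by (simp add: rhs_def) blast
qed

lemma X_d_reduct:
  "valuation xn \<phi> \<in> X_d (reduct k I) \<longleftrightarrow> \<phi> (2, 0, 0) = 1 \<and>
    vec (nx I) (\<lambda>l. \<phi> (0, l, 0)) \<in> X_d I \<and>
    (\<forall>i<k. vec (ny I) (\<lambda>j. \<phi> (1, i, j)) \<in> int_box (bound I) (ny I))"
proof -
  let ?E = "x_entry (mat_to_list (A_mat I))" and ?a = "rhs (list_of_vec (a_vec I)) R R M"
  have 0: "(\<Sum>d\<leftarrow>xn. real_of_rat (?E (0, r, 0) d) * \<phi> d) =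
      (\<Sum>l<nx I. real_of_rat (A_mat I $$ (r, l)) * \<phi> (0, l, 0))" if "r < mx I" for r
    using that by (simp add: sum_list_var_names x_entry_def lookup_A)
  have 1: "(\<Sum>d\<leftarrow>xn. real_of_rat (?E (Suc (fst c), snd c) d) * \<phi> d) = \<phi> c" if "c \<in> set xn" for c
    using box_row[OF that, of \<phi>] by (simp add: x_entry_def)
  have 4: "(\<Sum>d\<leftarrow>xn. real_of_rat (?E (4, 0, 0) d) * \<phi> d) = - \<phi> (2, 0, 0)"
    using box_row_last[where \<phi> = \<phi>] by (simp add: x_entry_def)
  have a: "?a (0, r, 0) = a_vec I $ r" if "r < mx I" for r
    using that by (simp add: rhs_def nth_default_vec carriers)
  have "valuation xn \<phi> \<in> X_d (reduct k I) \<longleftrightarrow>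
    (\<forall>c\<in>set xn. \<phi> c \<in> {0..real (Suc (2 * bound I))} \<inter> \<int>) \<and>
    (\<forall>\<rho>\<in>set (row_names (mx I) xn). (\<Sum>d\<leftarrow>xn. real_of_rat (?E \<rho> d) * \<phi> d) \<le> real_of_rat (?a \<rho>))"
    unfolding X_d_def reduct_sel map_table_mat table_mat_le mem_Collect_eq valuation_int_box by simp
  also have "\<dots> \<longleftrightarrow> ((\<forall>c\<in>set xn. \<phi> c \<in> {0..real (Suc (2 * bound I))} \<inter> \<int>) \<and>
      (\<forall>d\<in>set xn. \<phi> d \<le> real_of_rat (?a (Suc (fst d), snd d))) \<and>
      - \<phi> (2, 0, 0) \<le> real_of_rat (?a (4, 0, 0))) \<and>
    (\<forall>r<mx I. (\<Sum>l<nx I. real_of_rat (A_mat I $$ (r, l)) * \<phi> (0, l, 0)) \<le> real_of_rat (a_vec I $ r))"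
    unfolding set_row_names 4 by (simp only: 0 1 a cong: ball_cong imp_cong) blast
  also have "\<dots> \<longleftrightarrow> (\<phi> (2, 0, 0) = 1 \<and> (\<forall>l<nx I. \<phi> (0, l, 0) \<in> {0..real (bound I)} \<inter> \<int>) \<and>
      (\<forall>i<k. \<forall>j<ny I. \<phi> (1, i, j) \<in> {0..real (bound I)} \<inter> \<int>)) \<and>
    (\<forall>r<mx I. (\<Sum>l<nx I. real_of_rat (A_mat I $$ (r, l)) * \<phi> (0, l, 0)) \<le> real_of_rat (a_vec I $ r))"
    by (subst box_rows) simp_all
  finally show ?thesis unfolding X_d_vec int_box_vec by blast
qed

text \<open>Inserting a point of the new \<open>X\<close> leaves a matrix acting on the adversary's
  coordinates. In the rows of tag 6, the terms that involve neither \<open>u\<close> nor a marker,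
  namely \<epsilon> and the recourse part, are collected in the column of the constant
  coordinate.\<close>

lemma u_entry_rows:
  assumes "\<phi> (2, 0, 0) = 1" "c \<in> set un"
  shows "r < mu I \<Longrightarrow> (\<Sum>d\<leftarrow>xn. \<phi> d * real_of_rat (entry d (0, r, 0) c)) =
      (if fst c = 0 then \<Sum>l<nx I. \<phi> (0, l, 0) * real_of_rat (B_mats I ! l $$ (r, fst (snd c))) else 0)"
    and "t < 4 \<Longrightarrow> (\<Sum>d\<leftarrow>xn. \<phi> d * real_of_rat (entry d (Suc t, \<rho>) c)) = real_of_rat (box_entry (Suc t, \<rho>) c)"
    and "(\<Sum>d\<leftarrow>xn. \<phi> d * real_of_rat (entry d (5, i, 0) c)) = (if fst c = 1 \<and> fst (snd c) = i then - 1 else 0)"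
    and "i < k \<Longrightarrow> j < my I \<Longrightarrow> (\<Sum>d\<leftarrow>xn. \<phi> d * real_of_rat (entry d (6, i, j) c)) =
      (if fst c = 0 then - (\<Sum>l<nx I. \<phi> (0, l, 0) * real_of_rat (T_mats I ! (fst (snd c)) $$ (j, l)))
       else if fst c = 2 then 1 / 2 ^ L - (\<Sum>l<ny I. \<phi> (1, i, l) * real_of_rat (W_mat I $$ (j, l)))
       else if fst (snd c) = i \<and> snd (snd c) = j then 2 ^ (L + L + L + L + L + L) else 0)"
proof -
  have tag: "fst c = 0 \<and> fst (snd c) < nu I \<or> fst c = 1 \<or> fst c = 2"
    using assms(2) by (auto simp: var_names_def)
  have t: "real_of_rat M = 2 ^ (L + L + L + L + L + L)" "real_of_rat \<epsilon> = 1 / 2 ^ L"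
    by (simp_all only: of_rat_of_nat_eq of_nat_power of_nat_numeral of_rat_divide of_rat_power
        of_rat_numeral_eq of_rat_1)
  show "(\<Sum>d\<leftarrow>xn. \<phi> d * real_of_rat (entry d (0, r, 0) c)) =
      (if fst c = 0 then \<Sum>l<nx I. \<phi> (0, l, 0) * real_of_rat (B_mats I ! l $$ (r, fst (snd c))) else 0)"
    if "r < mu I"
    using that tag by (auto simp: sum_list_var_names u_entry_def lookup_B)
  show "(\<Sum>d\<leftarrow>xn. \<phi> d * real_of_rat (entry d (Suc t, \<rho>) c)) = real_of_rat (box_entry (Suc t, \<rho>) c)"
    if "t < 4"
    using that assms(1) by (simp add: sum_list_var_names u_entry_def)
  show "(\<Sum>d\<leftarrow>xn. \<phi> d * real_of_rat (entry d (5, i, 0) c)) = (if fst c = 1 \<and> fst (snd c) = i then - 1 else 0)"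
    using assms(1) by (simp add: sum_list_var_names u_entry_def)
  show "(\<Sum>d\<leftarrow>xn. \<phi> d * real_of_rat (entry d (6, i, j) c)) =
      (if fst c = 0 then - (\<Sum>l<nx I. \<phi> (0, l, 0) * real_of_rat (T_mats I ! (fst (snd c)) $$ (j, l)))
       else if fst c = 2 then 1 / 2 ^ L - (\<Sum>l<ny I. \<phi> (1, i, l) * real_of_rat (W_mat I $$ (j, l)))
       else if fst (snd c) = i \<and> snd (snd c) = j then 2 ^ (L + L + L + L + L + L) else 0)"
    if ij: "i < k" "j < my I"
  proof -
    consider "fst c = 0" "fst (snd c) < nu I" | "fst c = 1" | "fst c = 2" using tag by metis
    then show ?thesis
    proof cases
      case 1
      then show ?thesis using ij
        by (simp add: sum_list_var_names u_entry_def lookup_T of_rat_minus sum_negf)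
    next
      case 2
      then show ?thesis using assms(1)
        by (simp add: sum_list_var_names u_entry_def t del: of_nat_power)
    next
      case 3
      have "(\<Sum>a<k. \<Sum>b<ny I. \<phi> (1, a, b) * real_of_rat (if a = i then - lookup (mat_to_list (W_mat I)) j b else 0))
          = (\<Sum>a<k. if a = i then - (\<Sum>b<ny I. \<phi> (1, a, b) * real_of_rat (W_mat I $$ (j, b))) else 0)"
        using ij by (intro sum.cong) (auto simp: lookup_W of_rat_minus sum_negf)
      with 3 show ?thesis using assms(1) ij
        by (simp add: sum_list_var_names u_entry_def t cong: if_cong)
    qed
  qed
qed

lemma U_d_reduct:
  assumes "\<phi> (2, 0, 0) = 1"
  shows "valuation un \<psi> \<in> U_d (reduct k I) (valuation xn \<phi>) \<longleftrightarrow> \<psi> (2, 0, 0) = 1 \<and>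
    vec (nu I) (\<lambda>l. \<psi> (0, l, 0)) \<in> U_d I (vec (nx I) (\<lambda>l. \<phi> (0, l, 0))) \<and>
    (\<forall>i<k. \<forall>j<my I. \<psi> (1, i, j) \<in> {0..1} \<inter> \<int>) \<and> (\<forall>i<k. 1 \<le> (\<Sum>j<my I. \<psi> (1, i, j))) \<and>
    (\<forall>i<k. \<forall>j<my I. 2 ^ (L + L + L + L + L + L) * \<psi> (1, i, j) + 1 / 2 ^ L \<le> 2 ^ (L + L + L + L + L + L) +
      slack (\<lambda>l. \<phi> (0, l, 0)) (\<lambda>l. \<psi> (0, l, 0)) (\<lambda>l. \<phi> (1, i, l)) j)"
proof -
  define G where "G \<rho> c = (\<Sum>d\<leftarrow>xn. \<phi> d * real_of_rat (entry d \<rho> c))" for \<rho> c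
  note G = u_entry_rows[of \<phi>, OF assms, folded G_def]
  let ?b = "rhs (list_of_vec (b_vec I)) R 1 M"
  have cong: "(\<Sum>c\<leftarrow>un. G \<rho> c * \<psi> c) = (\<Sum>c\<leftarrow>un. g c * \<psi> c)" if "\<And>c. c \<in> set un \<Longrightarrow> G \<rho> c = g c" for \<rho> g
    by (rule arg_cong[where f = sum_list], rule map_cong) (auto simp: that)
  have 0: "(\<Sum>c\<leftarrow>un. G (0, r, 0) c * \<psi> c) =
      (\<Sum>i<nu I. (\<Sum>l<nx I. \<phi> (0, l, 0) * real_of_rat (B_mats I ! l $$ (r, i))) * \<psi> (0, i, 0))"
    if "r < mu I" for r
    by (subst cong[OF G(1)[OF _ that]]) (simp_all add: sum_list_var_names)
  have 1: "(\<Sum>c\<leftarrow>un. G (Suc (fst d), snd d) c * \<psi> c) = \<psi> d" if d: "d \<in> set un" for d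
  proof -
    have "fst d < 4" using d by (auto simp: var_names_def)
    then show ?thesis by (subst cong[OF G(2)]) (simp_all add: box_row[OF d])
  qed
  have 4: "(\<Sum>c\<leftarrow>un. G (4, 0, 0) c * \<psi> c) = - \<psi> (2, 0, 0)"
    using cong[OF G(2)[of _ 3 "(0, 0)"]] box_row_last[of \<psi>] by simp
  have 5: "(\<Sum>c\<leftarrow>un. G (5, i, 0) c * \<psi> c) = - (\<Sum>j<my I. \<psi> (1, i, j))" if "i < k" for i
  proof -
    have "(\<Sum>a<k. \<Sum>j<my I. (if a = i then - 1 else 0) * \<psi> (1, a, j)) =
        (\<Sum>a<k. if a = i then - (\<Sum>j<my I. \<psi> (1, a, j)) else 0)"
      by (intro sum.cong) (auto simp: sum_negf)
    then show ?thesis using that by (subst cong[OF G(3)]) (simp_all add: sum_list_var_names)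
  qed
  have 6: "(\<Sum>c\<leftarrow>un. G (6, i, j) c * \<psi> c) = 2 ^ (L + L + L + L + L + L) * \<psi> (1, i, j) + 1 / 2 ^ L -
      slack (\<lambda>l. \<phi> (0, l, 0)) (\<lambda>l. \<psi> (0, l, 0)) (\<lambda>l. \<phi> (1, i, l)) j"
    if "i < k" "j < my I" "\<psi> (2, 0, 0) = 1" for i j
  proof -
    define m :: real where "m = 2 ^ (L + L + L + L + L + L)"
    define e :: real where "e = 1 / 2 ^ L"
    have "(\<Sum>a<k. \<Sum>b<my I. (if a = i \<and> b = j then m else 0) * \<psi> (1, a, b)) =
        (\<Sum>a<k. if a = i then m * \<psi> (1, a, j) else 0)"
      using that by (intro sum.cong) (auto simp: if_distrib[of "\<lambda>t. t * _"] cong: if_cong)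
    moreover have "(\<Sum>a<nu I. (\<Sum>l<nx I. \<phi> (0, l, 0) * real_of_rat (T_mats I ! a $$ (j, l))) * \<psi> (0, a, 0)) =
      (\<Sum>l<nx I. (\<Sum>a<nu I. \<psi> (0, a, 0) * real_of_rat (T_mats I ! a $$ (j, l))) * \<phi> (0, l, 0))"
      unfolding sum_distrib_right by (subst sum.swap) (simp add: mult_ac)
    ultimately show ?thesis
      unfolding m_def[symmetric] e_def[symmetric]
      using that by (subst cong[OF G(4)[OF _ that(1,2), folded m_def e_def]])
        (simp_all add: sum_list_var_names slack_def sum_negf algebra_simps)
  qed
  have b: "?b (0, r, 0) = b_vec I $ r" if "r < mu I" for r
    using that by (simp add: rhs_def nth_default_vec carriers)
  have b56: "real_of_rat (?b (5, i, 0)) = - 1" "real_of_rat (?b (6, i, j)) = 2 ^ (L + L + L + L + L + L)" for i j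
    by (simp_all add: rhs_def of_rat_power)
  have "valuation un \<psi> \<in> U_d (reduct k I) (valuation xn \<phi>) \<longleftrightarrow>
    (\<forall>c\<in>set un. \<psi> c \<in> {0..real (Suc (2 * bound I))} \<inter> \<int>) \<and>
    (\<forall>\<rho>\<in>set (row_names (mu I) un @ claim_names k (my I)). (\<Sum>c\<leftarrow>un. G \<rho> c * \<psi> c) \<le> real_of_rat (?b \<rho>))"
    unfolding U_d_def B_of_def reduct_sel lin_table_mat table_mat_le mem_Collect_eq valuation_int_box G_def
    by simp
  also have "\<dots> \<longleftrightarrow> ((\<forall>c\<in>set un. \<psi> c \<in> {0..real (Suc (2 * bound I))} \<inter> \<int>) \<and>
      (\<forall>d\<in>set un. \<psi> d \<le> real_of_rat (?b (Suc (fst d), snd d))) \<and>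
      - \<psi> (2, 0, 0) \<le> real_of_rat (?b (4, 0, 0))) \<and>
    (\<forall>r<mu I. (\<Sum>i<nu I. (\<Sum>l<nx I. \<phi> (0, l, 0) * real_of_rat (B_mats I ! l $$ (r, i))) * \<psi> (0, i, 0))
      \<le> real_of_rat (b_vec I $ r)) \<and>
    (\<forall>i<k. - (\<Sum>j<my I. \<psi> (1, i, j)) \<le> - 1) \<and>
    (\<forall>i<k. \<forall>j<my I. (\<Sum>c\<leftarrow>un. G (6, i, j) c * \<psi> c) \<le> 2 ^ (L + L + L + L + L + L))"
    unfolding set_append ball_Un set_row_names set_claim_names 4 b56
    by (simp only: 0 1 5 b cong: ball_cong imp_cong) blast
  also have "\<dots> \<longleftrightarrow> (\<psi> (2, 0, 0) = 1 \<and> (\<forall>l<nu I. \<psi> (0, l, 0) \<in> {0..real (bound I)} \<inter> \<int>) \<and>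
      (\<forall>i<k. \<forall>j<my I. \<psi> (1, i, j) \<in> {0..1} \<inter> \<int>)) \<and>
    (\<forall>r<mu I. (\<Sum>i<nu I. (\<Sum>l<nx I. \<phi> (0, l, 0) * real_of_rat (B_mats I ! l $$ (r, i))) * \<psi> (0, i, 0))
      \<le> real_of_rat (b_vec I $ r)) \<and>
    (\<forall>i<k. - (\<Sum>j<my I. \<psi> (1, i, j)) \<le> - 1) \<and>
    (\<forall>i<k. \<forall>j<my I. (\<Sum>c\<leftarrow>un. G (6, i, j) c * \<psi> c) \<le> 2 ^ (L + L + L + L + L + L))"
    using box_rows[of "Suc (2 * bound I)" "bound I" 1 "nu I" k "my I" \<psi> "list_of_vec (b_vec I)" M]
    by simp
  finally have main: "valuation un \<psi> \<in> U_d (reduct k I) (valuation xn \<phi>) \<longleftrightarrow> \<dots>" .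
  have last: "(\<forall>i<k. \<forall>j<my I. (\<Sum>c\<leftarrow>un. G (6, i, j) c * \<psi> c) \<le> 2 ^ (L + L + L + L + L + L)) \<longleftrightarrow>
    (\<forall>i<k. \<forall>j<my I. 2 ^ (L + L + L + L + L + L) * \<psi> (1, i, j) + 1 / 2 ^ L \<le> 2 ^ (L + L + L + L + L + L) +
      slack (\<lambda>l. \<phi> (0, l, 0)) (\<lambda>l. \<psi> (0, l, 0)) (\<lambda>l. \<phi> (1, i, l)) j)" if "\<psi> (2, 0, 0) = 1"
    by (simp only: 6[OF _ _ that] diff_le_eq cong: imp_cong)
  show ?thesis
  \<comment> \<open>The rows of tag 6 take the stated form only when the constant coordinate is 1;
    otherwise both sides of the equivalence are false.\<close>
  proof (cases "\<psi> (2, 0, 0) = 1")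
    case True
    show ?thesis unfolding U_d_vec main last[OF True] neg_le_iff_le by (simp only: True simp_thms conj_ac)
  next
    case False
    then show ?thesis unfolding main by (simp only: simp_thms)
  qed
qed

end

section \<open>Correctness of the reduction\<close>

lemma less_power_length_bits: "n < 2 ^ length (bits n)"
proof (induction n rule: less_induct)
  case (less n)
  show ?case
  proof (cases "n = 0")
    case False
    then have "n div 2 < 2 ^ length (bits (n div 2))" by (intro less) auto
    moreover have "bits n = odd n # bits (n div 2)" using False by (subst bits.simps) simp
    ultimately show ?thesis by simp
  qed auto
qed

lemma length_enc_nat: "length (enc_nat n) = 2 * length (bits n) + 1"
  by (simp add: enc_nat_conv length_enc_list bool_code_def sum_list_triv)

lemma less_power_length_enc_nat: "n < 2 ^ length (enc_nat n)"
  by (rule less_le_trans[OF less_power_length_bits power_increasing]) (auto simp: length_enc_nat)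

lemma abs_le_power_length_enc_rat: "\<bar>real_of_rat r\<bar> \<le> 2 ^ length (enc_rat r)"
proof -
  obtain p d where pd: "quotient_of r = (p, d)" by force
  have d: "d > 0" by (rule quotient_of_denom_pos[OF pd])
  have r: "real_of_rat r = real_of_int p / real_of_int d"
    by (simp add: quotient_of_div[OF pd] of_rat_divide)
  have "\<bar>real_of_rat r\<bar> \<le> \<bar>real_of_int p\<bar>"
    unfolding r using d by (simp add: abs_divide pos_divide_le_eq mult_le_cancel_left1)
  also have "\<dots> = real (nat \<bar>p\<bar>)" by simp
  also have "\<dots> \<le> 2 ^ length (enc_nat (nat \<bar>p\<bar>))"
    using less_power_length_enc_nat[of "nat \<bar>p\<bar>"] by (metis less_imp_le of_nat_le_numeral_power_cancel_iff)
  also have "\<dots> \<le> 2 ^ length (enc_rat r)" by (rule power_increasing) (auto simp: enc_rat_conv pd)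
  finally show ?thesis .
qed

text \<open>The product of the denominators works: their bounds, powers of 2, multiply while the
  code lengths in the exponents add up.\<close>

lemma common_denominator:
  "\<exists>N::int. 0 < N \<and> real_of_int N \<le> 2 ^ (\<Sum>r\<leftarrow>rs. length (enc_rat r)) \<and>
    (\<forall>r\<in>set rs. real_of_int N * real_of_rat r \<in> \<int>)"
proof (induction rs)
  case Nil
  then show ?case by (auto intro: exI[of _ 1])
next
  case (Cons r rs)
  then obtain N :: int where N: "0 < N" "real_of_int N \<le> 2 ^ (\<Sum>r\<leftarrow>rs. length (enc_rat r))"
    "\<forall>r\<in>set rs. real_of_int N * real_of_rat r \<in> \<int>" by blast
  obtain p d where pd: "quotient_of r = (p, d)" by force
  have d: "d > 0" by (rule quotient_of_denom_pos[OF pd])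
  have "real (nat d) \<le> 2 ^ length (enc_nat (nat d))"
    using less_power_length_enc_nat[of "nat d"] by (metis less_imp_le of_nat_le_numeral_power_cancel_iff)
  also have "\<dots> \<le> 2 ^ length (enc_rat r)" by (rule power_increasing) (auto simp: enc_rat_conv pd)
  finally have "real_of_int d \<le> 2 ^ length (enc_rat r)" using d by simp
  with N(1,2) d have "real_of_int (d * N) \<le> 2 ^ (\<Sum>r\<leftarrow>r # rs. length (enc_rat r))"
    by (auto simp: power_add intro: mult_mono)
  moreover have "real_of_int (d * N) * real_of_rat r = real_of_int (N * p)"
    using d by (simp add: quotient_of_div[OF pd] of_rat_divide)
  moreover have "real_of_int (d * N) * real_of_rat s \<in> \<int>" if "s \<in> set rs" for s
  proof -
    have "real_of_int d * (real_of_int N * real_of_rat s) \<in> \<int>" by (rule Ints_mult[OF Ints_of_int N(3)[rule_format, OF that]])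
    then show ?thesis by (simp add: mult_ac)
  qed
  ultimately show ?case using N(1) d
    by (intro exI[of _ "d * N"]) (auto simp: Ints_of_int simp del: of_int_mult)
qed

lemma sum_list_le_length_enc_list:
  "(\<And>x. x \<in> set xs \<Longrightarrow> h x \<le> length (e x)) \<Longrightarrow> (\<Sum>x\<leftarrow>xs. h x) \<le> length (enc_list e xs)"
  by (induction xs) (auto intro: le_SucI add_mono)

section \<open>Bounds on the violation of a recourse row\<close>

context adapt
begin

text \<open>These are the entries that can occur as coefficients in \<open>slack\<close>. Their
  codes are disjoint parts of the encoding, so their total length is at most
  \<open>L\<close>.\<close>

definition rats :: "rat list" where
  "rats = concat (mat_to_list (W_mat I)) @ concat (map (\<lambda>C. concat (mat_to_list C)) (T_mats I))"

lemma sum_rats: "(\<Sum>r\<leftarrow>rats. length (enc_rat r)) \<le> L"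
proof -
  have m: "(\<Sum>r\<leftarrow>concat (mat_to_list C). length (enc_rat r)) \<le> length (enc_mat C)" for C
  proof -
    have "(\<Sum>r\<leftarrow>concat xss. length (enc_rat r)) \<le> length (enc_list (enc_list enc_rat) xss)" for xss
      using sum_list_le_length_enc_list[of _ "\<lambda>r. length (enc_rat r)" enc_rat]
      by (induction xss) (auto intro!: le_SucI add_mono)
    then show ?thesis by (simp add: enc_mat_def)
  qed
  have "(\<Sum>r\<leftarrow>concat (map (\<lambda>C. concat (mat_to_list C)) Cs). length (enc_rat r)) \<le> length (enc_list enc_mat Cs)" for Cs
    using m by (induction Cs) (auto intro!: le_SucI add_mono)
  from add_mono[OF m[of "W_mat I"] this[of "T_mats I"]] show ?thesis
    by (simp add: rats_def enc_inst_def)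
qed

lemma mem_mat_to_list: "C \<in> carrier_mat m n \<Longrightarrow> i < m \<Longrightarrow> j < n \<Longrightarrow> C $$ (i, j) \<in> set (concat (mat_to_list C))"
  by (force simp: mat_to_list_def)

lemma W_rats: "j < my I \<Longrightarrow> i < ny I \<Longrightarrow> W_mat I $$ (j, i) \<in> set rats"
  using mem_mat_to_list[OF carriers(4)] unfolding rats_def by auto

lemma T_rats: "l < nu I \<Longrightarrow> j < my I \<Longrightarrow> i < nx I \<Longrightarrow> T_mats I ! l $$ (j, i) \<in> set rats"
proof -
  assume *: "l < nu I" "j < my I" "i < nx I"
  then have "T_mats I ! l \<in> set (T_mats I)" using carriers(6) by simp
  moreover have "T_mats I ! l $$ (j, i) \<in> set (concat (mat_to_list (T_mats I ! l)))"
    using * by (intro mem_mat_to_list[OF carriers(8)])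
  ultimately show ?thesis unfolding rats_def set_append set_concat[of "map _ _"] set_map by blast
qed

lemma rats_bound: "r \<in> set rats \<Longrightarrow> \<bar>real_of_rat r\<bar> \<le> 2 ^ L"
proof -
  assume "r \<in> set rats"
  then have "length (enc_rat r) \<le> (\<Sum>r\<leftarrow>rats. length (enc_rat r))"
    by (intro member_le_sum_list) auto
  with sum_rats have "(2::real) ^ length (enc_rat r) \<le> 2 ^ L" by (intro power_increasing) auto
  with abs_le_power_length_enc_rat[of r] show ?thesis by (rule order.trans)
qed

lemma dims_bound: "real (nx I) \<le> 2 ^ L" "real (nu I) \<le> 2 ^ L" "real (ny I) \<le> 2 ^ L"
  "real (bound I) \<le> 2 ^ L" "(3::real) \<le> 2 ^ L"
proof -
  have le: "real n \<le> 2 ^ L" if "n \<le> L" for n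
    using that of_nat_less_two_power[of L, where 'a = real] by linarith
  show "real (nx I) \<le> 2 ^ L" "real (nu I) \<le> 2 ^ L" "real (ny I) \<le> 2 ^ L"
    by (rule le; simp add: enc_inst_def)+
  \<comment> \<open>The terminating bits of the code alone give \<open>3 \<le> L\<close>. The factor
    3 pays for the three summands in \<open>slack_lower\<close>.\<close>
  show "(3::real) \<le> 2 ^ L" using le[of 3] by (simp add: enc_inst_def)
  have "bound I < 2 ^ L"
    by (rule less_le_trans[OF less_power_length_enc_nat power_increasing]) (auto simp: enc_inst_def)
  then show "real (bound I) \<le> 2 ^ L"
    by (metis less_imp_le of_nat_le_numeral_power_cancel_iff)
qed

lemma slack_swap:
  "slack x u y j = (\<Sum>l<nx I. \<Sum>i<nu I. u i * x l * real_of_rat (T_mats I ! i $$ (j, l))) +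
    (\<Sum>i<ny I. y i * real_of_rat (W_mat I $$ (j, i)))"
  unfolding slack_def sum_distrib_right by (simp add: mult_ac)

text \<open>Multiplied by a common denominator of the coefficients, the left-hand side becomes a
  positive integer, hence at least 1, and the denominator is at most \<open>2 ^ L\<close>.\<close>

lemma slack_positive:
  assumes "j < my I" "\<forall>l<nx I. x l \<in> \<int>" "\<forall>l<nu I. u l \<in> \<int>" "\<forall>l<ny I. y l \<in> \<int>"
    and pos: "0 < slack x u y j"
  shows "1 / 2 ^ L \<le> slack x u y j"
proof -
  obtain N :: int where N: "0 < N" "real_of_int N \<le> 2 ^ (\<Sum>r\<leftarrow>rats. length (enc_rat r))"
    "\<And>r. r \<in> set rats \<Longrightarrow> real_of_int N * real_of_rat r \<in> \<int>" using common_denominator[of rats] by blast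
  have "real_of_int N * slack x u y j =
    (\<Sum>l<nx I. \<Sum>i<nu I. u i * x l * (real_of_int N * real_of_rat (T_mats I ! i $$ (j, l)))) +
    (\<Sum>i<ny I. y i * (real_of_int N * real_of_rat (W_mat I $$ (j, i))))"
    by (simp add: slack_swap distrib_left sum_distrib_left mult_ac)
  also have "\<dots> \<in> \<int>"
    using assms(1-4) by (intro Ints_add Ints_sum Ints_mult N(3) W_rats T_rats) auto
  finally have "real_of_int N * slack x u y j \<in> \<int>" .
  moreover have "0 < real_of_int N * slack x u y j" using N(1) pos by simp
  ultimately have "1 \<le> real_of_int N * slack x u y j"
    by (auto elim!: Ints_cases)
  also have "\<dots> \<le> 2 ^ L * slack x u y j"
  proof (rule mult_right_mono)
    have "(2::real) ^ (\<Sum>r\<leftarrow>rats. length (enc_rat r)) \<le> 2 ^ L"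
      using sum_rats by (intro power_increasing) auto
    with N(2) show "real_of_int N \<le> 2 ^ L" by (rule order.trans)
  qed (use pos in simp)
  finally show ?thesis by (simp add: field_simps)
qed

text \<open>With \<open>t = 2 ^ L\<close>, the bilinear part is at most \<open>t ^ 5\<close> in
  absolute value (two dimensions, two variables, one coefficient), the linear part at most
  \<open>t ^ 3\<close>, and \<epsilon> at most 1. Their sum is at most
  \<open>3 * t ^ 5 \<le> t ^ 6\<close>, so a row whose marker is 0 constrains nothing.\<close>

lemma slack_lower:
  assumes "j < my I" "\<forall>l<nx I. x l \<in> {0..real (bound I)}" "\<forall>l<nu I. u l \<in> {0..real (bound I)}"
    and "\<forall>l<ny I. y l \<in> {0..real (bound I)}"
  shows "1 / 2 ^ L \<le> 2 ^ (L + L + L + L + L + L) + slack x u y j"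
proof -
  define t :: real where "t = 2 ^ L"
  note t = dims_bound[folded t_def]
  have le: "v \<le> t" if "v \<in> {0..real (bound I)}" for v using that t by simp
  have "\<bar>u i * x l * real_of_rat (T_mats I ! i $$ (j, l))\<bar> \<le> t * t * t" if "l < nx I" "i < nu I" for l i
    unfolding abs_mult using that assms rats_bound[OF T_rats, folded t_def] le t
    by (intro mult_mono) auto
  then have "\<bar>\<Sum>i<nu I. u i * x l * real_of_rat (T_mats I ! i $$ (j, l))\<bar> \<le> real (nu I) * (t * t * t)" if "l < nx I" for l
    using that sum_norm_bound[of "{..<nu I}" "\<lambda>i. u i * x l * real_of_rat (T_mats I ! i $$ (j, l))" "t * t * t"] by simp
  then have 1: "\<bar>\<Sum>l<nx I. \<Sum>i<nu I. u i * x l * real_of_rat (T_mats I ! i $$ (j, l))\<bar> \<le> real (nx I) * (real (nu I) * (t * t * t))"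
    using sum_norm_bound[of "{..<nx I}" "\<lambda>l. \<Sum>i<nu I. u i * x l * real_of_rat (T_mats I ! i $$ (j, l))"] by simp
  have "\<bar>y i * real_of_rat (W_mat I $$ (j, i))\<bar> \<le> t * t" if "i < ny I" for i
    unfolding abs_mult using that assms rats_bound[OF W_rats, folded t_def] le t
    by (intro mult_mono) auto
  then have 2: "\<bar>\<Sum>i<ny I. y i * real_of_rat (W_mat I $$ (j, i))\<bar> \<le> real (ny I) * (t * t)"
    using sum_norm_bound[of "{..<ny I}" "\<lambda>i. y i * real_of_rat (W_mat I $$ (j, i))" "t * t"] by simp
  have "real (nx I) * (real (nu I) * (t * t * t)) \<le> t * (t * (t * t * t))"
    using t by (intro mult_mono) auto
  moreover have "real (ny I) * (t * t) \<le> t * (t * t)"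
    using t by (intro mult_mono) auto
  moreover have "t * (t * t) * 1 \<le> t * (t * t) * (t * t)"
    using t by (intro mult_left_mono) (auto intro: order.trans[OF _ mult_mono[of 1 t 1 t]])
  moreover have "1 \<le> t * (t * t) * (t * t)"
    using t one_le_power[of t 5] by (simp add: power_numeral_reduce mult_ac)
  moreover have "3 * (t * (t * (t * t * t))) \<le> t * (t * (t * (t * t * t)))"
    using t by (intro mult_right_mono) auto
  moreover have "1 / t \<le> 1" using t by simp
  ultimately have "1 / t - slack x u y j \<le> t * (t * (t * (t * t * t)))"
    unfolding slack_swap using 1 2 by (simp add: mult_ac)
  then show ?thesis by (simp add: t_def power_add mult_ac)
qed

section \<open>Equivalence of the two adaptability problems\<close>

lemma Y_d_reduct_empty:
  assumes "valuation xn \<phi> \<in> X_d (reduct k I)" "valuation un \<psi> \<in> U_d (reduct k I) (valuation xn \<phi>)"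
  shows "Y_d (reduct k I) (valuation xn \<phi>) (valuation un \<psi>) = {}"
proof -
  have one: "\<phi> (2, 0, 0) = 1" using assms(1) X_d_reduct by blast
  then have one': "\<psi> (2, 0, 0) = 1" using assms(2) U_d_reduct by blast
  have ge: "1 \<le> (\<Sum>d\<leftarrow>var_names n i m. f d)"
    if "\<forall>d\<in>set (var_names n i m). 0 \<le> f d" "f (2, 0, 0) = 1" for n i m and f :: "name \<Rightarrow> real"
    using that unfolding set_var_names sum_list_var_names
    by (simp, intro add_nonneg_nonneg sum_nonneg) auto
  have X: "1 \<le> (\<Sum>d\<leftarrow>xn. \<phi> d)"
    using assms(1) one by (intro ge) (auto simp: X_d_def valuation_int_box)
  have U: "1 \<le> (\<Sum>d\<leftarrow>un. \<psi> d)"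
    using assms(2) one' by (intro ge) (auto simp: U_d_def valuation_int_box)
  have T: "T_of (reduct k I) (valuation un \<psi>) = table_mat [()] xn (\<lambda>_ _. \<Sum>d\<leftarrow>un. \<psi> d)"
    using lin_table_mat[of "[()]" xn "\<lambda>_ _ _. 1" un \<psi>] by (simp add: T_of_def reduct_sel)
  have "(\<Sum>d\<leftarrow>xn. (\<Sum>d\<leftarrow>un. \<psi> d) * \<phi> d) = (\<Sum>d\<leftarrow>un. \<psi> d) * (\<Sum>d\<leftarrow>xn. \<phi> d)"
    by (rule sum_list_const_mult)
  moreover have "0 < (\<Sum>d\<leftarrow>un. \<psi> d) * (\<Sum>d\<leftarrow>xn. \<phi> d)" using X U by (intro mult_pos_pos) auto
  ultimately have pos: "0 < (table_mat [()] xn (\<lambda>_ _. \<Sum>d\<leftarrow>un. \<psi> d) *\<^sub>v valuation xn \<phi>) $ 0"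
    by (subst table_mat_mult) auto
  have W: "W_mat (reduct k I) = table_mat [()] [] (\<lambda>_ _ :: unit. 0)"
    by (simp only: reduct_def Let_def adapt_inst.select_convs)
  show ?thesis
  proof (rule equals0I)
    fix y assume "y \<in> Y_d (reduct k I) (valuation xn \<phi>) (valuation un \<psi>)"
    then have dim: "dim_vec y = 0"
      and le: "T_of (reduct k I) (valuation un \<psi>) *\<^sub>v valuation xn \<phi> +
        map_mat real_of_rat (W_mat (reduct k I)) *\<^sub>v y \<le> 0\<^sub>v 1"
      by (auto simp: Y_d_def int_box_def reduct_sel)
    have "(map_mat real_of_rat (W_mat (reduct k I)) *\<^sub>v y) $ 0 = 0"
      using dim by (simp add: W table_mat_def scalar_prod_def)
    moreover have "dim_row (map_mat real_of_rat (W_mat (reduct k I))) = 1"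
      by (simp add: W table_mat_def)
    ultimately show False
      using le pos unfolding T less_eq_vec_def by (auto simp del: index_mult_mat_vec)
  qed
qed

lemma U_d_reduct_empty_iff:
  assumes X: "vec (nx I) (\<lambda>l. \<phi> (0, l, 0)) \<in> X_d I"
    and Y: "\<forall>i<k. vec (ny I) (\<lambda>j. \<phi> (1, i, j)) \<in> int_box (bound I) (ny I)"
    and one: "\<phi> (2, 0, 0) = 1"
  shows "U_d (reduct k I) (valuation xn \<phi>) = {} \<longleftrightarrow>
    (\<forall>u\<in>U_d I (vec (nx I) (\<lambda>l. \<phi> (0, l, 0))). \<exists>i<k. vec (ny I) (\<lambda>j. \<phi> (1, i, j)) \<in>
      Y_d I (vec (nx I) (\<lambda>l. \<phi> (0, l, 0))) u)" (is "?E \<longleftrightarrow> ?A")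
proof
  let ?x = "\<lambda>l. \<phi> (0, l, 0)" and ?y = "\<lambda>i j. \<phi> (1, i, j)"
  have x: "\<forall>l<nx I. ?x l \<in> {0..real (bound I)} \<inter> \<int>" using X unfolding X_d_vec by blast
  have y: "\<forall>l<ny I. ?y i l \<in> {0..real (bound I)} \<inter> \<int>" if "i < k" for i using Y that unfolding int_box_vec by blast
  {
    assume empty: ?E
    show ?A
    proof (rule ballI, rule ccontr)
      fix u assume u: "u \<in> U_d I (vec (nx I) ?x)"
        and no: "\<not> (\<exists>i<k. vec (ny I) (?y i) \<in> Y_d I (vec (nx I) ?x) u)"
      have "u \<in> carrier_vec (nu I)" using u by (auto simp: U_d_def int_box_def)
      then have uv: "u = vec (nu I) (\<lambda>l. u $ l)" by auto
      have ub: "\<forall>l<nu I. u $ l \<in> {0..real (bound I)} \<inter> \<int>" using u by (simp add: U_d_def int_box_def)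
      let ?s = "\<lambda>i. slack ?x (\<lambda>l. u $ l) (?y i)"
      \<comment> \<open>The adversary may mark all violated rows, so no choice of one row per
        candidate is needed. The last case supplies the constant coordinate.\<close>
      let ?\<psi> = "\<lambda>(t, i, j). if t = 0 then u $ i else if t = Suc 0 then (if 0 < ?s i j then 1 else 0) else 1"
      have ex: "\<exists>j<my I. 0 < ?s i j" if "i < k" for i
      proof -
        have "vec (ny I) (?y i) \<notin> Y_d I (vec (nx I) ?x) (vec (nu I) (\<lambda>l. u $ l))"
          using no that uv by auto
        then show ?thesis using y[OF that] unfolding Y_d_vec by (auto simp: not_le)
      qed
      have "1 \<le> (\<Sum>j<my I. if 0 < ?s i j then 1 else 0 :: real)" if "i < k" for i
      proof -
        from ex[OF that] obtain j where j: "j < my I" "0 < ?s i j" by blast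
        have "(if 0 < ?s i j then 1 else 0 :: real) \<le> (\<Sum>j<my I. if 0 < ?s i j then 1 else 0)"
          using j by (intro member_le_sum) auto
        with j show ?thesis by simp
      qed
      moreover have "2 ^ (L + L + L + L + L + L) * (if 0 < ?s i j then 1 else 0) + 1 / 2 ^ L
          \<le> 2 ^ (L + L + L + L + L + L) + ?s i j" if "i < k" "j < my I" for i j
        using slack_positive[of j ?x "\<lambda>l. u $ l" "?y i"] slack_lower[of j ?x "\<lambda>l. u $ l" "?y i"]
          that x ub y by auto
      ultimately have "valuation un ?\<psi> \<in> U_d (reduct k I) (valuation xn \<phi>)"
        unfolding U_d_reduct[of \<phi>, OF one] using u uv by auto
      with empty show False by blast
    qed
  next
    assume A: ?A
    show ?E
    proof (rule equals0I)
      fix u' assume u': "u' \<in> U_d (reduct k I) (valuation xn \<phi>)"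
      then have "u' \<in> carrier_vec (length un)" by (simp add: U_d_def int_box_def reduct_sel)
      then obtain \<psi> where \<psi>: "u' = valuation un \<psi>" by (rule ex_valuation[OF distinct_var_names])
      let ?u = "\<lambda>l. \<psi> (0, l, 0)"
      note U = u'[unfolded \<psi> U_d_reduct[of \<phi>, OF one]]
      with A obtain i where i: "i < k" "vec (ny I) (?y i) \<in> Y_d I (vec (nx I) ?x) (vec (nu I) ?u)" by blast
      \<comment> \<open>The 0-1 markers of \<open>y\<^sup>i\<close> sum to at least 1. At a marker
        equal to 1 the big-M constant cancels, which leaves a left-hand side of at least \<epsilon>
        for a candidate that satisfies all rows.\<close>
      have "\<exists>j<my I. \<psi> (1, i, j) = 1"
      proof (rule ccontr)
        assume no: "\<not> (\<exists>j<my I. \<psi> (1, i, j) = 1)"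
        have "\<psi> (1, i, j) = 0" if "j < my I" for j
        proof -
          have "\<psi> (1, i, j) \<in> {0..1} \<inter> \<int>" "\<psi> (1, i, j) \<noteq> 1" using U i that no by blast+
          then show ?thesis by (auto elim!: Ints_cases)
        qed
        then have "(\<Sum>j<my I. \<psi> (1, i, j)) = 0" by simp
        with U i show False by fastforce
      qed
      then obtain j where j: "j < my I" "\<psi> (1, i, j) = 1" by blast
      have "2 ^ (L + L + L + L + L + L) * \<psi> (1, i, j) + 1 / 2 ^ L \<le>
        2 ^ (L + L + L + L + L + L) + slack ?x ?u (?y i) j" using U i j by blast
      moreover have "slack ?x ?u (?y i) j \<le> 0" using i j unfolding Y_d_vec by blast
      moreover have "(0::real) < 1 / 2 ^ L" by simp
      ultimately show False unfolding j(2) by linarith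
    qed
  }
qed

text \<open>No candidate ever helps, so the here-and-now decision must leave no scenario at all. If
  it does, the condition on the candidate is vacuous.\<close>

lemma adaptable_1_reduct:
  "adaptable 1 (reduct k I) \<longleftrightarrow> (\<exists>x\<in>X_d (reduct k I). U_d (reduct k I) x = {})"
proof
  assume "adaptable 1 (reduct k I)"
  then obtain x y where x: "x \<in> X_d (reduct k I)"
    and y: "\<forall>u\<in>U_d (reduct k I) x. y ` {1..1::nat} \<inter> Y_d (reduct k I) x u \<noteq> {}"
    unfolding adaptable_def by blast
  have "x \<in> carrier_vec (length xn)" using x by (simp add: X_d_def int_box_def reduct_sel)
  then obtain \<phi> where \<phi>: "x = valuation xn \<phi>" by (rule ex_valuation[OF distinct_var_names])
  have "U_d (reduct k I) x = {}"
  proof (rule equals0I)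
    fix u assume u: "u \<in> U_d (reduct k I) x"
    then have "u \<in> carrier_vec (length un)" by (simp add: U_d_def int_box_def reduct_sel)
    then obtain \<psi> where "u = valuation un \<psi>" by (rule ex_valuation[OF distinct_var_names])
    then have "Y_d (reduct k I) x u = {}" using Y_d_reduct_empty x u \<phi> by simp
    with y u show False by auto
  qed
  with x show "\<exists>x\<in>X_d (reduct k I). U_d (reduct k I) x = {}" by blast
next
  assume "\<exists>x\<in>X_d (reduct k I). U_d (reduct k I) x = {}"
  moreover have "(\<lambda>_. 0\<^sub>v (ny (reduct k I))) \<in> {1..1::nat} \<rightarrow> carrier_vec (ny (reduct k I))" by simp
  ultimately show "adaptable 1 (reduct k I)" unfolding adaptable_def by blast
qed

text \<open>Candidates may be arbitrary real vectors, but one outside the integral box lies in no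
  \<open>Y_d I x u\<close> and can be replaced by 0. This is why the candidates can become
  coordinates of the bounded integral set \<open>X_d\<close> of the new instance.\<close>

lemma adaptable_box:
  "adaptable k I \<longleftrightarrow> (\<exists>x\<in>X_d I. \<exists>y. (\<forall>i<k. y i \<in> int_box (bound I) (ny I)) \<and>
    (\<forall>u\<in>U_d I x. \<exists>i<k. y i \<in> Y_d I x u))"
proof
  assume "adaptable k I"
  then obtain x y where x: "x \<in> X_d I"
    and y: "\<forall>u\<in>U_d I x. y ` {1..k} \<inter> Y_d I x u \<noteq> {}"
    unfolding adaptable_def by blast
  \<comment> \<open>Candidates are numbered from 1 in \<open>adaptable\<close> and from 0
    here.\<close>
  let ?y = "\<lambda>i. if y (Suc i) \<in> int_box (bound I) (ny I) then y (Suc i) else 0\<^sub>v (ny I)"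
  have "\<exists>i<k. ?y i \<in> Y_d I x u" if "u \<in> U_d I x" for u
  proof -
    from y that obtain i where i: "i \<in> {1..k}" "y i \<in> Y_d I x u" by blast
    then have "y i \<in> int_box (bound I) (ny I)" by (simp add: Y_d_def)
    with i show ?thesis by (intro exI[of _ "i - 1"]) auto
  qed
  moreover have "0\<^sub>v (ny I) \<in> int_box (bound I) (ny I)" by (simp add: int_box_def)
  ultimately have "(\<forall>i<k. ?y i \<in> int_box (bound I) (ny I)) \<and> (\<forall>u\<in>U_d I x. \<exists>i<k. ?y i \<in> Y_d I x u)"
    by auto
  then show "\<exists>x\<in>X_d I. \<exists>y. (\<forall>i<k. y i \<in> int_box (bound I) (ny I)) \<and>
    (\<forall>u\<in>U_d I x. \<exists>i<k. y i \<in> Y_d I x u)" by (intro bexI[OF _ x] exI[of _ ?y])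
next
  assume "\<exists>x\<in>X_d I. \<exists>y. (\<forall>i<k. y i \<in> int_box (bound I) (ny I)) \<and>
    (\<forall>u\<in>U_d I x. \<exists>i<k. y i \<in> Y_d I x u)"
  then obtain x y where x: "x \<in> X_d I" and box: "\<forall>i<k. y i \<in> int_box (bound I) (ny I)"
    and y: "\<forall>u\<in>U_d I x. \<exists>i<k. y i \<in> Y_d I x u" by blast
  have "(\<lambda>i. y (i - 1)) \<in> {1..k} \<rightarrow> carrier_vec (ny I)" using box by (auto simp: int_box_def)
  moreover have "(\<lambda>i. y (i - 1)) ` {1..k} \<inter> Y_d I x u \<noteq> {}" if "u \<in> U_d I x" for u
  proof -
    from y that obtain i where i: "i < k" "y i \<in> Y_d I x u" by blast
    then have "y i \<in> (\<lambda>i. y (i - 1)) ` {1..k}" by (intro image_eqI[of _ _ "Suc i"]) auto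
    with i show ?thesis by blast
  qed
  ultimately show "adaptable k I" unfolding adaptable_def using x by blast
qed

theorem adaptable_reduct: "adaptable 1 (reduct k I) \<longleftrightarrow> adaptable k I"
proof -
  have "adaptable 1 (reduct k I) \<longleftrightarrow> (\<exists>\<phi>. valuation xn \<phi> \<in> X_d (reduct k I) \<and> U_d (reduct k I) (valuation xn \<phi>) = {})"
  proof -
    have "\<exists>\<phi>. x = valuation xn \<phi>" if "x \<in> X_d (reduct k I)" for x
    proof -
      have "x \<in> carrier_vec (length xn)" using that by (simp add: X_d_def int_box_def reduct_sel)
      then show ?thesis by (metis ex_valuation distinct_var_names)
    qed
    then show ?thesis unfolding adaptable_1_reduct by blast
  qed
  also have "\<dots> \<longleftrightarrow> (\<exists>\<phi> :: name \<Rightarrow> real. \<phi> (2, 0, 0) = 1 \<and> vec (nx I) (\<lambda>l. \<phi> (0, l, 0)) \<in> X_d I \<and>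
      (\<forall>i<k. vec (ny I) (\<lambda>j. \<phi> (1, i, j)) \<in> int_box (bound I) (ny I)) \<and>
      (\<forall>u\<in>U_d I (vec (nx I) (\<lambda>l. \<phi> (0, l, 0))). \<exists>i<k. vec (ny I) (\<lambda>j. \<phi> (1, i, j)) \<in>
        Y_d I (vec (nx I) (\<lambda>l. \<phi> (0, l, 0))) u))"
    by (rule iff_exI) (use U_d_reduct_empty_iff in \<open>auto simp: X_d_reduct\<close>)
  also have "\<dots> \<longleftrightarrow> adaptable k I"
    unfolding adaptable_box
  proof
    assume "\<exists>x\<in>X_d I. \<exists>y. (\<forall>i<k. y i \<in> int_box (bound I) (ny I)) \<and> (\<forall>u\<in>U_d I x. \<exists>i<k. y i \<in> Y_d I x u)"
    then obtain x y where x: "x \<in> X_d I" and box: "\<forall>i<k. y i \<in> int_box (bound I) (ny I)"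
      and y: "\<forall>u\<in>U_d I x. \<exists>i<k. y i \<in> Y_d I x u" by blast
    let ?\<phi> = "\<lambda>(t, i, j). if t = 0 then x $ i else if t = Suc 0 then y i $ j else 1 :: real"
    have "x \<in> carrier_vec (nx I)" using x by (simp add: X_d_def int_box_def)
    then have 1: "vec (nx I) (\<lambda>l. ?\<phi> (0, l, 0)) = x" by auto
    have 2: "vec (ny I) (\<lambda>j. ?\<phi> (1, i, j)) = y i" if "i < k" for i
    proof -
      have "y i \<in> carrier_vec (ny I)" using box that by (simp add: int_box_def)
      then show ?thesis by auto
    qed
    have "?\<phi> (2, 0, 0) = 1" by simp
    moreover have "\<exists>i<k. vec (ny I) (\<lambda>j. ?\<phi> (1, i, j)) \<in> Y_d I x u" if "u \<in> U_d I x" for u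
    proof -
      from y that obtain i where i: "i < k" "y i \<in> Y_d I x u" by blast
      show ?thesis by (rule exI[of _ i]) (simp only: 2[OF i(1)] i simp_thms)
    qed
    ultimately show "\<exists>\<phi> :: name \<Rightarrow> real. \<phi> (2, 0, 0) = 1 \<and> vec (nx I) (\<lambda>l. \<phi> (0, l, 0)) \<in> X_d I \<and>
      (\<forall>i<k. vec (ny I) (\<lambda>j. \<phi> (1, i, j)) \<in> int_box (bound I) (ny I)) \<and>
      (\<forall>u\<in>U_d I (vec (nx I) (\<lambda>l. \<phi> (0, l, 0))). \<exists>i<k. vec (ny I) (\<lambda>j. \<phi> (1, i, j)) \<in>
        Y_d I (vec (nx I) (\<lambda>l. \<phi> (0, l, 0))) u)"
      using x box by (intro exI[of _ ?\<phi>] conjI ballI allI impI) (simp_all only: 1 2)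
  next
    assume "\<exists>\<phi> :: name \<Rightarrow> real. \<phi> (2, 0, 0) = 1 \<and> vec (nx I) (\<lambda>l. \<phi> (0, l, 0)) \<in> X_d I \<and>
      (\<forall>i<k. vec (ny I) (\<lambda>j. \<phi> (1, i, j)) \<in> int_box (bound I) (ny I)) \<and>
      (\<forall>u\<in>U_d I (vec (nx I) (\<lambda>l. \<phi> (0, l, 0))). \<exists>i<k. vec (ny I) (\<lambda>j. \<phi> (1, i, j)) \<in>
        Y_d I (vec (nx I) (\<lambda>l. \<phi> (0, l, 0))) u)"
    then obtain \<phi> :: "name \<Rightarrow> real" where "vec (nx I) (\<lambda>l. \<phi> (0, l, 0)) \<in> X_d I"
      "\<forall>i<k. vec (ny I) (\<lambda>j. \<phi> (1, i, j)) \<in> int_box (bound I) (ny I)"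
      "\<forall>u\<in>U_d I (vec (nx I) (\<lambda>l. \<phi> (0, l, 0))). \<exists>i<k. vec (ny I) (\<lambda>j. \<phi> (1, i, j)) \<in>
        Y_d I (vec (nx I) (\<lambda>l. \<phi> (0, l, 0))) u" by blast
    then show "\<exists>x\<in>X_d I. \<exists>y. (\<forall>i<k. y i \<in> int_box (bound I) (ny I)) \<and> (\<forall>u\<in>U_d I x. \<exists>i<k. y i \<in> Y_d I x u)"
      by (intro bexI[of _ "vec (nx I) (\<lambda>l. \<phi> (0, l, 0))"] exI[of _ "\<lambda>i. vec (ny I) (\<lambda>j. \<phi> (1, i, j))"] conjI)
  qed
  finally show ?thesis .
qed

end

section \<open>The reduction runs in polynomial time\<close>

abbreviation "name_code \<equiv> enc_unary \<times>\<^sub>c enc_unary \<times>\<^sub>c enc_unary"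
abbreviation "row_code \<equiv> enc_list enc_rat"
abbreviation "mat_code \<equiv> enc_list row_code"
abbreviation "inst_code \<equiv> enc_unary \<times>\<^sub>c enc_unary \<times>\<^sub>c enc_unary \<times>\<^sub>c enc_unary \<times>\<^sub>c enc_unary \<times>\<^sub>c enc_unary \<times>\<^sub>c
  enc_nat \<times>\<^sub>c row_code \<times>\<^sub>c row_code \<times>\<^sub>c mat_code \<times>\<^sub>c mat_code \<times>\<^sub>c enc_list mat_code \<times>\<^sub>c enc_list mat_code"

text \<open>A nested tuple of numbers and lists, to which the combinators apply. By
  \<open>inst_code_tuple\<close> its code is literally the encoding of the instance, so no
  conversion has to be executed.\<close>

definition inst_tuple where
  "inst_tuple I = (nx I, nu I, ny I, mx I, mu I, my I, bound I, list_of_vec (a_vec I), list_of_vec (b_vec I),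
     mat_to_list (A_mat I), mat_to_list (W_mat I), map mat_to_list (B_mats I), map mat_to_list (T_mats I))"

lemma enc_list_map: "enc_list e (map f xs) = enc_list (\<lambda>x. e (f x)) xs"
  by (simp add: enc_list_def o_def)

lemma inst_code_tuple: "inst_code (inst_tuple I) = enc_inst I"
  by (simp add: inst_tuple_def enc_inst_def enc_vec_def enc_list_map enc_mat_def[abs_def])

lemmas fp_intros = fp_pair fp_fst fp_snd fp_ident fp_Cons fp_if fp_eq fp_conj fp_add fp_Suc fp_append
  fp_concat fp_upt fp_length fp_double_Suc fp_power2 fp_rat_of_nat fp_rat_inverse_power2 fp_rat_uminus
  fp_nth_default fp_map fp_const scannable_intros

lemma fp_lookup:
  assumes "fp UNIV e mat_code A" "fp UNIV e enc_unary i" "fp UNIV e enc_unary j" "scannable e"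
  shows "fp UNIV e enc_rat (\<lambda>z. lookup (A z) (i z) (j z))"
  unfolding lookup_def by (rule assms fp_nth_default scannable_intros)+

lemma fp_box_entry:
  assumes "fp UNIV e name_code \<rho>" "fp UNIV e name_code d" "scannable e"
  shows "fp UNIV e enc_rat (\<lambda>z. box_entry (\<rho> z) (d z))"
  unfolding box_entry_def by (rule assms fp_intros)+

lemma fp_x_entry:
  assumes "fp UNIV e mat_code A" "fp UNIV e name_code \<rho>" "fp UNIV e name_code d" "scannable e"
  shows "fp UNIV e enc_rat (\<lambda>z. x_entry (A z) (\<rho> z) (d z))"
  unfolding x_entry_def by (rule assms fp_lookup fp_box_entry fp_intros)+

lemma fp_u_entry:
  assumes "fp UNIV e (enc_list mat_code) B" "fp UNIV e (enc_list mat_code) T" "fp UNIV e mat_code W"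
    and "fp UNIV e enc_rat M" "fp UNIV e enc_rat \<epsilon>"
    and "fp UNIV e name_code d" "fp UNIV e name_code \<rho>" "fp UNIV e name_code c" "scannable e"
  shows "fp UNIV e enc_rat (\<lambda>z. u_entry (B z) (T z) (W z) (M z) (\<epsilon> z) (d z) (\<rho> z) (c z))"
  unfolding u_entry_def by (rule assms fp_lookup fp_box_entry fp_intros)+

lemma fp_rhs:
  assumes "fp UNIV e row_code v" "fp UNIV e enc_rat R" "fp UNIV e enc_rat s" "fp UNIV e enc_rat M"
    and "fp UNIV e name_code \<rho>" "scannable e"
  shows "fp UNIV e enc_rat (\<lambda>z. rhs (v z) (R z) (s z) (M z) (\<rho> z))"
  unfolding rhs_def by (rule assms fp_intros)+

lemma fp_var_names:
  assumes "fp UNIV e enc_unary n" "fp UNIV e enc_unary k" "fp UNIV e enc_unary m" "scannable e"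
  shows "fp UNIV e (enc_list name_code) (\<lambda>z. var_names (n z) (k z) (m z))"
proof -
  \<comment> \<open>\<open>name_code\<close>, a triple of unary numbers, serves here also as the
    code of the three parameters.\<close>
  have "fp UNIV name_code (enc_list name_code) (\<lambda>p. var_names (fst p) (fst (snd p)) (snd (snd p)))"
    unfolding var_names_def by (rule fp_intros)+
  from fp_o[OF this fp_pair[OF assms(1) fp_pair[OF assms(2-4)] assms(4)]] show ?thesis by simp
qed

lemma fp_row_names:
  assumes "fp UNIV e enc_unary m" "fp UNIV e (enc_list name_code) X" "scannable e"
  shows "fp UNIV e (enc_list name_code) (\<lambda>z. row_names (m z) (X z))"
proof -
  have "fp UNIV (enc_unary \<times>\<^sub>c enc_list name_code) (enc_list name_code) (\<lambda>p. row_names (fst p) (snd p))"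
    unfolding row_names_def by (rule fp_intros)+
  from fp_o[OF this fp_pair[OF assms]] show ?thesis by simp
qed

lemma fp_claim_names:
  assumes "fp UNIV e enc_unary k" "fp UNIV e enc_unary m" "scannable e"
  shows "fp UNIV e (enc_list name_code) (\<lambda>z. claim_names (k z) (m z))"
proof -
  have "fp UNIV (enc_unary \<times>\<^sub>c enc_unary) (enc_list name_code) (\<lambda>p. claim_names (fst p) (snd p))"
    unfolding claim_names_def by (rule fp_intros)+
  from fp_o[OF this fp_pair[OF assms]] show ?thesis by simp
qed

text \<open>Name lists and constants recur throughout the new instance. Once they are stored in a
  tuple, \<open>assemble\<close> reaches them by projections.\<close>

definition prepare where
  "prepare = (\<lambda>(k, t). case t of (n, n', n'', m, m', m'', R, _) \<Rightarrow>
    (let L = length (inst_code t); X = var_names n k n''; U = var_names n' k m''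
     in (X, U, row_names m X, row_names m' U @ claim_names k m'',
         rat_of_nat (2 ^ (L + L + L + L + L + L)), 1 / 2 ^ L :: rat, rat_of_nat R, t)))"

abbreviation "prepared_code \<equiv> enc_list name_code \<times>\<^sub>c enc_list name_code \<times>\<^sub>c enc_list name_code \<times>\<^sub>c
  enc_list name_code \<times>\<^sub>c enc_rat \<times>\<^sub>c enc_rat \<times>\<^sub>c enc_rat \<times>\<^sub>c inst_code"

lemma fp_prepare: "fp UNIV (enc_unary \<times>\<^sub>c inst_code) prepared_code prepare"
  unfolding prepare_def split_def Let_def
  by (rule fp_length_enc fp_var_names fp_row_names fp_claim_names fp_intros)+

definition assemble where
  "assemble = (\<lambda>(X, U, XR, UR, M, \<epsilon>, R, n, n', n'', m, m', m'', bd, a, b, A, W, B, T).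
    (length X, length U, 0 :: nat, length XR, length UR, 1 :: nat, Suc (2 * bd),
     map (\<lambda>\<rho>. rhs a R R M \<rho>) XR, map (\<lambda>\<rho>. rhs b R 1 M \<rho>) UR,
     map (\<lambda>\<rho>. map (\<lambda>d. x_entry A \<rho> d) X) XR, [[] :: rat list],
     map (\<lambda>d. map (\<lambda>\<rho>. map (\<lambda>c. u_entry B T W M \<epsilon> d \<rho> c) U) UR) X,
     map (\<lambda>_. [map (\<lambda>_. 1 :: rat) X]) U))"

lemma fp_assemble: "fp UNIV prepared_code inst_code assemble"
  unfolding assemble_def split_def
  by (rule fp_rhs fp_x_entry fp_u_entry fp_intros)+

lemma mat_to_list_table_mat: "mat_to_list (table_mat R C g) = map (\<lambda>r. map (\<lambda>c. g r c) C) R"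
  by (rule nth_equalityI) (auto simp: mat_to_list_def table_mat_def intro!: nth_equalityI)

lemma assemble_prepare: "assemble (prepare (k, inst_tuple I)) = inst_tuple (reduct k I)"
proof -
  have "prepare (k, inst_tuple I) =
    (let L = length (enc_inst I); X = var_names (nx I) k (ny I); U = var_names (nu I) k (my I)
     in (X, U, row_names (mx I) X, row_names (mu I) U @ claim_names k (my I),
         rat_of_nat (2 ^ (L + L + L + L + L + L)), 1 / 2 ^ L, rat_of_nat (bound I), inst_tuple I))"
    by (simp only: prepare_def prod.case inst_code_tuple Let_def) (simp only: inst_tuple_def prod.case)
  then show ?thesis
    by (simp only: Let_def assemble_def inst_tuple_def prod.case reduct_def adapt_inst.select_convs
        mat_to_list_table_mat list_vec map_map o_def list.map)
qed

lemma length_bits_le: "length (bits n) \<le> n"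
proof (induction n rule: less_induct)
  case (less n)
  show ?case
  proof (cases "n = 0")
    case False
    then have "length (bits (n div 2)) \<le> n div 2" by (intro less) auto
    moreover have "bits n = odd n # bits (n div 2)" using False by (subst bits.simps) simp
    ultimately show ?thesis using False by simp
  qed auto
qed

text \<open>The domain consists only of pairs built from instances, because only for these is the
  decoded number polynomially bounded and its unary form short enough to be written down.
  \<open>?k\<close> recovers that number from its binary expansion.\<close>

lemma fp_reduct:
  assumes "\<And>I. I \<in> adapt_insts \<Longrightarrow> K I \<le> poly p (length (enc_inst I))"
  shows "\<exists>c q. \<forall>I\<in>adapt_insts. \<forall>s. s 0 = enc_list bool_code (rev (bits (K I))) @ enc_inst I \<longrightarrow>
    exec c s (poly q (2 * length (bits (K I)) + 1 + length (enc_inst I))) (s(0 := enc_inst (reduct (K I) I)))"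
proof -
  let ?C = "enc_list bool_code \<times>\<^sub>c inst_code"
  let ?a = "\<lambda>I. (rev (bits (K I)), inst_tuple I)"
  let ?S = "?a ` adapt_insts"
  let ?k = "\<lambda>z. inv_into UNIV bits (rev (fst z))"
  have k: "?k (?a I) = K I" for I
    by (simp add: inv_into_f_f[OF inj_bits])
  have "fp ?S ?C (enc_list bool_code) (\<lambda>z. fst z)"
    by (rule fp_fst fp_ident scannable_intros)+
  then have "fp ?S ?C (enc_list bool_code) (\<lambda>z. rev (bits (?k z)))"
    by (rule fp_cong) (auto simp: k[simplified])
  moreover have "size_bounded ?S ?C ?k"
    unfolding size_bounded_def
  proof (intro exI[of _ p] ballI)
    fix z assume "z \<in> ?S"
    then obtain I where I: "I \<in> adapt_insts" "z = ?a I" by blast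
    have "?k z \<le> poly p (length (enc_inst I))" using assms I k by simp
    also have "\<dots> \<le> poly p (length (?C z))"
      unfolding I(2) by (subst pair_code_simp) (rule poly_mono_nat, simp add: inst_code_tuple del: pair_code_simp)
    finally show "?k z \<le> \<dots>" .
  qed
  ultimately have k_fp: "fp ?S ?C enc_unary ?k"
    by (rule fp_unary_of_bits) (rule scannable_intros)+
  have "fp ?S ?C (enc_unary \<times>\<^sub>c inst_code) (\<lambda>z. (?k z, snd z))"
    by (rule k_fp fp_pair fp_snd fp_ident scannable_intros)+
  from fp_o[OF fp_assemble fp_o[OF fp_prepare this]]
  obtain c q where c: "\<And>a s r. a \<in> ?S \<Longrightarrow> s 0 = ?C a @ r \<Longrightarrow>
      exec c s (poly q (length (?C a))) (s(0 := inst_code (assemble (prepare (?k a, snd a))) @ r))"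
    by (elim fpE) blast
  have code: "?C (?a I) = enc_list bool_code (rev (bits (K I))) @ enc_inst I" for I
    by (subst pair_code_simp) (simp only: inst_code_tuple)
  have len: "length (?C (?a I)) = 2 * length (bits (K I)) + 1 + length (enc_inst I)" for I
    by (simp add: code length_enc_list bool_code_def sum_list_triv del: pair_code_simp)
  show ?thesis
  proof (intro exI ballI allI impI)
    fix I and s :: store
    assume I: "I \<in> adapt_insts" and s: "s 0 = enc_list bool_code (rev (bits (K I))) @ enc_inst I"
    have "exec c s (poly q (length (?C (?a I)))) (s(0 := inst_code (assemble (prepare (?k (?a I), snd (?a I)))) @ []))"
      by (rule c) (use I s in \<open>auto simp: code simp del: pair_code_simp\<close>)
    then show "exec c s (poly q (2 * length (bits (K I)) + 1 + length (enc_inst I))) (s(0 := enc_inst (reduct (K I) I)))"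
      unfolding len k snd_conv assemble_prepare inst_code_tuple append_Nil2 .
  qed
qed

section \<open>Assembling the machine\<close>

text \<open>The machine for \<open>K\<close> may overwrite its input, so a copy goes to the last
  tape first. State 0 copies up to the blank behind the word, state 1 runs back to the blank in
  front of it, and the final step moves both heads right onto the first symbol.\<close>

definition copy_tm :: "nat \<Rightarrow> tm" where
  "copy_tm N = \<lparr>tapes = N, states = 2, delta = (\<lambda>q ss.
     let mv = (if q = 0 \<longleftrightarrow> hd ss \<noteq> None then Move_Right else Move_Left)
     in (if hd ss \<noteq> None then q else Suc q,
         (hd ss, mv) # idle (butlast (tl ss)) @ [(if q = 0 then hd ss else last ss, mv)]))\<rparr>"

lemma copy_tm_sel [simp]: "tapes (copy_tm N) = N" "states (copy_tm N) = 2"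
  by (simp_all add: copy_tm_def)

lemma wf_copy_tm: "2 \<le> N \<Longrightarrow> wf_tm (copy_tm N)"
  by (auto simp: wf_tm_def copy_tm_def Let_def)

definition tape_at :: "bool list \<Rightarrow> int \<Rightarrow> tape" where
  "tape_at w i = \<lparr>cell = cell (word_tape w), pos = i\<rparr>"

lemma tape_at_0: "tape_at w 0 = word_tape w" "tape_at [] 0 = blank_tape"
  by (auto simp: tape_at_def word_tape_def blank_tape_def)

lemma scan_tape_at: "scan (tape_at w i) = (if 0 \<le> i \<and> i < int (length w) then Some (w ! nat i) else None)"
  by (simp add: scan_def tape_at_def word_tape_def)

lemma step_copy_tm:
  assumes "q < 2" "length ts = N - 2" "2 \<le> N"
  shows "step (copy_tm N) (q, a # ts @ [b]) =
    (let mv = (if q = 0 \<longleftrightarrow> scan a \<noteq> None then Move_Right else Move_Left)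
     in (if scan a \<noteq> None then q else Suc q,
         act (scan a, mv) a # ts @ [act (if q = 0 then scan a else scan b, mv) b]))"
  using assms by (simp add: step_def copy_tm_def Let_def)

lemma act_scan: "act (scan a, mv) a = a\<lparr>pos := pos a + move_offset mv\<rparr>"
  by (simp add: act_def scan_def)

lemma copy_forward:
  assumes "length ts = N - 2" "2 \<le> N" "n \<le> length w"
  shows "(step (copy_tm N) ^^ n) (0, word_tape w # ts @ [blank_tape]) =
    (0, tape_at w (int n) # ts @ [tape_at (take n w) (int n)])"
  using assms(3)
proof (induction n)
  case 0
  have "word_tape [] = blank_tape" by (auto simp: word_tape_def blank_tape_def fun_eq_iff)
  then show ?case by (simp add: tape_at_0)
next
  case (Suc n)
  have s: "scan (tape_at w (int n)) = Some (w ! n)"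
    using Suc.prems by (simp add: scan_tape_at)
  have "(cell (word_tape (take n w)))(int n := Some (w ! n)) = cell (word_tape (take (Suc n) w))"
    using Suc.prems by (intro ext) (auto simp: word_tape_def)
  then have "act (Some (w ! n), Move_Right) (tape_at (take n w) (int n)) = tape_at (take (Suc n) w) (int (Suc n))"
    by (simp add: act_def tape_at_def)
  moreover have "act (Some (w ! n), Move_Right) (tape_at w (int n)) = tape_at w (int (Suc n))"
    using act_scan[of "tape_at w (int n)" Move_Right] s by (simp add: tape_at_def)
  ultimately show ?case
    using Suc assms(1,2) by (simp add: step_copy_tm s Let_def)
qed

text \<open>\<open>n\<close> steps lead from position \<open>n - 1\<close> to position -1, and one
  more enters the halting state at position 0.\<close>

lemma copy_backward:
  assumes "length ts = N - 2" "2 \<le> N" "n \<le> length w"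
  shows "(step (copy_tm N) ^^ Suc n) (1, tape_at w (int n - 1) # ts @ [tape_at w (int n - 1)]) =
    (2, word_tape w # ts @ [word_tape w])"
  using assms(3)
proof (induction n)
  case 0
  have "scan (tape_at w (- 1)) = None" by (simp add: scan_tape_at)
  with act_scan[of "tape_at w (- 1)" Move_Right] show ?case
    using assms(1,2) by (simp add: step_copy_tm Let_def tape_at_0[symmetric]) (simp add: tape_at_def)
next
  case (Suc n)
  have s: "scan (tape_at w (int n)) = Some (w ! n)"
    using Suc.prems by (simp add: scan_tape_at)
  have "act (Some (w ! n), Move_Left) (tape_at w (int n)) = tape_at w (int n - 1)"
    using act_scan[of "tape_at w (int n)" Move_Left] s by (simp add: tape_at_def)
  then have "step (copy_tm N) (1, tape_at w (int n) # ts @ [tape_at w (int n)]) =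
      (1, tape_at w (int n - 1) # ts @ [tape_at w (int n - 1)])"
    using assms(1,2) by (simp add: step_copy_tm s Let_def)
  with Suc show ?case by (simp add: funpow_swap1)
qed

lemma halts_in_copy_tm:
  assumes "length ts = N - 2" "2 \<le> N"
  shows "halts_in (copy_tm N) (word_tape w # ts @ [blank_tape]) (2 * length w + 2) (word_tape w # ts @ [word_tape w])"
proof -
  let ?n = "length w" and ?M = "copy_tm N"
  have "scan (tape_at w (int ?n)) = None" by (simp add: scan_tape_at)
  with act_scan[of "tape_at w (int ?n)" Move_Left]
  have "step ?M (0, tape_at w (int ?n) # ts @ [tape_at w (int ?n)]) =
      (1, tape_at w (int ?n - 1) # ts @ [tape_at w (int ?n - 1)])"
    using assms by (simp add: step_copy_tm Let_def) (simp add: tape_at_def)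
  then have "(step ?M ^^ (Suc ?n + (Suc 0 + ?n))) (0, word_tape w # ts @ [blank_tape]) =
      (2, word_tape w # ts @ [word_tape w])"
    using copy_forward[OF assms, of ?n w] copy_backward[OF assms, of ?n w]
    by (simp only: funpow_add o_apply) simp
  then show ?thesis unfolding halts_in_def copy_tm_sel by (intro exI[of _ "Suc ?n + (Suc 0 + ?n)"]) simp
qed

definition embed_tm :: "nat \<Rightarrow> tm \<Rightarrow> tm" where
  "embed_tm m M = \<lparr>tapes = tapes M + m, states = states M, delta = (\<lambda>q ss.
     (fst (delta M q (take (tapes M) ss)), snd (delta M q (take (tapes M) ss)) @ idle (drop (tapes M) ss)))\<rparr>"

lemma embed_tm_sel [simp]: "tapes (embed_tm m M) = tapes M + m" "states (embed_tm m M) = states M"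
  by (simp_all add: embed_tm_def)

lemma wf_embed_tm:
  assumes "wf_tm M"
  shows "wf_tm (embed_tm m M)"
  using assms wf_tmD[OF assms] by (auto simp: wf_tm_def embed_tm_def)

lemma halts_in_embed_tm:
  assumes "wf_tm M" "halts_in M ts t ts'" "length ts = tapes M" "length us = m"
  shows "halts_in (embed_tm m M) (ts @ us) t (ts' @ us)"
proof -
  obtain n where n: "n \<le> t" "(step M ^^ n) (0, ts) = (states M, ts')"
    using assms(2) by (auto simp: halts_in_def)
  have "\<exists>n'\<le>n. (step (embed_tm m M) ^^ n') ((\<lambda>q. q) 0, ts @ us) = ((\<lambda>q. q) (states M), ts' @ us)"
    by (rule simulate[OF assms(1) _ assms(3,4) _ n(2)]) (auto simp: embed_tm_def)
  with n show ?thesis unfolding halts_in_def by (auto intro: le_trans)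
qed

lemma length_halts_in:
  assumes "wf_tm M" "halts_in M ts t ts'" "length ts = tapes M"
  shows "length ts' = tapes M"
proof -
  have "length (snd ((step M ^^ n) (q, ts))) = tapes M" if "length ts = tapes M" "q \<le> states M" for n q ts
    using that
  proof (induction n arbitrary: q ts)
    case (Suc n)
    show ?case
    proof (cases "q < states M")
      case True
      from wf_tmD[OF assms(1) True, of "map scan ts"] Suc show ?thesis
        by (auto simp: funpow_swap1 step_def split: prod.splits)
    qed (use Suc in \<open>auto simp: funpow_swap1 step_def\<close>)
  qed auto
  with assms(2,3) show ?thesis unfolding halts_in_def by (metis le0 snd_conv)
qed

text \<open>The output of the machine for \<open>K\<close> is delimited only by a blank; here it
  becomes a self-delimiting word on top of the saved input. Moving it bit by bit reverses it, which
  yields the order that Horner's scheme needs.\<close>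

definition mark_bits :: cmd where
  "mark_bits = Push 0 False ;; Loop 4 {Some True, Some False} (Cond 4 {Some True}
     (Pop 4 ;; Push 0 True ;; Push 0 True) (Pop 4 ;; Push 0 False ;; Push 0 True))"

lemma exec_mark_bits:
  assumes "s 4 = v"
  shows "exec mark_bits s (12 * length v + 3) (s(0 := enc_list bool_code (rev v) @ s 0, 4 := []))"
proof -
  let ?c = "Cond 4 {Some True} (Pop 4 ;; Push 0 True ;; Push 0 True) (Pop 4 ;; Push 0 False ;; Push 0 True)"
  have loop: "exec (Loop 4 {Some True, Some False} ?c) s (12 * length v + 1)
      (s(0 := enc_list bool_code (rev v @ w) @ r, 4 := []))"
    if "s 4 = v" "s 0 = enc_list bool_code w @ r" for s v w r
    using that
  proof (induction v arbitrary: s w)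
    case Nil
    then show ?case using exec_Loop_stop[of 4 s "{Some True, Some False}" ?c] by (simp add: fun_upd_idem)
  next
    case (Cons b v)
    let ?s = "s(4 := v, 0 := True # b # s 0)"
    have 1: "exec ?c s 11 ?s"
      by (rule exec_straightI) (use Cons.prems in \<open>auto simp: fun_upd_twist\<close>)
    have 2: "exec (Loop 4 {Some True, Some False} ?c) ?s (12 * length v + 1)
        (?s(0 := enc_list bool_code (rev v @ b # w) @ r, 4 := []))"
      by (rule Cons.IH) (use Cons.prems in \<open>auto simp: bool_code_def\<close>)
    show ?case
      by (rule exec_cong[OF exec_Loop_step[OF _ _ 1 2]])
        (use Cons.prems in \<open>auto simp: fun_upd_twist\<close>)
  qed
  let ?s = "s(0 := False # s 0)"
  have "exec (Push 0 False) s 2 ?s" by (rule exec_straightI) auto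
  moreover have "exec (Loop 4 {Some True, Some False} ?c) ?s (12 * length v + 1)
      (?s(0 := enc_list bool_code (rev v @ []) @ s 0, 4 := []))"
    by (rule loop) (use assms in auto)
  ultimately show ?thesis unfolding mark_bits_def by (auto intro: exec_SeqI)
qed

lemma presents_word_tape: "presents (word_tape w) w"
  by (simp add: presents_def word_tape_def)

lemma presents_blank_tape: "presents blank_tape []"
  by (simp add: presents_def blank_tape_def)

lemma computes_withinI:
  assumes "halts_in M ts t ts'" "init_config M w = (0, ts)" "presents (last ts') v" "t \<le> t'"
  shows "computes_within M w v t'"
proof -
  obtain n where n: "n \<le> t" "(step M ^^ n) (0, ts) = (states M, ts')"
    using assms(1) by (auto simp: halts_in_def)
  show ?thesis unfolding computes_within_def
    by (rule exI[of _ n]) (use n assms in simp)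
qed

theorem polytime_reduct:
  assumes "polytime_computable adapt_insts enc_inst bits K" "polynomial_in_input K"
  shows "polytime_computable adapt_insts enc_inst enc_inst (\<lambda>I. reduct (K I) I)"
proof -
  obtain M p where M: "wf_tm M"
    and comp: "\<And>I. I \<in> adapt_insts \<Longrightarrow> computes_within M (enc_inst I) (bits (K I)) (poly p (length (enc_inst I)))"
    using assms(1) unfolding polytime_computable_def by blast
  obtain pK :: "nat poly" where pK: "\<And>I. I \<in> adapt_insts \<Longrightarrow> K I \<le> poly pK (length (enc_inst I))"
    using assms(2) unfolding polynomial_in_input_def by blast
  obtain c q where c: "\<And>I s. I \<in> adapt_insts \<Longrightarrow> s 0 = enc_list bool_code (rev (bits (K I))) @ enc_inst I \<Longrightarrow>
    exec c s (poly q (2 * length (bits (K I)) + 1 + length (enc_inst I))) (s(0 := enc_inst (reduct (K I) I)))"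
    using fp_reduct[OF pK] by blast
  have m: "1 \<le> tapes M" using M by (simp add: wf_tm_def)
  \<comment> \<open>The registers are the last five tapes. Four additional tapes make register 4 the
    output tape of \<open>M\<close>, while register 0 is the last tape, with the saved
    input.\<close>
  define N where "N = tapes M + 4"
  let ?M = "seq_tm (copy_tm N) (seq_tm (embed_tm 4 M) (compile N (mark_bits ;; c)))"
  \<comment> \<open>The summands pay for copying the input, running \<open>M\<close>, marking the
    bits of \<open>K I\<close> and the stack program. The number of bits is at most
    \<open>K I\<close>, hence bounded by \<open>pK\<close>.\<close>
  let ?p = "[:5, 2:] + p + smult 12 pK + pcompose q ([:1, 1:] + smult 2 pK)"
  have wf: "wf_tm (copy_tm N)" "wf_tm (embed_tm 4 M)" "wf_tm (compile N (mark_bits ;; c))"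
    by (rule wf_copy_tm wf_embed_tm M wf_compile; simp add: N_def M)+
  have wf': "wf_tm (seq_tm (embed_tm 4 M) (compile N (mark_bits ;; c)))"
    by (rule wf_seq_tm[OF wf(2,3)]) (simp add: N_def)
  have "wf_tm ?M" by (rule wf_seq_tm[OF wf(1) wf']) (simp add: N_def)
  moreover have "computes_within ?M (enc_inst I) (enc_inst (reduct (K I) I)) (poly ?p (length (enc_inst I)))"
    if I: "I \<in> adapt_insts" for I
  proof -
    let ?w = "enc_inst I"
    let ?n = "length ?w"
    let ?k = "length (bits (K I))"
    obtain t where t: "t \<le> poly p ?n"
      and final: "case (step M ^^ t) (init_config M ?w) of (q, ts) \<Rightarrow> q = states M \<and> presents (last ts) (bits (K I))"
      using comp[OF I] unfolding computes_within_def by (elim exE conjE) (rule that)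
    obtain q' ts where ts: "(step M ^^ t) (init_config M ?w) = (q', ts)" by force
    from final have q': "q' = states M" and out: "presents (last ts) (bits (K I))" by (simp_all add: ts)
    let ?in = "word_tape ?w # replicate (tapes M - 1) blank_tape"
    let ?rest = "replicate 3 blank_tape @ [word_tape ?w]"
    have hM: "halts_in M ?in (poly p ?n) ts"
      unfolding halts_in_def using t ts[unfolded q' init_config_def] by blast
    have len_in: "length ?in = tapes M" using m by simp
    have len_ts: "length ts = tapes M" by (rule length_halts_in[OF M hM len_in])
    have h1: "halts_in (copy_tm N) (word_tape ?w # replicate (N - 2) blank_tape @ [blank_tape]) (2 * ?n + 2)
        (word_tape ?w # replicate (N - 2) blank_tape @ [word_tape ?w])"
      by (rule halts_in_copy_tm) (auto simp: N_def)
    have eq: "word_tape ?w # replicate (N - 2) blank_tape @ [word_tape ?w] = ?in @ ?rest"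
    proof -
      have "N - 2 = (tapes M - 1) + 3" using m by (simp add: N_def)
      then show ?thesis by (simp only: replicate_add append_Cons append_assoc)
    qed
    have h2: "halts_in (embed_tm 4 M) (?in @ ?rest) (poly p ?n) (ts @ ?rest)"
      by (rule halts_in_embed_tm[OF M hM len_in]) simp
    let ?s = "\<lambda>r::nat. if r = 0 then ?w else if r = 4 then bits (K I) else []"
    have rep: "represents N (ts @ ?rest) ?s"
      unfolding represents_def
    proof (intro conjI allI impI)
      show "length (ts @ ?rest) = N" using len_ts by (simp add: N_def)
      fix r :: nat assume "r < 5"
      then consider "r = 0" | "r = 1" | "r = 2" | "r = 3" | "r = 4" by linarith
      then show "presents ((ts @ ?rest) ! (N - 1 - r)) (?s r)"
      proof cases
        case 5
        have "ts \<noteq> []" using m len_ts by auto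
        then have "last ts = ts ! (tapes M - 1)" by (simp add: last_conv_nth len_ts)
        moreover have "N - 1 - r = tapes M - 1" using 5 by (simp add: N_def)
        ultimately have "(ts @ ?rest) ! (N - 1 - r) = last ts" using m len_ts by (simp add: nth_append)
        with out 5 show ?thesis by simp
      qed (use len_ts in \<open>auto simp: N_def nth_append presents_word_tape presents_blank_tape numeral_3_eq_3\<close>)
    qed
    let ?s1 = "?s(0 := enc_list bool_code (rev (bits (K I))) @ ?w, 4 := [])"
    let ?s2 = "?s1(0 := enc_inst (reduct (K I) I))"
    have "exec mark_bits ?s (12 * ?k + 3) ?s1"
      using exec_mark_bits[of ?s "bits (K I)"] by simp
    moreover have "exec c ?s1 (poly q (2 * ?k + 1 + ?n)) ?s2" by (rule c[OF I]) simp
    ultimately have "exec (mark_bits ;; c) ?s (12 * ?k + 3 + poly q (2 * ?k + 1 + ?n)) ?s2"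
      by (rule exec_Seq)
    from compile_correct[OF this rep] obtain us
      where h3: "halts_in (compile N (mark_bits ;; c)) (ts @ ?rest) (12 * ?k + 3 + poly q (2 * ?k + 1 + ?n)) us"
        and us: "represents N us ?s2" using m by (auto simp: N_def)
    have "halts_in (seq_tm (embed_tm 4 M) (compile N (mark_bits ;; c))) (?in @ ?rest)
        (poly p ?n + (12 * ?k + 3 + poly q (2 * ?k + 1 + ?n))) us"
      by (rule halts_in_seq_tm[OF wf(2,3) _ _ _ h2 h3]) (use m len_ts in \<open>auto simp: N_def\<close>)
    from halts_in_seq_tm[OF wf(1) wf' _ _ _ h1[unfolded eq] this]
    have "halts_in ?M (word_tape ?w # replicate (N - 2) blank_tape @ [blank_tape])
        (2 * ?n + 2 + (poly p ?n + (12 * ?k + 3 + poly q (2 * ?k + 1 + ?n)))) us"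
      using m by (simp add: N_def)
    moreover have "init_config ?M ?w = (0, word_tape ?w # replicate (N - 2) blank_tape @ [blank_tape])"
    proof -
      have "N - 1 = Suc (N - 2)" by (simp add: N_def)
      then show ?thesis by (simp add: init_config_def replicate_append_same[symmetric])
    qed
    moreover have "presents (last us) (enc_inst (reduct (K I) I))"
    proof -
      have len_us: "length us = N" using us by (simp add: represents_def)
      then have "us \<noteq> []" by (auto simp: N_def)
      then have "last us = us ! (N - 1 - 0)" by (simp add: last_conv_nth len_us)
      moreover have "presents (us ! (N - 1 - 0)) (?s2 0)"
        using us unfolding represents_def by (elim conjE allE[of _ 0] impE) simp
      ultimately show ?thesis by simp
    qed
    moreover have "2 * ?n + 2 + (poly p ?n + (12 * ?k + 3 + poly q (2 * ?k + 1 + ?n))) \<le> poly ?p ?n"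
    proof -
      have "?k \<le> poly pK ?n" using length_bits_le[of "K I"] pK[OF I] by simp
      moreover from this have "poly q (2 * ?k + 1 + ?n) \<le> poly q (1 + ?n + 2 * poly pK ?n)"
        by (intro poly_mono_nat) simp
      ultimately show ?thesis by (simp add: poly_pcompose)
    qed
    ultimately show ?thesis by (rule computes_withinI)
  qed
  ultimately show ?thesis unfolding polytime_computable_def by blast
qed

text \<open>Computability of \<open>K\<close> lets the reduction determine the number of candidates,
  and the polynomial bound lets it write all of them down.\<close>

theorem theorem2:
  fixes K :: "adapt_inst \<Rightarrow> nat"
  assumes "polytime_computable adapt_insts enc_inst bits K"
    and "polynomial_in_input K"
  shows "bounded_adaptability K \<le>\<^sub>p bounded_adaptability (\<lambda>_. 1)"
  unfolding polytime_reducible_def bounded_adaptability_def decision_problem.select_convs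
proof (intro exI conjI ballI)
  show "(\<lambda>I. reduct (K I) I) \<in> adapt_insts \<rightarrow> adapt_insts"
    by (simp add: reduct_in_adapt_insts)
  show "polytime_computable adapt_insts enc_inst enc_inst (\<lambda>I. reduct (K I) I)"
    by (rule polytime_reduct[OF assms])
  fix I assume "I \<in> adapt_insts"
  then interpret adapt I "K I" by unfold_locales
  show "adaptable (K I) I \<longleftrightarrow> adaptable 1 (reduct (K I) I)"
    by (rule adaptable_reduct[symmetric])
qed

end
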